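(* Let $k$ be a field, $n\ge1$, $\lambda\in k^\times$, and let $\boldsymbol p=(p_{ij})\in M_n(k^\times)$ be multiplicatively antisymmetric. Let $\Lambda$ be the $n^2\times n^2$ multiplicatively antisymmetric matrix over $k$, with rows and columns indexed by pairs $(i,a)$, $1\le i,a\le n$, in lexicographic order, with entries $$\Lambda_{(i,a),(i,b)}=p_{ba};\qquad \Lambda_{(i,a),(j,b)}=\begin{cases}\lambda p_{ij}p_{ba},&a\le b\\ p_{ij}p_{ba},&a>b\end{cases}\ (i>j);\qquad \Lambda_{(i,a),(j,b)}=\begin{cases}\lambda^{-1}p_{ij}p_{ba},&a\ge b\\ p_{ij}p_{ba},&a<b\end{cases}\ (i<j).$$ Then $$\operatorname{Fract}\mathcal O_{\lambda,\boldsymbol p}(M_n(k))\cong\operatorname{Fract}\mathcal O_\Lambda(k^{n^2}).$$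
   Context: $k$ has arbitrary characteristic. A matrix $(\lambda_{ij})$ over $k^\times$ is multiplicatively antisymmetric if $\lambda_{ii}=1$ and $\lambda_{ji}=\lambda_{ij}^{-1}$. The multiparameter coordinate ring of quantum $n\times n$ matrices $\mathcal O_{\lambda,\boldsymbol p}(M_n(k))$ is the $k$-algebra with generators $x_{ij}$ ($1\le i,j\le n$) and relations: $x_{\ell m}x_{ij}=p_{\ell i}p_{jm}x_{ij}x_{\ell m}+(\lambda-1)p_{\ell i}x_{im}x_{\ell j}$ if $\ell>i$, $m>j$; $x_{\ell m}x_{ij}=\lambda p_{\ell i}p_{jm}x_{ij}x_{\ell m}$ if $\ell>i$, $m\le j$; $x_{\ell m}x_{ij}=p_{jm}x_{ij}x_{\ell m}$ if $\ell=i$, $m>j$. For multiplicatively antisymmetric $\boldsymbol\lambda\in M_N(k^\times)$, $\mathcal O_{\boldsymbol\lambda}(k^N)$ is the $k$-algebra with generators $z_1,\dots,z_N$ and relations $z_iz_j=\lambda_{ij}z_jz_i$. $\operatorname{Fract}$ is the division ring of fractions. *)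

theory Defs
  imports "HOL-Algebra.Module" "HOL-Algebra.QuotRing" "HOL-Algebra.Algebraic_Closure_Type" "HOL-Library.Poly_Mapping"
begin

section \<open>Associative algebras over a field\<close>

text \<open>The locale \<open>algebra\<close> of HOL-Algebra only covers commutative algebras.\<close>

locale assoc_algebra = module R A + A?: ring A for R and A (structure) +
  assumes smult_mult_left:
      "\<lbrakk>c \<in> carrier R; x \<in> carrier A; y \<in> carrier A\<rbrakk> \<Longrightarrow> (c \<odot>\<^bsub>A\<^esub> x) \<otimes>\<^bsub>A\<^esub> y = c \<odot>\<^bsub>A\<^esub> (x \<otimes>\<^bsub>A\<^esub> y)"
    and smult_mult_right:
      "\<lbrakk>c \<in> carrier R; x \<in> carrier A; y \<in> carrier A\<rbrakk> \<Longrightarrow> x \<otimes>\<^bsub>A\<^esub> (c \<odot>\<^bsub>A\<^esub> y) = c \<odot>\<^bsub>A\<^esub> (x \<otimes>\<^bsub>A\<^esub> y)"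

text \<open>The ground field is a type of class \<open>field\<close>, viewed as a ring with full carrier.\<close>

definition k_algebra :: "('k::field, 'a) module \<Rightarrow> bool" where
  "k_algebra A \<longleftrightarrow> assoc_algebra (ring_of_type_algebra :: 'k ring) A"

definition algebra_hom :: "('k, 'a) module \<Rightarrow> ('k, 'b) module \<Rightarrow> ('a \<Rightarrow> 'b) set" where
  "algebra_hom A B =
     {h \<in> ring_hom A B. \<forall>c. \<forall>x\<in>carrier A. h (c \<odot>\<^bsub>A\<^esub> x) = c \<odot>\<^bsub>B\<^esub> h x}"

definition algebra_isomorphic :: "('k, 'a) module \<Rightarrow> ('k, 'b) module \<Rightarrow> bool"
    (infix \<open>\<cong>\<^sub>k\<close> 50) where
  "A \<cong>\<^sub>k B \<longleftrightarrow> (\<exists>h \<in> algebra_hom A B. bij_betw h (carrier A) (carrier B))"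


section \<open>Algebras given by generators and relations\<close>

text \<open>The free monoid, written additively so that the monoid algebra structure of
  \<open>Poly_Mapping\<close> applies: \<open>'g word \<Rightarrow>\<^sub>0 'k\<close> is the free \<open>'k\<close>-algebra on \<open>'g\<close>.\<close>

datatype 'g word = Word (letters: "'g list")

instantiation word :: (type) monoid_add
begin

definition zero_word :: "'a word" where
  "0 = Word []"

definition plus_word :: "'a word \<Rightarrow> 'a word \<Rightarrow> 'a word" where
  "u + v = Word (letters u @ letters v)"

instance
  by standard (simp_all add: zero_word_def plus_word_def)

end

definition gen :: "'g \<Rightarrow> 'g word \<Rightarrow>\<^sub>0 'k::field" where
  "gen g = Poly_Mapping.single (Word [g]) 1"

definition scal :: "'k \<Rightarrow> 'g word \<Rightarrow>\<^sub>0 'k::field" where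
  "scal c = Poly_Mapping.single 0 c"

definition free_algebra :: "'g set \<Rightarrow> ('k::field, 'g word \<Rightarrow>\<^sub>0 'k) module" where
  "free_algebra G =
     \<lparr>carrier = {f. \<forall>w \<in> Poly_Mapping.keys f. set (letters w) \<subseteq> G},
      monoid.mult = (*), one = 1, ring.zero = 0, add = (+), module.smult = (\<lambda>c f. scal c * f)\<rparr>"

definition quotient_algebra :: "('k, 'a) module \<Rightarrow> 'a set \<Rightarrow> ('k, 'a set) module" where
  "quotient_algebra A I =
     \<lparr>carrier = carrier (A Quot I), monoid.mult = monoid.mult (A Quot I), one = one (A Quot I),
      ring.zero = ring.zero (A Quot I), add = add (A Quot I),
      module.smult = (\<lambda>c C. \<Union>x\<in>C. I +>\<^bsub>A\<^esub> (c \<odot>\<^bsub>A\<^esub> x))\<rparr>"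

text \<open>A relation \<open>l = r\<close> is encoded by the element \<open>l - r\<close>; ideals in HOL-Algebra are two-sided.\<close>

definition presented_algebra ::
    "'g set \<Rightarrow> ('g word \<Rightarrow>\<^sub>0 'k) set \<Rightarrow> ('k::field, ('g word \<Rightarrow>\<^sub>0 'k) set) module" where
  "presented_algebra G S =
     quotient_algebra (free_algebra G) (genideal (free_algebra G) S)"


section \<open>Quantum matrices and quantum affine spaces\<close>

text \<open>An \<open>N \<times> N\<close> matrix is a function of two indices, used only on \<open>{1..N}\<close>.\<close>

definition mult_antisymmetric :: "nat \<Rightarrow> (nat \<Rightarrow> nat \<Rightarrow> 'k::field) \<Rightarrow> bool" where
  "mult_antisymmetric N q \<longleftrightarrow>
     (\<forall>i\<in>{1..N}. \<forall>j\<in>{1..N}. q i j \<noteq> 0 \<and> q i i = 1 \<and> q j i = inverse (q i j))"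

definition quantum_matrix_relations ::
    "nat \<Rightarrow> 'k::field \<Rightarrow> (nat \<Rightarrow> nat \<Rightarrow> 'k) \<Rightarrow> ((nat \<times> nat) word \<Rightarrow>\<^sub>0 'k) set" where
  "quantum_matrix_relations n lam p =
     (let x = (\<lambda>i j. gen (i, j)); I = {1..n} in
      {x l m * x i j - (scal (p l i * p j m) * x i j * x l m
                        + scal ((lam - 1) * p l i) * x i m * x l j)
        | l m i j. l \<in> I \<and> m \<in> I \<and> i \<in> I \<and> j \<in> I \<and> l > i \<and> m > j} \<union>
      {x l m * x i j - scal (lam * p l i * p j m) * x i j * x l m
        | l m i j. l \<in> I \<and> m \<in> I \<and> i \<in> I \<and> j \<in> I \<and> l > i \<and> m \<le> j} \<union>
      {x l m * x i j - scal (p j m) * x i j * x l m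
        | l m i j. l \<in> I \<and> m \<in> I \<and> i \<in> I \<and> j \<in> I \<and> l = i \<and> m > j})"

definition quantum_matrices ::
    "nat \<Rightarrow> 'k::field \<Rightarrow> (nat \<Rightarrow> nat \<Rightarrow> 'k) \<Rightarrow> ('k, ((nat \<times> nat) word \<Rightarrow>\<^sub>0 'k) set) module" where
  "quantum_matrices n lam p =
     presented_algebra ({1..n} \<times> {1..n}) (quantum_matrix_relations n lam p)"

definition quantum_affine_space ::
    "nat \<Rightarrow> (nat \<Rightarrow> nat \<Rightarrow> 'k::field) \<Rightarrow> ('k, (nat word \<Rightarrow>\<^sub>0 'k) set) module" where
  "quantum_affine_space N q =
     presented_algebra {1..N}
       {gen i * gen j - scal (q i j) * gen j * gen i | i j. i \<in> {1..N} \<and> j \<in> {1..N}}"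

definition Lambda_entry ::
    "'k::field \<Rightarrow> (nat \<Rightarrow> nat \<Rightarrow> 'k) \<Rightarrow> nat \<times> nat \<Rightarrow> nat \<times> nat \<Rightarrow> 'k" where
  "Lambda_entry lam p = (\<lambda>(i, a) (j, b).
     if i = j then p b a
     else if i > j then (if a \<le> b then lam * p i j * p b a else p i j * p b a)
     else (if a \<ge> b then inverse lam * p i j * p b a else p i j * p b a))"

text \<open>The \<open>r\<close>-th pair (counting from 1) of \<open>{1..n} \<times> {1..n}\<close> in lexicographic order.\<close>

definition lex_pair :: "nat \<Rightarrow> nat \<Rightarrow> nat \<times> nat" where
  "lex_pair n r = ((r - 1) div n + 1, (r - 1) mod n + 1)"

definition Lambda_matrix ::
    "nat \<Rightarrow> 'k::field \<Rightarrow> (nat \<Rightarrow> nat \<Rightarrow> 'k) \<Rightarrow> nat \<Rightarrow> nat \<Rightarrow> 'k" where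
  "Lambda_matrix n lam p r s = Lambda_entry lam p (lex_pair n r) (lex_pair n s)"

lemma lex_pair_in:
  assumes "r \<in> {1..n^2}"
  shows "lex_pair n r \<in> {1..n} \<times> {1..n}"
proof -
  have n: "n > 0" using assms by (cases n) auto
  have "r - 1 < n * n" using assms by (auto simp: power2_eq_square)
  then have "(r - 1) div n < n" by (simp add: less_mult_imp_div_less)
  moreover have "(r - 1) mod n < n" using n by simp
  ultimately show ?thesis unfolding lex_pair_def mem_Times_iff fst_conv snd_conv
    by (simp add: Suc_le_eq)
qed

lemma lex_pair_bij: "bij_betw (lex_pair n) {1..n^2} ({1..n} \<times> {1..n})"
proof -
  have "inj_on (lex_pair n) {1..n^2}"
  proof (rule inj_onI)
    fix r s assume rs: "r \<in> {1..n^2}" "s \<in> {1..n^2}" "lex_pair n r = lex_pair n s"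
    then have "(r - 1) div n = (s - 1) div n" "(r - 1) mod n = (s - 1) mod n"
      by (auto simp: lex_pair_def)
    then have "r - 1 = s - 1" by (metis div_mult_mod_eq)
    then show "r = s" using rs by auto
  qed
  moreover have "lex_pair n ` {1..n^2} \<subseteq> {1..n} \<times> {1..n}"
    using lex_pair_in by blast
  ultimately show ?thesis
    by (simp add: bij_betw_def card_image card_subset_eq power2_eq_square)
qed

lemma Lambda_entry_antisymmetric:
  assumes "lam \<noteq> 0" "mult_antisymmetric n p"
    and "x \<in> {1..n} \<times> {1..n}" "y \<in> {1..n} \<times> {1..n}"
  shows "Lambda_entry lam p x y \<noteq> 0" "Lambda_entry lam p x x = 1"
    "Lambda_entry lam p y x = inverse (Lambda_entry lam p x y)"
proof -
  have p: "p i j \<noteq> 0" "p i i = 1" "p j i = inverse (p i j)" if "i \<in> {1..n}" "j \<in> {1..n}" for i j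
    using assms(2) that unfolding mult_antisymmetric_def by blast+
  obtain i a j b where xy: "x = (i, a)" "y = (j, b)" by (metis surj_pair)
  have r: "i \<in> {1..n}" "a \<in> {1..n}" "j \<in> {1..n}" "b \<in> {1..n}" using assms(3,4) xy by auto
  show "Lambda_entry lam p x y \<noteq> 0"
    using assms(1) p(1)[OF r(1,3)] p(1)[OF r(4,2)] p(1)[OF r(2,2)] by (simp add: Lambda_entry_def xy)
  show "Lambda_entry lam p x x = 1"
    using p(2)[OF r(2,2)] by (simp add: Lambda_entry_def xy)
  show "Lambda_entry lam p y x = inverse (Lambda_entry lam p x y)"
    using p(3)[OF r(1,3)] p(3)[OF r(4,2)] p(2)[OF r(4,4)] by (simp add: Lambda_entry_def xy)
qed

lemma Lambda_matrix_antisymmetric: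
  assumes "lam \<noteq> 0" "mult_antisymmetric n p"
  shows "mult_antisymmetric (n^2) (Lambda_matrix n lam p)"
  unfolding mult_antisymmetric_def Lambda_matrix_def
  using Lambda_entry_antisymmetric[OF assms lex_pair_in lex_pair_in] by blast


section \<open>Division rings of fractions\<close>

locale skew_field = ring +
  assumes one_not_zero: "\<one> \<noteq> \<zero>"
    and skew_field_Units: "Units R = carrier R - {\<zero>}"

definition division_ring_of_fractions ::
    "('k::field, 'a) module \<Rightarrow> ('k, 'q) module \<Rightarrow> ('a \<Rightarrow> 'q) \<Rightarrow> bool" where
  "division_ring_of_fractions A Q \<iota> \<longleftrightarrow>
     k_algebra A \<and> k_algebra Q \<and> skew_field Q \<and>
     \<iota> \<in> algebra_hom A Q \<and> inj_on \<iota> (carrier A) \<and>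
     (\<forall>q\<in>carrier Q. \<exists>a\<in>carrier A. \<exists>s\<in>carrier A - {\<zero>\<^bsub>A\<^esub>}. q = \<iota> a \<otimes>\<^bsub>Q\<^esub> inv\<^bsub>Q\<^esub> (\<iota> s)) \<and>
     (\<forall>q\<in>carrier Q. \<exists>a\<in>carrier A. \<exists>s\<in>carrier A - {\<zero>\<^bsub>A\<^esub>}. q = inv\<^bsub>Q\<^esub> (\<iota> s) \<otimes>\<^bsub>Q\<^esub> \<iota> a)"

text \<open>The Ore localization at all nonzero elements: the class of \<open>(a, s)\<close> is the right
  fraction \<open>a s\<^sup>-\<^sup>1\<close>. These definitions make sense for any ring, but \<open>Fract_algebra A\<close> is only
  meaningful if \<open>A\<close> is an Ore domain; it is then characterised by
  \<open>division_ring_of_fractions\<close>.\<close>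

definition fractions :: "('k, 'a) module \<Rightarrow> ('a \<times> 'a) set" where
  "fractions A = carrier A \<times> (carrier A - {\<zero>\<^bsub>A\<^esub>})"

definition frac_rel :: "('k, 'a) module \<Rightarrow> (('a \<times> 'a) \<times> ('a \<times> 'a)) set" where
  "frac_rel A = {((a, s), (b, t)). (a, s) \<in> fractions A \<and> (b, t) \<in> fractions A \<and>
     (\<exists>u\<in>carrier A. \<exists>v\<in>carrier A. a \<otimes>\<^bsub>A\<^esub> u = b \<otimes>\<^bsub>A\<^esub> v \<and>
        s \<otimes>\<^bsub>A\<^esub> u = t \<otimes>\<^bsub>A\<^esub> v \<and> s \<otimes>\<^bsub>A\<^esub> u \<noteq> \<zero>\<^bsub>A\<^esub>)}"

text \<open>Sums use a common denominator \<open>s u = t v\<close>; products use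
  \<open>s\<^sup>-\<^sup>1 b = c v\<^sup>-\<^sup>1\<close> whenever \<open>s c = b v\<close>.\<close>

definition Fract_algebra :: "('k, 'a) module \<Rightarrow> ('k, ('a \<times> 'a) set) module" where
  "Fract_algebra A =
     \<lparr>carrier = fractions A // frac_rel A,
      monoid.mult = (\<lambda>C D. frac_rel A `` {(a \<otimes>\<^bsub>A\<^esub> c, t \<otimes>\<^bsub>A\<^esub> v) | a s b t c v.
        (a, s) \<in> C \<and> (b, t) \<in> D \<and> c \<in> carrier A \<and> v \<in> carrier A - {\<zero>\<^bsub>A\<^esub>} \<and>
        s \<otimes>\<^bsub>A\<^esub> c = b \<otimes>\<^bsub>A\<^esub> v}),
      one = frac_rel A `` {(\<one>\<^bsub>A\<^esub>, \<one>\<^bsub>A\<^esub>)},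
      ring.zero = frac_rel A `` {(\<zero>\<^bsub>A\<^esub>, \<one>\<^bsub>A\<^esub>)},
      add = (\<lambda>C D. frac_rel A `` {(a \<otimes>\<^bsub>A\<^esub> u \<oplus>\<^bsub>A\<^esub> b \<otimes>\<^bsub>A\<^esub> v, s \<otimes>\<^bsub>A\<^esub> u) | a s b t u v.
        (a, s) \<in> C \<and> (b, t) \<in> D \<and> u \<in> carrier A \<and> v \<in> carrier A \<and>
        s \<otimes>\<^bsub>A\<^esub> u = t \<otimes>\<^bsub>A\<^esub> v \<and> s \<otimes>\<^bsub>A\<^esub> u \<noteq> \<zero>\<^bsub>A\<^esub>}),
      module.smult = (\<lambda>c C. frac_rel A `` {(c \<odot>\<^bsub>A\<^esub> a, s) | a s. (a, s) \<in> C})\<rparr>"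

definition to_Fract_algebra :: "('k, 'a) module \<Rightarrow> 'a \<Rightarrow> ('a \<times> 'a) set" where
  "to_Fract_algebra A a = frac_rel A `` {(a, \<one>\<^bsub>A\<^esub>)}"

end

(*
  Both algebras are embedded into the quantum torus T on generators t_ia attached to Lambda, a
  twisted group algebra of a linearly ordered group. Leading exponents show that T is a domain,
  and a growth argument shows that each of its subalgebras is an Ore domain.

  The quantum affine space is the subalgebra generated by the t_ia. For quantum matrices the rows
  are brought in one at a time: if the matrix x over T satisfies the relations for its rows i < l,
  then so does the matrix with the new row t_l1, ..., t_ln and with x_ij replaced by
  (SUM m >= j. x_im t_lm^-1) t_lj. This reverses Cauchon's deleting derivations and works
  in every characteristic, also when lambda is a root of unity. The final entry (i,a) has the same leading
  exponent as t_ia. Since the ordered monomials span the abstract algebras (straightening) and have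
  distinct leading exponents in T, the resulting homomorphisms to T are injective. Each image
  consists of fractions over the other one, so the division rings of fractions agree.
*)
theory Submission
  imports Defs
begin

section \<open>Ore localization\<close>

text \<open>The obstacle is that nothing is known about the presented algebras beforehand: a
  monomial basis and the absence of zero divisors are both read off from the model in T. The
  fractions are compared inside T as well. T is not a division ring, so a subalgebra W is enlarged
  to the set of x in T with x s in W for some nonzero s in W. This is again a subalgebra, has the
  same division ring of fractions as W, and contains the inverses that its elements have in T. Both
  images have the same enlargement.

  The row formula originates in the elements v_im = x_im t_lm^-1: the factor t_lm^-1 removes the
  column parameters, and in the commutation rules of the tail sums SUM m >= j. v_im the coefficients
  1 and lam - 1 add up to lam. No q-integer is inverted, so neither roots of unity nor the
  characteristic interfere. Exponents are compared at their largest index, in lexicographic order of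
  the pairs (i,a). Hence t_lm^-1, coming from the newest row, pushes every summand with m > j below
  the summand with m = j.\<close>

lemma ring_of_type_algebra_simps [simp]:
  "carrier (ring_of_type_algebra :: 'k::comm_ring_1 ring) = UNIV"
  "x \<otimes>\<^bsub>ring_of_type_algebra\<^esub> y = x * y"
  "x \<oplus>\<^bsub>ring_of_type_algebra\<^esub> y = x + y"
  "\<one>\<^bsub>ring_of_type_algebra\<^esub> = 1"
  "\<zero>\<^bsub>ring_of_type_algebra\<^esub> = 0"
  by (simp_all add: ring_of_type_algebra_def)

lemma k_algebra_iff:
  fixes A :: "('k::field, 'a) module"
  shows "k_algebra A \<longleftrightarrow> ring A \<and>
    (\<forall>c. \<forall>x\<in>carrier A. c \<odot>\<^bsub>A\<^esub> x \<in> carrier A) \<and>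
    (\<forall>c d. \<forall>x\<in>carrier A. (c + d) \<odot>\<^bsub>A\<^esub> x = c \<odot>\<^bsub>A\<^esub> x \<oplus>\<^bsub>A\<^esub> d \<odot>\<^bsub>A\<^esub> x) \<and>
    (\<forall>c. \<forall>x\<in>carrier A. \<forall>y\<in>carrier A. c \<odot>\<^bsub>A\<^esub> (x \<oplus>\<^bsub>A\<^esub> y) = c \<odot>\<^bsub>A\<^esub> x \<oplus>\<^bsub>A\<^esub> c \<odot>\<^bsub>A\<^esub> y) \<and>
    (\<forall>c d. \<forall>x\<in>carrier A. (c * d) \<odot>\<^bsub>A\<^esub> x = c \<odot>\<^bsub>A\<^esub> (d \<odot>\<^bsub>A\<^esub> x)) \<and>
    (\<forall>x\<in>carrier A. 1 \<odot>\<^bsub>A\<^esub> x = x) \<and>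
    (\<forall>c. \<forall>x\<in>carrier A. \<forall>y\<in>carrier A. (c \<odot>\<^bsub>A\<^esub> x) \<otimes>\<^bsub>A\<^esub> y = c \<odot>\<^bsub>A\<^esub> (x \<otimes>\<^bsub>A\<^esub> y)) \<and>
    (\<forall>c. \<forall>x\<in>carrier A. \<forall>y\<in>carrier A. x \<otimes>\<^bsub>A\<^esub> (c \<odot>\<^bsub>A\<^esub> y) = c \<odot>\<^bsub>A\<^esub> (x \<otimes>\<^bsub>A\<^esub> y))"
    (is "_ \<longleftrightarrow> ring A \<and> ?P")
proof
  assume "k_algebra A"
  then interpret assoc_algebra "ring_of_type_algebra :: 'k ring" A
    by (simp add: k_algebra_def)
  show "ring A \<and> ?P"
    using A.ring_axioms smult_closed smult_l_distr smult_r_distr smult_assoc1 smult_one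
      smult_mult_left smult_mult_right by simp
next
  assume *: "ring A \<and> ?P"
  then interpret A: ring A by blast
  show "k_algebra A"
    unfolding k_algebra_def assoc_algebra_def assoc_algebra_axioms_def
    using * A.is_abelian_group cring_from_type_algebra
    by (intro conjI moduleI) auto
qed

text \<open>Right denominators carry the construction of fractions; the left condition turns a right
  fraction into a left one. The multiplier \<open>v\<close> is nonzero, while \<open>c\<close> may
  vanish, as it must for \<open>a = \<zero>\<close>.\<close>

locale ore_domain = ring A for A :: "('k::field, 'a) module" (structure) +
  assumes k_alg: "k_algebra A"
    and one_not_zero: "\<one> \<noteq> \<zero>"
    and integral: "\<lbrakk>x \<in> carrier A; y \<in> carrier A; x \<otimes> y = \<zero>\<rbrakk> \<Longrightarrow> x = \<zero> \<or> y = \<zero>"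
    and right_ore: "\<lbrakk>a \<in> carrier A; s \<in> carrier A; s \<noteq> \<zero>\<rbrakk> \<Longrightarrow>
      \<exists>c\<in>carrier A. \<exists>v\<in>carrier A - {\<zero>}. s \<otimes> c = a \<otimes> v"
    and left_ore: "\<lbrakk>a \<in> carrier A; s \<in> carrier A; s \<noteq> \<zero>\<rbrakk> \<Longrightarrow>
      \<exists>c\<in>carrier A. \<exists>v\<in>carrier A - {\<zero>}. c \<otimes> s = v \<otimes> a"
begin

lemmas smult_facts = k_alg[unfolded k_algebra_iff]

lemma smult_closed [simp, intro]: "x \<in> carrier A \<Longrightarrow> c \<odot> x \<in> carrier A"
  using smult_facts by blast

lemma smult_laws:
  "x \<in> carrier A \<Longrightarrow> (c + d) \<odot> x = c \<odot> x \<oplus> d \<odot> x"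
  "x \<in> carrier A \<Longrightarrow> y \<in> carrier A \<Longrightarrow> c \<odot> (x \<oplus> y) = c \<odot> x \<oplus> c \<odot> y"
  "x \<in> carrier A \<Longrightarrow> (c * d) \<odot> x = c \<odot> (d \<odot> x)"
  "x \<in> carrier A \<Longrightarrow> 1 \<odot> x = x"
  using smult_facts by blast+

lemma smult_mult:
  "x \<in> carrier A \<Longrightarrow> y \<in> carrier A \<Longrightarrow> (c \<odot> x) \<otimes> y = c \<odot> (x \<otimes> y)"
  "x \<in> carrier A \<Longrightarrow> y \<in> carrier A \<Longrightarrow> x \<otimes> (c \<odot> y) = c \<odot> (x \<otimes> y)"
  using smult_facts by blast+

lemma mult_eq_zero: "\<lbrakk>x \<in> carrier A; y \<in> carrier A\<rbrakk> \<Longrightarrow> x \<otimes> y = \<zero> \<longleftrightarrow> x = \<zero> \<or> y = \<zero>"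
  using integral by auto

lemma cancel_right:
  assumes "x \<in> carrier A" "y \<in> carrier A" "z \<in> carrier A" "z \<noteq> \<zero>" "x \<otimes> z = y \<otimes> z"
  shows "x = y"
proof -
  have "(x \<ominus> y) \<otimes> z = \<zero>" using assms by (simp add: minus_eq l_distr l_minus r_neg)
  then have "x \<ominus> y = \<zero>" using integral[of "x \<ominus> y" z] assms by auto
  then show ?thesis using assms by simp
qed

lemma cancel_left:
  assumes "x \<in> carrier A" "y \<in> carrier A" "z \<in> carrier A" "z \<noteq> \<zero>" "z \<otimes> x = z \<otimes> y"
  shows "x = y"
proof -
  have "z \<otimes> (x \<ominus> y) = \<zero>" using assms by (simp add: minus_eq r_distr r_minus r_neg)
  then have "x \<ominus> y = \<zero>" using integral[of z "x \<ominus> y"] assms by auto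
  then show ?thesis using assms by simp
qed

lemma common_multiple:
  assumes "s \<in> carrier A" "s \<noteq> \<zero>" "t \<in> carrier A" "t \<noteq> \<zero>"
  obtains u v where "u \<in> carrier A" "v \<in> carrier A" "u \<noteq> \<zero>" "v \<noteq> \<zero>" "s \<otimes> u = t \<otimes> v" "s \<otimes> u \<noteq> \<zero>"
proof -
  obtain u v where uv: "u \<in> carrier A" "v \<in> carrier A" "v \<noteq> \<zero>" "s \<otimes> u = t \<otimes> v"
    using right_ore[of t s] assms by blast
  then have "s \<otimes> u \<noteq> \<zero>" using assms by (simp add: mult_eq_zero)
  moreover from this have "u \<noteq> \<zero>" using assms by auto
  ultimately show ?thesis using that uv by blast
qed

lemma common_multiple_ex:
  assumes "s \<in> carrier A" "s \<noteq> \<zero>" "t \<in> carrier A" "t \<noteq> \<zero>"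
  shows "\<exists>u v. u \<in> carrier A \<and> v \<in> carrier A \<and> u \<noteq> \<zero> \<and> v \<noteq> \<zero> \<and> s \<otimes> u = t \<otimes> v"
  using common_multiple[OF assms] by metis

abbreviation "Frac \<equiv> fractions A"
abbreviation "rel \<equiv> frac_rel A"
abbreviation cls ("\<lblot>_, _\<rblot>") where "\<lblot>a, s\<rblot> \<equiv> frac_rel A `` {(a, s)}"

lemma frac_iff [simp]: "(a, s) \<in> Frac \<longleftrightarrow> a \<in> carrier A \<and> s \<in> carrier A \<and> s \<noteq> \<zero>"
  by (auto simp: fractions_def)

lemma relI:
  assumes "a \<in> carrier A" "s \<in> carrier A" "s \<noteq> \<zero>" "b \<in> carrier A" "t \<in> carrier A" "t \<noteq> \<zero>"
    "u \<in> carrier A" "v \<in> carrier A" "a \<otimes> u = b \<otimes> v" "s \<otimes> u = t \<otimes> v" "u \<noteq> \<zero>"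
  shows "((a, s), (b, t)) \<in> rel"
  using assms by (auto simp: frac_rel_def mult_eq_zero)

lemma rel_frac: "((a, s), (b, t)) \<in> rel \<Longrightarrow> (a, s) \<in> Frac \<and> (b, t) \<in> Frac"
  by (auto simp: frac_rel_def)

text \<open>By the Ore condition and cancellation, the witnesses \<open>u, v\<close> in the definition of \<open>frac_rel\<close>
  can be chosen freely; this makes all operations on fractions well defined.\<close>

lemma rel_any:
  assumes r: "((a, s), (b, t)) \<in> rel" and uv: "u \<in> carrier A" "v \<in> carrier A" "s \<otimes> u = t \<otimes> v"
  shows "a \<otimes> u = b \<otimes> v"
proof -
  obtain u0 v0 where *: "u0 \<in> carrier A" "v0 \<in> carrier A" "a \<otimes> u0 = b \<otimes> v0" "s \<otimes> u0 = t \<otimes> v0"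
      "s \<otimes> u0 \<noteq> \<zero>" and
    c [simp]: "a \<in> carrier A" "b \<in> carrier A" "s \<in> carrier A" "t \<in> carrier A" "s \<noteq> \<zero>" "t \<noteq> \<zero>"
    using r by (auto simp: frac_rel_def)
  note [simp] = *(1,2) uv(1,2)
  show ?thesis
  proof (cases "u = \<zero>")
    case True
    then have "v = \<zero>" using uv mult_eq_zero[of t v] by auto
    then show ?thesis using True by simp
  next
    case False
    have "u0 \<noteq> \<zero>" using *(5) r_null[of s] by auto
    \<comment> \<open>A common right multiple of \<open>u0\<close> and \<open>u\<close> makes the
      two pairs of witnesses comparable: \<open>t\<close> cancels on the left, \<open>y\<close> on
      the right.\<close>
    then obtain x y where xy [simp]: "x \<in> carrier A" "y \<in> carrier A" "y \<noteq> \<zero>" and xy4: "u0 \<otimes> x = u \<otimes> y"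
      using common_multiple_ex[of u0 u] False by auto
    have "t \<otimes> (v0 \<otimes> x) = s \<otimes> (u0 \<otimes> x)" using *(4) by (simp flip: m_assoc)
    also have "\<dots> = t \<otimes> (v \<otimes> y)" unfolding xy4 using uv by (simp flip: m_assoc)
    finally have v: "v0 \<otimes> x = v \<otimes> y" using cancel_left[of "v0 \<otimes> x" "v \<otimes> y" t] by simp
    have "a \<otimes> u \<otimes> y = a \<otimes> u0 \<otimes> x" by (simp add: m_assoc xy4)
    also have "\<dots> = b \<otimes> v \<otimes> y" using v *(3) by (simp add: m_assoc)
    finally show ?thesis using cancel_right[of "a \<otimes> u" "b \<otimes> v" y] by simp
  qed
qed

lemma equiv_rel: "equiv Frac rel"
proof (rule equivI)
  show "rel \<subseteq> Frac \<times> Frac" by (auto simp: frac_rel_def)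
  show "refl_on Frac rel"
    by (rule refl_onI) (auto simp: one_not_zero intro!: relI[where u = \<one> and v = \<one>])
  show "sym rel"
    by (rule symI) (auto simp: frac_rel_def, metis)
  show "trans rel"
  proof (rule transI, clarify)
    fix a s b t c w assume r: "((a, s), (b, t)) \<in> rel" "((b, t), (c, w)) \<in> rel"
    then have [simp]: "a \<in> carrier A" "b \<in> carrier A" "c \<in> carrier A" "s \<in> carrier A"
      "t \<in> carrier A" "w \<in> carrier A" "s \<noteq> \<zero>" "t \<noteq> \<zero>" "w \<noteq> \<zero>"
      by (auto dest: rel_frac)
    obtain u v where uv [simp]: "u \<in> carrier A" "v \<in> carrier A" "u \<noteq> \<zero>" "v \<noteq> \<zero>" "s \<otimes> u = t \<otimes> v"
      using common_multiple_ex[of s t] by auto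
    \<comment> \<open>One common multiple for all three denominators:
      \<open>s u x = t v x = w y\<close>.\<close>
    have "t \<otimes> v \<noteq> \<zero>" by (simp add: mult_eq_zero)
    then obtain x y where xy [simp]: "x \<in> carrier A" "y \<in> carrier A" "x \<noteq> \<zero>" "t \<otimes> v \<otimes> x = w \<otimes> y"
      using common_multiple_ex[of "t \<otimes> v" w] by auto
    have 1: "a \<otimes> u = b \<otimes> v" using rel_any[OF r(1), of u v] by simp
    have "t \<otimes> (v \<otimes> x) = w \<otimes> y" using xy(4) by (simp add: m_assoc del: xy(4))
    then have 2: "b \<otimes> (v \<otimes> x) = c \<otimes> y" using rel_any[OF r(2), of "v \<otimes> x" y] by simp
    show "((a, s), (c, w)) \<in> rel"
      using 1 2 xy(4) by (intro relI[where u = "u \<otimes> x" and v = y]) (auto simp: mult_eq_zero simp flip: m_assoc)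
  qed
qed

lemma cls_eq_iff:
  assumes "(a, s) \<in> Frac" "(b, t) \<in> Frac"
  shows "\<lblot>a, s\<rblot> = \<lblot>b, t\<rblot> \<longleftrightarrow> ((a, s), (b, t)) \<in> rel"
  using eq_equiv_class_iff[OF equiv_rel assms] .

lemma cls_expand:
  assumes "a \<in> carrier A" "s \<in> carrier A" "s \<noteq> \<zero>" "u \<in> carrier A" "u \<noteq> \<zero>"
  shows "\<lblot>a \<otimes> u, s \<otimes> u\<rblot> = \<lblot>a, s\<rblot>"
  using assms one_not_zero
  by (subst cls_eq_iff) (auto simp: mult_eq_zero m_assoc intro!: relI[where u = \<one> and v = u])

abbreviation "Q \<equiv> Fract_algebra A"

lemma carrier_Q: "carrier Q = Frac // rel"
  by (simp add: Fract_algebra_def)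

lemma cls_closed [simp]: "a \<in> carrier A \<Longrightarrow> s \<in> carrier A \<Longrightarrow> s \<noteq> \<zero> \<Longrightarrow> \<lblot>a, s\<rblot> \<in> carrier Q"
  unfolding carrier_Q by (rule quotientI) simp

lemma carrier_Q_cases:
  assumes "x \<in> carrier Q"
  obtains a s where "a \<in> carrier A" "s \<in> carrier A" "s \<noteq> \<zero>" "x = \<lblot>a, s\<rblot>"
  using assms unfolding carrier_Q by (rule quotientE) (use that in auto)

text \<open>The operations of \<open>Fract_algebra\<close> take the union over all admissible
  representatives and multipliers. Well-definedness therefore means that each admissible result is
  related to one chosen result, itself admissible.\<close>

lemma rel_image_eqI:
  assumes "\<And>y. y \<in> Y \<Longrightarrow> (x, y) \<in> rel" "x \<in> Y"
  shows "rel `` Y = rel `` {x}"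
proof -
  have "rel `` {y} = rel `` {x}" if "y \<in> Y" for y
    using equiv_class_eq[OF equiv_rel assms(1)[OF that]] by simp
  then show ?thesis using assms(2) by blast
qed

text \<open>Equal denominators suffice, since two or three fractions always admit a common one; the
  additive laws then reduce to those of the numerators.\<close>

lemma add_cls:
  assumes [simp]: "a \<in> carrier A" "b \<in> carrier A" "s \<in> carrier A" "s \<noteq> \<zero>"
  shows "\<lblot>a, s\<rblot> \<oplus>\<^bsub>Q\<^esub> \<lblot>b, s\<rblot> = \<lblot>a \<oplus> b, s\<rblot>"
  unfolding Fract_algebra_def ring.simps
proof (rule rel_image_eqI, goal_cases)
  case (1 y)
  then obtain a' s' b' t' u v where y: "y = (a' \<otimes> u \<oplus> b' \<otimes> v, s' \<otimes> u)"
    "(a', s') \<in> \<lblot>a, s\<rblot>" "(b', t') \<in> \<lblot>b, s\<rblot>"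
    and [simp]: "u \<in> carrier A" "v \<in> carrier A" "s' \<otimes> u = t' \<otimes> v" and "s' \<otimes> u \<noteq> \<zero>"
    by blast
  with y have r: "((a, s), (a', s')) \<in> rel" "((b, s), (b', t')) \<in> rel"
    and [simp]: "t' \<otimes> v \<noteq> \<zero>" by auto
  have [simp]: "a' \<in> carrier A" "s' \<in> carrier A" "b' \<in> carrier A" "t' \<in> carrier A"
    using r by (auto dest: rel_frac)
  obtain x y where xy [simp]: "x \<in> carrier A" "y \<in> carrier A" "x \<noteq> \<zero>" "s \<otimes> x = t' \<otimes> v \<otimes> y"
    using common_multiple_ex[of s "t' \<otimes> v"] by auto
  have 1: "a \<otimes> x = a' \<otimes> (u \<otimes> y)" using rel_any[OF r(1), of x "u \<otimes> y"]
    by (simp flip: m_assoc)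
  have 2: "b \<otimes> x = b' \<otimes> (v \<otimes> y)" using rel_any[OF r(2), of x "v \<otimes> y"]
    by (simp add: m_assoc)
  show ?case unfolding y(1)
    by (rule relI[where u = x and v = y]) (auto simp: l_distr 1 2 m_assoc)
next
  case 2
  have *: "((a, s), (a, s)) \<in> rel" "((b, s), (b, s)) \<in> rel"
    using equiv_rel by (auto simp: equiv_def refl_on_def)
  show ?case
    unfolding mem_Collect_eq
    by (rule exI[of _ a], rule exI[of _ s],
        rule exI[of _ b], rule exI[of _ s],
        rule exI[of _ \<one>], rule exI[of _ \<one>])
      (simp add: * one_not_zero)
qed

text \<open>If the second numerator is a right multiple \<open>s c\<close> of the first denominator,
  the product is \<open>a s^-1 s c t^-1 = a c t^-1\<close>, with no Ore multiplier left to choose.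
  By \<open>composable\<close> every second factor has such a form.\<close>

lemma mult_cls:
  assumes [simp]: "a \<in> carrier A" "s \<in> carrier A" "s \<noteq> \<zero>" "c \<in> carrier A" "t \<in> carrier A" "t \<noteq> \<zero>"
  shows "\<lblot>a, s\<rblot> \<otimes>\<^bsub>Q\<^esub> \<lblot>s \<otimes> c, t\<rblot> = \<lblot>a \<otimes> c, t\<rblot>"
  unfolding Fract_algebra_def monoid.simps
proof (rule rel_image_eqI, goal_cases)
  case (1 y)
  then obtain a' s' b t' c' v where y: "y = (a' \<otimes> c', t' \<otimes> v)"
    "(a', s') \<in> \<lblot>a, s\<rblot>" "(b, t') \<in> \<lblot>s \<otimes> c, t\<rblot>"
    and [simp]: "c' \<in> carrier A" "v \<in> carrier A" "v \<noteq> \<zero>" and sc: "s' \<otimes> c' = b \<otimes> v"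
    by blast
  with y have r: "((a, s), (a', s')) \<in> rel" "((s \<otimes> c, t), (b, t')) \<in> rel" by auto
  have [simp]: "a' \<in> carrier A" "s' \<in> carrier A" "b \<in> carrier A" "t' \<in> carrier A" "t' \<noteq> \<zero>"
    using r by (auto dest: rel_frac)
  obtain x y where xy [simp]: "x \<in> carrier A" "y \<in> carrier A" "x \<noteq> \<zero>" "t \<otimes> x = t' \<otimes> v \<otimes> y"
    using common_multiple_ex[of t "t' \<otimes> v"] mult_eq_zero[of t' v] by auto
  have "s \<otimes> (c \<otimes> x) = b \<otimes> v \<otimes> y"
    using rel_any[OF r(2), of x "v \<otimes> y"] by (simp add: m_assoc)
  also have "\<dots> = s' \<otimes> c' \<otimes> y" by (simp add: sc)
  finally have "a \<otimes> (c \<otimes> x) = a' \<otimes> (c' \<otimes> y)"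
    using rel_any[OF r(1), of "c \<otimes> x" "c' \<otimes> y"] by (simp add: m_assoc)
  then show ?case unfolding y(1)
    by (intro relI[where u = x and v = y]) (auto simp: m_assoc mult_eq_zero)
next
  case 2
  have *: "((a, s), (a, s)) \<in> rel" "((s \<otimes> c, t), (s \<otimes> c, t)) \<in> rel"
    using equiv_rel by (auto simp: equiv_def refl_on_def)
  show ?case
    unfolding mem_Collect_eq
    by (rule exI[of _ a], rule exI[of _ s],
        rule exI[of _ "s \<otimes> c"], rule exI[of _ t], rule exI[of _ c], rule exI[of _ \<one>])
      (simp add: * one_not_zero)
qed

lemma smult_cls:
  assumes [simp]: "a \<in> carrier A" "s \<in> carrier A" "s \<noteq> \<zero>"
  shows "c \<odot>\<^bsub>Q\<^esub> \<lblot>a, s\<rblot> = \<lblot>c \<odot> a, s\<rblot>"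
  unfolding Fract_algebra_def module.simps
proof (rule rel_image_eqI, goal_cases)
  case (1 y)
  then obtain a' s' where y: "y = (c \<odot> a', s')" "(a', s') \<in> \<lblot>a, s\<rblot>" by blast
  then have r: "((a, s), (a', s')) \<in> rel" by simp
  have [simp]: "a' \<in> carrier A" "s' \<in> carrier A" "s' \<noteq> \<zero>" using r by (auto dest: rel_frac)
  obtain x y where xy [simp]: "x \<in> carrier A" "y \<in> carrier A" "x \<noteq> \<zero>" "s \<otimes> x = s' \<otimes> y"
    using common_multiple_ex[of s s'] by auto
  show ?case unfolding y(1)
    using rel_any[OF r, of x y] by (intro relI[where u = x and v = y]) (auto simp: smult_mult)
next
  case 2
  have "((a, s), (a, s)) \<in> rel" using equiv_rel by (auto simp: equiv_def refl_on_def)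
  then show ?case by auto
qed

lemma common_denominator:
  assumes "x \<in> carrier Q" "y \<in> carrier Q"
  obtains a b s where "a \<in> carrier A" "b \<in> carrier A" "s \<in> carrier A" "s \<noteq> \<zero>"
    "x = \<lblot>a, s\<rblot>" "y = \<lblot>b, s\<rblot>"
proof -
  obtain a s b t where *: "a \<in> carrier A" "s \<in> carrier A" "s \<noteq> \<zero>" "x = \<lblot>a, s\<rblot>"
    "b \<in> carrier A" "t \<in> carrier A" "t \<noteq> \<zero>" "y = \<lblot>b, t\<rblot>"
    using assms by (metis carrier_Q_cases)
  then obtain u v where uv: "u \<in> carrier A" "v \<in> carrier A" "u \<noteq> \<zero>" "v \<noteq> \<zero>" "s \<otimes> u = t \<otimes> v"
    "s \<otimes> u \<noteq> \<zero>"
    using common_multiple[of s t] by metis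
  have "x = \<lblot>a \<otimes> u, s \<otimes> u\<rblot>" "y = \<lblot>b \<otimes> v, s \<otimes> u\<rblot>"
    using * uv cls_expand[of a s u] cls_expand[of b t v] by simp_all
  then show ?thesis using that[of "a \<otimes> u" "b \<otimes> v" "s \<otimes> u"] *(1,2,5,6) uv by simp
qed

lemma common_denominator3:
  assumes "x \<in> carrier Q" "y \<in> carrier Q" "z \<in> carrier Q"
  obtains a b c s where "a \<in> carrier A" "b \<in> carrier A" "c \<in> carrier A" "s \<in> carrier A" "s \<noteq> \<zero>"
    "x = \<lblot>a, s\<rblot>" "y = \<lblot>b, s\<rblot>" "z = \<lblot>c, s\<rblot>"
proof -
  obtain a b s where 1: "a \<in> carrier A" "b \<in> carrier A" "s \<in> carrier A" "s \<noteq> \<zero>"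
    "x = \<lblot>a, s\<rblot>" "y = \<lblot>b, s\<rblot>"
    using common_denominator assms by metis
  obtain c t where 2: "c \<in> carrier A" "t \<in> carrier A" "t \<noteq> \<zero>" "z = \<lblot>c, t\<rblot>"
    using carrier_Q_cases assms by metis
  obtain u v where uv: "u \<in> carrier A" "v \<in> carrier A" "u \<noteq> \<zero>" "v \<noteq> \<zero>" "s \<otimes> u = t \<otimes> v"
    "s \<otimes> u \<noteq> \<zero>"
    using common_multiple[of s t] 1 2 by metis
  have "x = \<lblot>a \<otimes> u, s \<otimes> u\<rblot>" "y = \<lblot>b \<otimes> u, s \<otimes> u\<rblot>" "z = \<lblot>c \<otimes> v, s \<otimes> u\<rblot>"
    using 1 2 uv cls_expand[of a s u] cls_expand[of b s u] cls_expand[of c t v] by simp_all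
  then show ?thesis using that[of "a \<otimes> u" "b \<otimes> u" "c \<otimes> v" "s \<otimes> u"] 1(1-3) 2(1,2) uv by simp
qed

lemma composable:
  assumes "s \<in> carrier A" "s \<noteq> \<zero>" "y \<in> carrier Q"
  obtains c t where "c \<in> carrier A" "t \<in> carrier A" "t \<noteq> \<zero>" "y = \<lblot>s \<otimes> c, t\<rblot>"
proof -
  obtain b t where 1: "b \<in> carrier A" "t \<in> carrier A" "t \<noteq> \<zero>" "y = \<lblot>b, t\<rblot>"
    using carrier_Q_cases assms by metis
  obtain c v where 2: "c \<in> carrier A" "v \<in> carrier A" "v \<noteq> \<zero>" "s \<otimes> c = b \<otimes> v"
    using right_ore[of b s] assms 1 by blast
  have "y = \<lblot>s \<otimes> c, t \<otimes> v\<rblot>" unfolding 2(4) 1(4) using 1 2 cls_expand[of b t v] by metis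
  moreover have "t \<otimes> v \<in> carrier A" "t \<otimes> v \<noteq> \<zero>" using 1 2 by (simp_all add: mult_eq_zero)
  ultimately show ?thesis using that[of c "t \<otimes> v"] 2(1) by simp
qed

lemma composable2:
  assumes "s \<in> carrier A" "s \<noteq> \<zero>" "y \<in> carrier Q" "z \<in> carrier Q"
  obtains c d t where "c \<in> carrier A" "d \<in> carrier A" "t \<in> carrier A" "t \<noteq> \<zero>"
    "y = \<lblot>s \<otimes> c, t\<rblot>" "z = \<lblot>s \<otimes> d, t\<rblot>"
proof -
  obtain c t where 1: "c \<in> carrier A" "t \<in> carrier A" "t \<noteq> \<zero>" "y = \<lblot>s \<otimes> c, t\<rblot>"
    using composable assms by metis
  obtain d w where 2: "d \<in> carrier A" "w \<in> carrier A" "w \<noteq> \<zero>" "z = \<lblot>s \<otimes> d, w\<rblot>"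
    using composable assms by metis
  obtain u v where uv: "u \<in> carrier A" "v \<in> carrier A" "u \<noteq> \<zero>" "v \<noteq> \<zero>" "t \<otimes> u = w \<otimes> v"
    "t \<otimes> u \<noteq> \<zero>"
    using common_multiple[of t w] 1 2 by metis
  have "y = \<lblot>s \<otimes> (c \<otimes> u), t \<otimes> u\<rblot>" "z = \<lblot>s \<otimes> (d \<otimes> v), t \<otimes> u\<rblot>"
    using 1 2 uv assms cls_expand[of "s \<otimes> c" t u] cls_expand[of "s \<otimes> d" w v]
    by (simp_all add: m_assoc)
  then show ?thesis using that[of "c \<otimes> u" "d \<otimes> v" "t \<otimes> u"] 1(1,2) 2(1,2) uv by simp
qed

lemma one_Q: "\<one>\<^bsub>Q\<^esub> = \<lblot>\<one>, \<one>\<rblot>" and zero_Q: "\<zero>\<^bsub>Q\<^esub> = \<lblot>\<zero>, \<one>\<rblot>"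
  by (simp_all add: Fract_algebra_def)

lemma one_Q': "s \<in> carrier A \<Longrightarrow> s \<noteq> \<zero> \<Longrightarrow> \<one>\<^bsub>Q\<^esub> = \<lblot>s, s\<rblot>"
  unfolding one_Q using cls_expand[of \<one> \<one> s] one_not_zero by simp

lemma zero_Q': "s \<in> carrier A \<Longrightarrow> s \<noteq> \<zero> \<Longrightarrow> \<zero>\<^bsub>Q\<^esub> = \<lblot>\<zero>, s\<rblot>"
  unfolding zero_Q using cls_expand[of \<zero> \<one> s] one_not_zero by simp

lemma cls_eq_zero:
  assumes "a \<in> carrier A" "s \<in> carrier A" "s \<noteq> \<zero>"
  shows "\<lblot>a, s\<rblot> = \<zero>\<^bsub>Q\<^esub> \<longleftrightarrow> a = \<zero>"
proof
  assume "\<lblot>a, s\<rblot> = \<zero>\<^bsub>Q\<^esub>"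
  then have "((a, s), (\<zero>, s)) \<in> rel"
    using assms by (simp add: zero_Q'[of s] cls_eq_iff)
  from rel_any[OF this, of \<one> \<one>] show "a = \<zero>" using assms by simp
qed (use assms zero_Q' in simp)

lemma ring_Q: "ring Q"
proof (rule ringI)
  show "abelian_group Q"
  proof (rule abelian_groupI)
    fix x y assume "x \<in> carrier Q" "y \<in> carrier Q"
    then obtain a b s where [simp]: "a \<in> carrier A" "b \<in> carrier A" "s \<in> carrier A" "s \<noteq> \<zero>"
      "x = \<lblot>a, s\<rblot>" "y = \<lblot>b, s\<rblot>" by (rule common_denominator)
    show "x \<oplus>\<^bsub>Q\<^esub> y \<in> carrier Q" "x \<oplus>\<^bsub>Q\<^esub> y = y \<oplus>\<^bsub>Q\<^esub> x" by (simp_all add: add_cls a_comm)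
  next
    fix x y z assume "x \<in> carrier Q" "y \<in> carrier Q" "z \<in> carrier Q"
    then obtain a b c s where [simp]: "a \<in> carrier A" "b \<in> carrier A" "c \<in> carrier A"
      "s \<in> carrier A" "s \<noteq> \<zero>" "x = \<lblot>a, s\<rblot>" "y = \<lblot>b, s\<rblot>" "z = \<lblot>c, s\<rblot>"
      by (rule common_denominator3)
    show "x \<oplus>\<^bsub>Q\<^esub> y \<oplus>\<^bsub>Q\<^esub> z = x \<oplus>\<^bsub>Q\<^esub> (y \<oplus>\<^bsub>Q\<^esub> z)" using a_assoc[of a b c] by (simp add: add_cls)
  next
    fix x assume "x \<in> carrier Q"
    then obtain a s where [simp]: "a \<in> carrier A" "s \<in> carrier A" "s \<noteq> \<zero>" "x = \<lblot>a, s\<rblot>"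
      by (rule carrier_Q_cases)
    show "\<zero>\<^bsub>Q\<^esub> \<oplus>\<^bsub>Q\<^esub> x = x" by (simp add: zero_Q'[of s] add_cls)
    have "\<lblot>\<ominus> a, s\<rblot> \<in> carrier Q" "\<lblot>\<ominus> a, s\<rblot> \<oplus>\<^bsub>Q\<^esub> x = \<zero>\<^bsub>Q\<^esub>"
      by (simp_all add: zero_Q'[of s] add_cls l_neg)
    then show "\<exists>y\<in>carrier Q. y \<oplus>\<^bsub>Q\<^esub> x = \<zero>\<^bsub>Q\<^esub>" by blast
  qed (simp add: zero_Q one_not_zero)
  show "monoid Q"
  proof (rule monoidI)
    fix x y assume x: "x \<in> carrier Q" and y: "y \<in> carrier Q"
    obtain a s where [simp]: "a \<in> carrier A" "s \<in> carrier A" "s \<noteq> \<zero>" "x = \<lblot>a, s\<rblot>"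
      using x by (rule carrier_Q_cases)
    obtain c t where [simp]: "c \<in> carrier A" "t \<in> carrier A" "t \<noteq> \<zero>" "y = \<lblot>s \<otimes> c, t\<rblot>"
      using \<open>s \<in> carrier A\<close> \<open>s \<noteq> \<zero>\<close> y by (rule composable)
    show "x \<otimes>\<^bsub>Q\<^esub> y \<in> carrier Q" by (simp add: mult_cls)
  next
    \<comment> \<open>A composable chain \<open>a/s\<close>, \<open>s c/t\<close>,
      \<open>t d/w\<close>: both bracketings give \<open>a c d/w\<close>.\<close>
    fix x y z assume x: "x \<in> carrier Q" and y: "y \<in> carrier Q" and z: "z \<in> carrier Q"
    obtain a s where [simp]: "a \<in> carrier A" "s \<in> carrier A" "s \<noteq> \<zero>" "x = \<lblot>a, s\<rblot>"
      using x by (rule carrier_Q_cases)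
    obtain c t where [simp]: "c \<in> carrier A" "t \<in> carrier A" "t \<noteq> \<zero>" "y = \<lblot>s \<otimes> c, t\<rblot>"
      using \<open>s \<in> carrier A\<close> \<open>s \<noteq> \<zero>\<close> y by (rule composable)
    obtain d w where [simp]: "d \<in> carrier A" "w \<in> carrier A" "w \<noteq> \<zero>" "z = \<lblot>t \<otimes> d, w\<rblot>"
      using \<open>t \<in> carrier A\<close> \<open>t \<noteq> \<zero>\<close> z by (rule composable)
    show "x \<otimes>\<^bsub>Q\<^esub> y \<otimes>\<^bsub>Q\<^esub> z = x \<otimes>\<^bsub>Q\<^esub> (y \<otimes>\<^bsub>Q\<^esub> z)"
      using mult_cls[of a s "c \<otimes> d" w] by (simp add: mult_cls m_assoc)
  next
    fix x assume "x \<in> carrier Q"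
    then obtain a s where [simp]: "a \<in> carrier A" "s \<in> carrier A" "s \<noteq> \<zero>" "x = \<lblot>a, s\<rblot>"
      by (rule carrier_Q_cases)
    show "\<one>\<^bsub>Q\<^esub> \<otimes>\<^bsub>Q\<^esub> x = x" using mult_cls[of \<one> \<one> a s] one_not_zero by (simp add: one_Q)
    show "x \<otimes>\<^bsub>Q\<^esub> \<one>\<^bsub>Q\<^esub> = x" using mult_cls[of a s \<one> s] one_not_zero by (simp add: one_Q'[of s])
  qed (simp add: one_Q one_not_zero)
next
  fix x y z assume Q: "x \<in> carrier Q" "y \<in> carrier Q" "z \<in> carrier Q"
  obtain a b s where [simp]: "a \<in> carrier A" "b \<in> carrier A" "s \<in> carrier A" "s \<noteq> \<zero>"
    "x = \<lblot>a, s\<rblot>" "y = \<lblot>b, s\<rblot>" using Q(1,2) by (rule common_denominator)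
  obtain c t where [simp]: "c \<in> carrier A" "t \<in> carrier A" "t \<noteq> \<zero>" "z = \<lblot>s \<otimes> c, t\<rblot>"
    using \<open>s \<in> carrier A\<close> \<open>s \<noteq> \<zero>\<close> Q(3) by (rule composable)
  show "(x \<oplus>\<^bsub>Q\<^esub> y) \<otimes>\<^bsub>Q\<^esub> z = x \<otimes>\<^bsub>Q\<^esub> z \<oplus>\<^bsub>Q\<^esub> y \<otimes>\<^bsub>Q\<^esub> z"
    using l_distr[of a b c] by (simp add: add_cls mult_cls)
next
  fix x y z assume Q: "x \<in> carrier Q" "y \<in> carrier Q" "z \<in> carrier Q"
  obtain a s where [simp]: "a \<in> carrier A" "s \<in> carrier A" "s \<noteq> \<zero>" "z = \<lblot>a, s\<rblot>"
    using Q(3) by (rule carrier_Q_cases)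
  obtain c d t where [simp]: "c \<in> carrier A" "d \<in> carrier A" "t \<in> carrier A" "t \<noteq> \<zero>"
    "x = \<lblot>s \<otimes> c, t\<rblot>" "y = \<lblot>s \<otimes> d, t\<rblot>"
    using \<open>s \<in> carrier A\<close> \<open>s \<noteq> \<zero>\<close> Q(1,2) by (rule composable2)
  have "z \<otimes>\<^bsub>Q\<^esub> (x \<oplus>\<^bsub>Q\<^esub> y) = z \<otimes>\<^bsub>Q\<^esub> \<lblot>s \<otimes> (c \<oplus> d), t\<rblot>" by (simp add: add_cls r_distr)
  also have "\<dots> = \<lblot>a \<otimes> (c \<oplus> d), t\<rblot>" unfolding \<open>z = _\<close> by (rule mult_cls) simp_all
  finally show "z \<otimes>\<^bsub>Q\<^esub> (x \<oplus>\<^bsub>Q\<^esub> y) = z \<otimes>\<^bsub>Q\<^esub> x \<oplus>\<^bsub>Q\<^esub> z \<otimes>\<^bsub>Q\<^esub> y"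
    by (simp add: add_cls mult_cls r_distr)
qed

sublocale Q: ring "Fract_algebra A" by (rule ring_Q)

lemma k_algebra_Q: "k_algebra Q"
  unfolding k_algebra_iff
proof (intro conjI allI ballI)
  show "ring Q" by (rule ring_Q)
next
  fix c :: 'k and x y assume "x \<in> carrier Q" "y \<in> carrier Q"
  then obtain a b s where [simp]: "a \<in> carrier A" "b \<in> carrier A" "s \<in> carrier A" "s \<noteq> \<zero>"
    "x = \<lblot>a, s\<rblot>" "y = \<lblot>b, s\<rblot>" by (rule common_denominator)
  show "c \<odot>\<^bsub>Q\<^esub> (x \<oplus>\<^bsub>Q\<^esub> y) = c \<odot>\<^bsub>Q\<^esub> x \<oplus>\<^bsub>Q\<^esub> c \<odot>\<^bsub>Q\<^esub> y"
    by (simp add: smult_cls add_cls smult_laws)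
next
  fix c d :: 'k
  fix x assume x: "x \<in> carrier Q"
  then obtain a s where [simp]: "a \<in> carrier A" "s \<in> carrier A" "s \<noteq> \<zero>" "x = \<lblot>a, s\<rblot>"
    by (rule carrier_Q_cases)
  show "c \<odot>\<^bsub>Q\<^esub> x \<in> carrier Q" by (simp add: smult_cls)
  show "(c + d) \<odot>\<^bsub>Q\<^esub> x = c \<odot>\<^bsub>Q\<^esub> x \<oplus>\<^bsub>Q\<^esub> d \<odot>\<^bsub>Q\<^esub> x" "(c * d) \<odot>\<^bsub>Q\<^esub> x = c \<odot>\<^bsub>Q\<^esub> (d \<odot>\<^bsub>Q\<^esub> x)" "1 \<odot>\<^bsub>Q\<^esub> x = x"
    by (simp_all add: smult_cls add_cls smult_laws)
  fix y assume y: "y \<in> carrier Q"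
  obtain b t where [simp]: "b \<in> carrier A" "t \<in> carrier A" "t \<noteq> \<zero>" "y = \<lblot>s \<otimes> b, t\<rblot>"
    using \<open>s \<in> carrier A\<close> \<open>s \<noteq> \<zero>\<close> y by (rule composable)
  show "c \<odot>\<^bsub>Q\<^esub> x \<otimes>\<^bsub>Q\<^esub> y = c \<odot>\<^bsub>Q\<^esub> (x \<otimes>\<^bsub>Q\<^esub> y)"
    by (simp add: smult_cls mult_cls smult_mult)
  have "x \<otimes>\<^bsub>Q\<^esub> (c \<odot>\<^bsub>Q\<^esub> y) = x \<otimes>\<^bsub>Q\<^esub> \<lblot>s \<otimes> (c \<odot> b), t\<rblot>" by (simp add: smult_cls smult_mult)
  also have "\<dots> = \<lblot>a \<otimes> (c \<odot> b), t\<rblot>" unfolding \<open>x = _\<close> by (rule mult_cls) simp_all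
  finally show "x \<otimes>\<^bsub>Q\<^esub> (c \<odot>\<^bsub>Q\<^esub> y) = c \<odot>\<^bsub>Q\<^esub> (x \<otimes>\<^bsub>Q\<^esub> y)"
    by (simp add: smult_cls mult_cls smult_mult)
qed

lemma inverse_cls:
  assumes "a \<in> carrier A" "s \<in> carrier A" "a \<noteq> \<zero>" "s \<noteq> \<zero>"
  shows "\<lblot>a, s\<rblot> \<otimes>\<^bsub>Q\<^esub> \<lblot>s, a\<rblot> = \<one>\<^bsub>Q\<^esub>"
  using assms mult_cls[of a s \<one> a] one_Q'[of a] by simp

lemma inv_cls:
  assumes "a \<in> carrier A" "s \<in> carrier A" "a \<noteq> \<zero>" "s \<noteq> \<zero>"
  shows "inv\<^bsub>Q\<^esub> \<lblot>a, s\<rblot> = \<lblot>s, a\<rblot>"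
  by (rule Q.inv_unique'[symmetric]) (simp_all add: assms inverse_cls)

lemma skew_field_Q: "skew_field Q"
proof -
  have ne: "\<one>\<^bsub>Q\<^esub> \<noteq> \<zero>\<^bsub>Q\<^esub>" using cls_eq_zero[of \<one> \<one>] one_not_zero by (simp add: one_Q)
  have "x \<in> Units Q" if x: "x \<in> carrier Q" "x \<noteq> \<zero>\<^bsub>Q\<^esub>" for x
  proof -
    obtain a s where *: "a \<in> carrier A" "s \<in> carrier A" "s \<noteq> \<zero>" "x = \<lblot>a, s\<rblot>"
      using carrier_Q_cases x(1) by metis
    then have "a \<noteq> \<zero>" using x(2) cls_eq_zero by blast
    then show ?thesis using * inverse_cls unfolding Units_def
      by (auto intro!: bexI[of _ "\<lblot>s, a\<rblot>"])
  qed
  moreover have "\<zero>\<^bsub>Q\<^esub> \<notin> Units Q"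
    using ne by (auto simp: Units_def)
  ultimately show ?thesis
    using ne Q.Units_closed by unfold_locales auto
qed

lemma division_ring_of_fractions_Fract:
  "division_ring_of_fractions A Q (to_Fract_algebra A)"
proof -
  have tf: "to_Fract_algebra A a = \<lblot>a, \<one>\<rblot>" for a by (simp add: to_Fract_algebra_def)
  have m1: "\<lblot>a, \<one>\<rblot> \<otimes>\<^bsub>Q\<^esub> \<lblot>b, \<one>\<rblot> = \<lblot>a \<otimes> b, \<one>\<rblot>"
    if "a \<in> carrier A" "b \<in> carrier A" for a b
    using mult_cls[of a \<one> b \<one>] one_not_zero that by simp
  have hom: "to_Fract_algebra A \<in> algebra_hom A Q"
    unfolding algebra_hom_def ring_hom_def
    by (simp add: tf one_not_zero m1 add_cls smult_cls one_Q)
  have inj: "inj_on (to_Fract_algebra A) (carrier A)"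
  proof (rule inj_onI)
    fix a b assume ab: "a \<in> carrier A" "b \<in> carrier A" "to_Fract_algebra A a = to_Fract_algebra A b"
    then have "((a, \<one>), (b, \<one>)) \<in> rel" using one_not_zero cls_eq_iff[of a \<one> b \<one>] by (simp only: tf frac_iff) simp
    from rel_any[OF this, of \<one> \<one>] show "a = b" using ab by simp
  qed
  have fr: "(\<exists>a\<in>carrier A. \<exists>s\<in>carrier A - {\<zero>}. q = to_Fract_algebra A a \<otimes>\<^bsub>Q\<^esub> inv\<^bsub>Q\<^esub> to_Fract_algebra A s) \<and>
    (\<exists>a\<in>carrier A. \<exists>s\<in>carrier A - {\<zero>}. q = inv\<^bsub>Q\<^esub> to_Fract_algebra A s \<otimes>\<^bsub>Q\<^esub> to_Fract_algebra A a)"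
    if q: "q \<in> carrier Q" for q
  proof -
    obtain a s where [simp]: "a \<in> carrier A" "s \<in> carrier A" "s \<noteq> \<zero>" "q = \<lblot>a, s\<rblot>"
      using carrier_Q_cases q by metis
    \<comment> \<open>From \<open>c s = v a\<close> follows \<open>a s^-1 = v^-1 c\<close>.\<close>
    obtain c v where [simp]: "c \<in> carrier A" "v \<in> carrier A" "v \<noteq> \<zero>" and cv: "c \<otimes> s = v \<otimes> a"
      using left_ore[of a s] by auto
    have 1: "q = \<lblot>a, \<one>\<rblot> \<otimes>\<^bsub>Q\<^esub> inv\<^bsub>Q\<^esub> \<lblot>s, \<one>\<rblot>"
      using mult_cls[of a \<one> \<one> s] one_not_zero by (simp add: inv_cls)
    have "\<lblot>c, \<one>\<rblot> = \<lblot>v \<otimes> a, s\<rblot>" using cls_expand[of c \<one> s] one_not_zero cv by simp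
    then have "q = inv\<^bsub>Q\<^esub> \<lblot>v, \<one>\<rblot> \<otimes>\<^bsub>Q\<^esub> \<lblot>c, \<one>\<rblot>"
      using mult_cls[of \<one> v a s] one_not_zero by (simp add: inv_cls)
    then have 2: "q = inv\<^bsub>Q\<^esub> to_Fract_algebra A v \<otimes>\<^bsub>Q\<^esub> to_Fract_algebra A c" by (simp only: tf)
    from 1 have 1: "q = to_Fract_algebra A a \<otimes>\<^bsub>Q\<^esub> inv\<^bsub>Q\<^esub> to_Fract_algebra A s" by (simp only: tf)
    have "s \<in> carrier A - {\<zero>}" "v \<in> carrier A - {\<zero>}" by simp_all
    then show ?thesis using 1 2 \<open>a \<in> carrier A\<close> \<open>c \<in> carrier A\<close> by metis
  qed
  show ?thesis
    unfolding division_ring_of_fractions_def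
    using k_alg k_algebra_Q skew_field_Q hom inj fr by blast
qed

end

section \<open>Isomorphisms between algebras of fractions\<close>

lemma algebra_isomorphic_trans:
  assumes "A \<cong>\<^sub>k B" "B \<cong>\<^sub>k C"
  shows "A \<cong>\<^sub>k C"
proof -
  obtain f g where f: "f \<in> algebra_hom A B" "bij_betw f (carrier A) (carrier B)"
    and g: "g \<in> algebra_hom B C" "bij_betw g (carrier B) (carrier C)"
    using assms unfolding algebra_isomorphic_def by blast
  have c: "f x \<in> carrier B" if "x \<in> carrier A" for x
    using f(2) that by (auto simp: bij_betw_def)
  have "g \<circ> f \<in> algebra_hom A C"
    using f(1) g(1) c by (auto simp: algebra_hom_def ring_hom_def)
  then show ?thesis
    unfolding algebra_isomorphic_def using bij_betw_trans[OF f(2) g(2)] by blast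
qed

lemma algebra_isomorphic_sym:
  assumes "A \<cong>\<^sub>k B" "k_algebra A"
  shows "B \<cong>\<^sub>k A"
proof -
  obtain f where f: "f \<in> algebra_hom A B" "bij_betw f (carrier A) (carrier B)"
    using assms unfolding algebra_isomorphic_def by blast
  interpret A: ring A using assms(2) by (simp add: k_algebra_iff)
  have sm: "c \<odot>\<^bsub>A\<^esub> x \<in> carrier A" if "x \<in> carrier A" for c x
    using assms(2) that by (auto simp: k_algebra_iff)
  define g where "g = inv_into (carrier A) f"
  have g: "bij_betw g (carrier B) (carrier A)"
    unfolding g_def by (rule bij_betw_inv_into[OF f(2)])
  have gf: "g (f x) = x" if "x \<in> carrier A" for x
    unfolding g_def using bij_betw_inv_into_left[OF f(2) that] .
  have ex: "\<exists>x\<in>carrier A. y = f x" if "y \<in> carrier B" for y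
    using f(2) that unfolding bij_betw_def by blast
  have hom: "f (x \<otimes>\<^bsub>A\<^esub> y) = f x \<otimes>\<^bsub>B\<^esub> f y" "f (x \<oplus>\<^bsub>A\<^esub> y) = f x \<oplus>\<^bsub>B\<^esub> f y"
    "f \<one>\<^bsub>A\<^esub> = \<one>\<^bsub>B\<^esub>" "f (c \<odot>\<^bsub>A\<^esub> x) = c \<odot>\<^bsub>B\<^esub> f x"
    if "x \<in> carrier A" "y \<in> carrier A" for x y c
    using f(1) that by (auto simp: algebra_hom_def ring_hom_def)
  have "g \<in> ring_hom B A"
  proof (rule ring_hom_memI)
    fix x y assume "x \<in> carrier B" "y \<in> carrier B"
    then obtain u v where uv: "u \<in> carrier A" "v \<in> carrier A" "x = f u" "y = f v" using ex by metis
    show "g (x \<otimes>\<^bsub>B\<^esub> y) = g x \<otimes>\<^bsub>A\<^esub> g y"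
      using uv hom(1)[of u v] gf[of "u \<otimes>\<^bsub>A\<^esub> v"] gf[of u] gf[of v] by simp
    show "g (x \<oplus>\<^bsub>B\<^esub> y) = g x \<oplus>\<^bsub>A\<^esub> g y"
      using uv hom(2)[of u v] gf[of "u \<oplus>\<^bsub>A\<^esub> v"] gf[of u] gf[of v] by simp
  next
    show "g \<one>\<^bsub>B\<^esub> = \<one>\<^bsub>A\<^esub>" using hom(3)[of "\<one>\<^bsub>A\<^esub>" "\<one>\<^bsub>A\<^esub>"] gf[of "\<one>\<^bsub>A\<^esub>"] by simp
  qed (use g in \<open>auto simp: bij_betw_def\<close>)
  moreover have "g (c \<odot>\<^bsub>B\<^esub> x) = c \<odot>\<^bsub>A\<^esub> g x" if x: "x \<in> carrier B" for c x
  proof -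
    obtain u where u: "u \<in> carrier A" "x = f u" using ex x by metis
    then show ?thesis using hom(4)[of u u c] gf[of "c \<odot>\<^bsub>A\<^esub> u"] gf[of u] sm by simp
  qed
  ultimately show ?thesis
    unfolding algebra_isomorphic_def algebra_hom_def using g by blast
qed

text \<open>An embedding extends to fractions, and the extension is surjective as soon as every
  element of \<open>C\<close> is a right fraction over the image of \<open>A\<close>.\<close>

lemma Fract_algebra_isomorphic:
  assumes A: "ore_domain A" and C: "ore_domain C"
    and h: "h \<in> algebra_hom A C" "inj_on h (carrier A)"
    and frac: "\<And>c. c \<in> carrier C \<Longrightarrow>
      \<exists>a\<in>carrier A. \<exists>s\<in>carrier A - {\<zero>\<^bsub>A\<^esub>}. c \<otimes>\<^bsub>C\<^esub> h s = h a"
  shows "Fract_algebra A \<cong>\<^sub>k Fract_algebra C"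
proof -
  interpret A: ore_domain A by (rule A)
  interpret C: ore_domain C by (rule C)
  have h_closed [simp]: "h x \<in> carrier C" if "x \<in> carrier A" for x
    using h(1) that by (auto simp: algebra_hom_def ring_hom_def)
  have h_mult: "h (x \<otimes>\<^bsub>A\<^esub> y) = h x \<otimes>\<^bsub>C\<^esub> h y" if "x \<in> carrier A" "y \<in> carrier A" for x y
    using h(1) that by (auto simp: algebra_hom_def ring_hom_def)
  have h_add: "h (x \<oplus>\<^bsub>A\<^esub> y) = h x \<oplus>\<^bsub>C\<^esub> h y" if "x \<in> carrier A" "y \<in> carrier A" for x y
    using h(1) that by (auto simp: algebra_hom_def ring_hom_def)
  have h_smult: "h (c \<odot>\<^bsub>A\<^esub> x) = c \<odot>\<^bsub>C\<^esub> h x" if "x \<in> carrier A" for c x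
    using h(1) that by (auto simp: algebra_hom_def)
  have h_one: "h \<one>\<^bsub>A\<^esub> = \<one>\<^bsub>C\<^esub>"
    using h(1) by (auto simp: algebra_hom_def ring_hom_def)
  have h_zero: "h \<zero>\<^bsub>A\<^esub> = \<zero>\<^bsub>C\<^esub>"
    using h_add[of "\<zero>\<^bsub>A\<^esub>" "\<zero>\<^bsub>A\<^esub>"] C.add.l_cancel_one[of "h \<zero>\<^bsub>A\<^esub>" "h \<zero>\<^bsub>A\<^esub>"] by simp
  have h_nz [simp]: "h x \<noteq> \<zero>\<^bsub>C\<^esub>" if "x \<in> carrier A" "x \<noteq> \<zero>\<^bsub>A\<^esub>" for x
    using inj_onD[OF h(2), of x "\<zero>\<^bsub>A\<^esub>"] that h_zero by auto
  define H where "H K = frac_rel C `` {(h a, h s) | a s. (a, s) \<in> K}" for K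
  have H: "H (frac_rel A `` {(a, s)}) = frac_rel C `` {(h a, h s)}"
    if [simp]: "a \<in> carrier A" "s \<in> carrier A" "s \<noteq> \<zero>\<^bsub>A\<^esub>" for a s
    unfolding H_def
  proof (rule C.rel_image_eqI, goal_cases)
    case (1 y)
    then obtain b t where y: "y = (h b, h t)" and bt: "((a, s), (b, t)) \<in> frac_rel A" by blast
    have [simp]: "b \<in> carrier A" "t \<in> carrier A" "t \<noteq> \<zero>\<^bsub>A\<^esub>" using A.rel_frac[OF bt] by simp_all
    obtain u v where uv: "u \<in> carrier A" "v \<in> carrier A" "u \<noteq> \<zero>\<^bsub>A\<^esub>" "s \<otimes>\<^bsub>A\<^esub> u = t \<otimes>\<^bsub>A\<^esub> v"
      using A.common_multiple_ex[of s t] by auto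
    have "a \<otimes>\<^bsub>A\<^esub> u = b \<otimes>\<^bsub>A\<^esub> v" by (rule A.rel_any[OF bt uv(1,2,4)])
    then have "h a \<otimes>\<^bsub>C\<^esub> h u = h b \<otimes>\<^bsub>C\<^esub> h v" "h s \<otimes>\<^bsub>C\<^esub> h u = h t \<otimes>\<^bsub>C\<^esub> h v"
      using uv by (simp_all flip: h_mult)
    then show ?case unfolding y using uv by (intro C.relI[where u = "h u" and v = "h v"]) simp_all
  next
    case 2
    have "((a, s), (a, s)) \<in> frac_rel A" using A.equiv_rel by (simp add: equiv_def refl_on_def)
    then show ?case by blast
  qed
  have "H \<in> algebra_hom (Fract_algebra A) (Fract_algebra C)"
    unfolding algebra_hom_def mem_Collect_eq
  proof (intro conjI ring_hom_memI allI ballI)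
    fix x assume "x \<in> carrier (Fract_algebra A)"
    then obtain a s where as [simp]: "a \<in> carrier A" "s \<in> carrier A" "s \<noteq> \<zero>\<^bsub>A\<^esub>"
        and x: "x = frac_rel A `` {(a, s)}"
      by (rule A.carrier_Q_cases)
    show "H x \<in> carrier (Fract_algebra C)" unfolding x by (simp add: H)
    show "H (c \<odot>\<^bsub>Fract_algebra A\<^esub> x) = c \<odot>\<^bsub>Fract_algebra C\<^esub> H x" for c
      unfolding x by (simp add: H A.smult_cls C.smult_cls h_smult)
  next
    fix x y assume Q: "x \<in> carrier (Fract_algebra A)" "y \<in> carrier (Fract_algebra A)"
    obtain a s where as [simp]: "a \<in> carrier A" "s \<in> carrier A" "s \<noteq> \<zero>\<^bsub>A\<^esub>"
        and x: "x = frac_rel A `` {(a, s)}"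
      using Q(1) by (rule A.carrier_Q_cases)
    obtain c t where ct [simp]: "c \<in> carrier A" "t \<in> carrier A" "t \<noteq> \<zero>\<^bsub>A\<^esub>"
        and y: "y = frac_rel A `` {(s \<otimes>\<^bsub>A\<^esub> c, t)}"
      using as(2,3) Q(2) by (rule A.composable)
    show "H (x \<otimes>\<^bsub>Fract_algebra A\<^esub> y) = H x \<otimes>\<^bsub>Fract_algebra C\<^esub> H y"
      unfolding x y by (simp add: H A.mult_cls C.mult_cls h_mult)
  next
    fix x y assume "x \<in> carrier (Fract_algebra A)" "y \<in> carrier (Fract_algebra A)"
    then obtain a b s where as [simp]: "a \<in> carrier A" "b \<in> carrier A" "s \<in> carrier A" "s \<noteq> \<zero>\<^bsub>A\<^esub>"
        and xy: "x = frac_rel A `` {(a, s)}" "y = frac_rel A `` {(b, s)}"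
      by (rule A.common_denominator)
    show "H (x \<oplus>\<^bsub>Fract_algebra A\<^esub> y) = H x \<oplus>\<^bsub>Fract_algebra C\<^esub> H y"
      unfolding xy by (simp add: H A.add_cls C.add_cls h_add)
  next
    show "H \<one>\<^bsub>Fract_algebra A\<^esub> = \<one>\<^bsub>Fract_algebra C\<^esub>"
      by (simp add: H A.one_Q C.one_Q h_one A.one_not_zero)
  qed
  moreover have "inj_on H (carrier (Fract_algebra A))"
  proof (rule inj_onI)
    fix x y assume Q: "x \<in> carrier (Fract_algebra A)" "y \<in> carrier (Fract_algebra A)" and eq: "H x = H y"
    obtain a b s where as [simp]: "a \<in> carrier A" "b \<in> carrier A" "s \<in> carrier A" "s \<noteq> \<zero>\<^bsub>A\<^esub>"
        and xy: "x = frac_rel A `` {(a, s)}" "y = frac_rel A `` {(b, s)}"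
      using Q by (rule A.common_denominator)
    have "((h a, h s), (h b, h s)) \<in> frac_rel C"
      using eq C.cls_eq_iff[of "h a" "h s" "h b" "h s"] unfolding xy by (simp add: H)
    from C.rel_any[OF this, of "\<one>\<^bsub>C\<^esub>" "\<one>\<^bsub>C\<^esub>"] have "h a = h b" by simp
    then have "a = b" using inj_onD[OF h(2)] by simp
    then show "x = y" unfolding xy by simp
  qed
  moreover have "\<exists>x\<in>carrier (Fract_algebra A). y = H x" if Q: "y \<in> carrier (Fract_algebra C)" for y
  proof -
    have frac': "\<exists>a s. a \<in> carrier A \<and> s \<in> carrier A \<and> s \<noteq> \<zero>\<^bsub>A\<^esub> \<and> c \<otimes>\<^bsub>C\<^esub> h s = h a"
      if "c \<in> carrier C" for c
      using frac[OF that] by blast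
    obtain c d where cd [simp]: "c \<in> carrier C" "d \<in> carrier C" "d \<noteq> \<zero>\<^bsub>C\<^esub>"
        and y: "y = frac_rel C `` {(c, d)}"
      using Q by (rule C.carrier_Q_cases)
    obtain a s where as [simp]: "a \<in> carrier A" "s \<in> carrier A" "s \<noteq> \<zero>\<^bsub>A\<^esub>" and 1: "c \<otimes>\<^bsub>C\<^esub> h s = h a"
      using frac'[OF cd(1)] by (elim exE conjE) (rule that)
    obtain b t where bt [simp]: "b \<in> carrier A" "t \<in> carrier A" "t \<noteq> \<zero>\<^bsub>A\<^esub>" and 2: "d \<otimes>\<^bsub>C\<^esub> h t = h b"
      using frac'[OF cd(2)] by (elim exE conjE) (rule that)
    obtain u v where uv [simp]: "u \<in> carrier A" "v \<in> carrier A" "u \<noteq> \<zero>\<^bsub>A\<^esub>" "v \<noteq> \<zero>\<^bsub>A\<^esub>"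
        and su: "s \<otimes>\<^bsub>A\<^esub> u = t \<otimes>\<^bsub>A\<^esub> v"
      using A.common_multiple_ex[of s t] by auto
    \<comment> \<open>With \<open>s u = t v\<close>, the single multiplier \<open>h (s u)\<close>
      moves numerator and denominator of \<open>c d^-1\<close> into the image at once; the preimage
      is \<open>(a u) (b v)^-1\<close>.\<close>
    have e1: "c \<otimes>\<^bsub>C\<^esub> h (s \<otimes>\<^bsub>A\<^esub> u) = h (a \<otimes>\<^bsub>A\<^esub> u)"
      using 1 by (simp add: h_mult flip: C.m_assoc)
    have e2: "d \<otimes>\<^bsub>C\<^esub> h (s \<otimes>\<^bsub>A\<^esub> u) = h (b \<otimes>\<^bsub>A\<^esub> v)"
      unfolding su using 2 by (simp add: h_mult flip: C.m_assoc)
    have nz: "h (s \<otimes>\<^bsub>A\<^esub> u) \<noteq> \<zero>\<^bsub>C\<^esub>" by (intro h_nz) (simp_all add: A.mult_eq_zero)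
    have "b \<otimes>\<^bsub>A\<^esub> v \<noteq> \<zero>\<^bsub>A\<^esub>"
    proof
      assume "b \<otimes>\<^bsub>A\<^esub> v = \<zero>\<^bsub>A\<^esub>"
      then have "d \<otimes>\<^bsub>C\<^esub> h (s \<otimes>\<^bsub>A\<^esub> u) = \<zero>\<^bsub>C\<^esub>" using e2 h_zero by simp
      then show False using nz C.integral[of d "h (s \<otimes>\<^bsub>A\<^esub> u)"] by simp
    qed
    then have "H (frac_rel A `` {(a \<otimes>\<^bsub>A\<^esub> u, b \<otimes>\<^bsub>A\<^esub> v)}) = y"
      unfolding y using C.cls_expand[of c d "h (s \<otimes>\<^bsub>A\<^esub> u)"] nz e1 e2 by (simp add: H)
    moreover have "frac_rel A `` {(a \<otimes>\<^bsub>A\<^esub> u, b \<otimes>\<^bsub>A\<^esub> v)} \<in> carrier (Fract_algebra A)"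
      using \<open>b \<otimes>\<^bsub>A\<^esub> v \<noteq> \<zero>\<^bsub>A\<^esub>\<close> by simp
    ultimately show ?thesis by metis
  qed
  moreover from calculation(1) have "H ` carrier (Fract_algebra A) \<subseteq> carrier (Fract_algebra C)"
    by (simp add: algebra_hom_def ring_hom_def Pi_iff image_subset_iff)
  ultimately have "bij_betw H (carrier (Fract_algebra A)) (carrier (Fract_algebra C))"
    unfolding bij_betw_def by (intro conjI subset_antisym) (assumption, assumption, rule subsetI, simp add: image_iff)
  with \<open>H \<in> _\<close> show ?thesis unfolding algebra_isomorphic_def by blast
qed


section \<open>Linear extension and finitely supported functions\<close>

abbreviation "lookup \<equiv> Poly_Mapping.lookup"
abbreviation "keys \<equiv> Poly_Mapping.keys"

definition pm_scale :: "'k::field \<Rightarrow> ('a \<Rightarrow>\<^sub>0 'k) \<Rightarrow> 'a \<Rightarrow>\<^sub>0 'k" where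
  "pm_scale c = Poly_Mapping.map ((*) c)"

lemma lookup_pm_scale [simp]: "lookup (pm_scale c f) x = c * lookup f x"
  by (simp add: pm_scale_def Poly_Mapping.map.rep_eq when_def)

lemma pm_scale_single [simp]: "pm_scale c (Poly_Mapping.single x d) = Poly_Mapping.single x (c * d)"
  by (rule poly_mapping_eqI) (simp add: lookup_single when_def)

lemma pm_expand:
  fixes f :: "'a \<Rightarrow>\<^sub>0 'b::comm_monoid_add"
  shows "f = (\<Sum>x\<in>keys f. Poly_Mapping.single x (lookup f x))"
  by (rule poly_mapping_eqI)
    (auto simp: lookup_sum lookup_single when_def in_keys_iff sum.delta' split: if_splits)

lemma pm_induct [case_names zero single add]:
  fixes f :: "'a \<Rightarrow>\<^sub>0 'b::comm_monoid_add"
  assumes "P 0" "\<And>x c. P (Poly_Mapping.single x c)" "\<And>f g. P f \<Longrightarrow> P g \<Longrightarrow> P (f + g)"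
  shows "P f"
proof -
  have "P (\<Sum>x\<in>W. Poly_Mapping.single x (lookup f x))" for W
    by (induction W rule: infinite_finite_induct) (auto simp: assms)
  then show ?thesis using pm_expand[of f] by metis
qed

locale linear_extension = vector_space scale
  for scale :: "'k::field \<Rightarrow> 'a::ab_group_add \<Rightarrow> 'a"
begin

text \<open>The linear map with prescribed values on the basis; the twisted product and the
  evaluation of noncommutative polynomials are both instances.\<close>

definition linear_ext :: "('x \<Rightarrow> 'a) \<Rightarrow> ('x \<Rightarrow>\<^sub>0 'k) \<Rightarrow> 'a" where
  "linear_ext h f = (\<Sum>x\<in>keys f. scale (lookup f x) (h x))"

lemma linear_ext_superset:
  fixes f :: "'x \<Rightarrow>\<^sub>0 'k"
  assumes "finite W" "keys f \<subseteq> W"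
  shows "linear_ext h f = (\<Sum>x\<in>W. scale (lookup f x) (h x))"
  unfolding linear_ext_def using assms
  by (intro sum.mono_neutral_left) (auto simp: in_keys_iff)

lemma linear_ext_add: "linear_ext h (f + g) = linear_ext h f + linear_ext h g"
proof -
  let ?W = "keys f \<union> keys g"
  have "keys (f + g) \<subseteq> ?W" by (rule keys_add)
  then show ?thesis
    by (simp add: linear_ext_superset[of ?W] lookup_add scale_left_distrib sum.distrib)
qed

lemma linear_ext_zero [simp]: "linear_ext h 0 = 0"
  by (simp add: linear_ext_def)

lemma linear_ext_single [simp]: "linear_ext h (Poly_Mapping.single x c) = scale c (h x)"
  by (simp add: linear_ext_def)

lemma linear_ext_scale: "linear_ext h (pm_scale c f) = scale c (linear_ext h f)"
proof -
  have "keys (pm_scale c f) \<subseteq> keys f" by (auto simp: in_keys_iff)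
  then show ?thesis
    by (simp add: linear_ext_superset[of "keys f"] scale_sum_right)
qed

lemma linear_ext_minus: "linear_ext h (- f) = - linear_ext h f"
  using linear_ext_add[of h f "- f"] by (simp add: eq_neg_iff_add_eq_0 add.commute)

lemma linear_ext_diff: "linear_ext h (f - g) = linear_ext h f - linear_ext h g"
  using linear_ext_add[of h f "- g"] by (simp add: linear_ext_minus)

lemma linear_ext_fun_add: "linear_ext (\<lambda>x. h x + h' x) f = linear_ext h f + linear_ext h' f"
  by (simp add: linear_ext_def scale_right_distrib sum.distrib)

lemma linear_ext_fun_scale: "linear_ext (\<lambda>x. scale c (h x)) f = scale c (linear_ext h f)"
  by (simp add: linear_ext_def scale_sum_right mult.commute)

end

interpretation pm: linear_extension pm_scale
  by unfold_locales (auto intro!: poly_mapping_eqI simp: lookup_add algebra_simps)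

lemma lookup_linear_ext:
  "lookup (pm.linear_ext h f) z = (\<Sum>x\<in>keys f. lookup f x * lookup (h x) z)"
  by (simp add: pm.linear_ext_def lookup_sum)

locale unital_algebra = linear_extension scale
  for scale :: "'k::field \<Rightarrow> 'a::ab_group_add \<Rightarrow> 'a" (infixr \<open>*s\<close> 75) +
  fixes mul :: "'a \<Rightarrow> 'a \<Rightarrow> 'a" (infixl \<open>\<star>\<close> 70) and unit :: 'a
  assumes mul_assoc: "(x \<star> y) \<star> z = x \<star> (y \<star> z)"
    and mul_add_left: "(x + y) \<star> z = x \<star> z + y \<star> z"
    and mul_add_right: "x \<star> (y + z) = x \<star> y + x \<star> z"
    and mul_scale_left: "(c *s x) \<star> y = c *s (x \<star> y)"
    and mul_scale_right: "x \<star> (c *s y) = c *s (x \<star> y)"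
    and unit_mul [simp]: "unit \<star> x = x"
    and mul_unit [simp]: "x \<star> unit = x"
begin

lemma mul_zero [simp]: "0 \<star> x = 0" "x \<star> 0 = 0"
  using mul_add_left[of 0 0 x] mul_add_right[of x 0 0] by simp_all

lemma mul_minus: "(- x) \<star> y = - (x \<star> y)" "x \<star> (- y) = - (x \<star> y)"
  using mul_add_left[of x "-x" y] mul_add_right[of x y "-y"] by (simp_all add: eq_neg_iff_add_eq_0 add.commute)

lemma mul_diff: "(x - y) \<star> z = x \<star> z - y \<star> z" "z \<star> (x - y) = z \<star> x - z \<star> y"
  using mul_add_left[of x "-y" z] mul_add_right[of z x "-y"] by (simp_all add: mul_minus)

lemma mul_sum_left: "sum f I \<star> y = (\<Sum>i\<in>I. f i \<star> y)"
  by (induction I rule: infinite_finite_induct) (auto simp: mul_add_left)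

lemma mul_sum_right: "y \<star> sum f I = (\<Sum>i\<in>I. y \<star> f i)"
  by (induction I rule: infinite_finite_induct) (auto simp: mul_add_right)

definition is_subalgebra :: "'a set \<Rightarrow> bool" where
  "is_subalgebra W \<longleftrightarrow> subspace W \<and> unit \<in> W \<and> (\<forall>x\<in>W. \<forall>y\<in>W. x \<star> y \<in> W)"

lemma is_subalgebraD:
  assumes "is_subalgebra W"
  shows "unit \<in> W" "0 \<in> W" "x \<in> W \<Longrightarrow> y \<in> W \<Longrightarrow> x + y \<in> W" "x \<in> W \<Longrightarrow> y \<in> W \<Longrightarrow> x \<star> y \<in> W"
    "x \<in> W \<Longrightarrow> c *s x \<in> W" "x \<in> W \<Longrightarrow> - x \<in> W" "x \<in> W \<Longrightarrow> y \<in> W \<Longrightarrow> x - y \<in> W"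
    "(\<And>i. i \<in> I \<Longrightarrow> f i \<in> W) \<Longrightarrow> sum f I \<in> W"
  using assms by (auto simp: is_subalgebra_def subspace_0 subspace_add subspace_scale subspace_neg
      subspace_diff subspace_sum)

text \<open>Right fractions over \<open>W\<close> that exist in the ambient algebra, so that no
  ambient division ring is required. In the Ore setting below they form a subalgebra.\<close>

definition fraction_closure :: "'a set \<Rightarrow> 'a set" where
  "fraction_closure W = {x. \<exists>s\<in>W - {0}. x \<star> s \<in> W}"

definition subalgebra_record :: "'a set \<Rightarrow> ('k, 'a) module" where
  "subalgebra_record W = \<lparr>carrier = W, monoid.mult = (\<star>), one = unit, ring.zero = 0, add = (+),
     module.smult = (*s)\<rparr>"

lemma subalgebra_record_simps [simp]:
  "carrier (subalgebra_record W) = W"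
  "x \<otimes>\<^bsub>subalgebra_record W\<^esub> y = x \<star> y"
  "\<one>\<^bsub>subalgebra_record W\<^esub> = unit"
  "\<zero>\<^bsub>subalgebra_record W\<^esub> = 0"
  "x \<oplus>\<^bsub>subalgebra_record W\<^esub> y = x + y"
  "c \<odot>\<^bsub>subalgebra_record W\<^esub> y = c *s y"
  by (simp_all add: subalgebra_record_def)

lemma k_algebra_subalgebra:
  assumes "is_subalgebra W"
  shows "k_algebra (subalgebra_record W)"
proof -
  note W = is_subalgebraD[OF assms]
  have "abelian_group (subalgebra_record W)"
  proof (rule abelian_groupI)
    fix x assume "x \<in> carrier (subalgebra_record W)"
    then have "- x \<in> W" "- x + x = 0" using W by simp_all
    then show "\<exists>y\<in>carrier (subalgebra_record W). y \<oplus>\<^bsub>subalgebra_record W\<^esub> x = \<zero>\<^bsub>subalgebra_record W\<^esub>"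
      by (metis subalgebra_record_simps(1,4,5))
  qed (use W in \<open>auto simp: algebra_simps\<close>)
  moreover have "Group.monoid (subalgebra_record W)"
    by (rule monoidI) (use W in \<open>auto simp: mul_assoc\<close>)
  ultimately have "ring (subalgebra_record W)"
    by (rule ringI) (auto simp: mul_add_left mul_add_right)
  then show ?thesis
    unfolding k_algebra_iff using W
    by (simp add: mul_scale_left mul_scale_right scale_left_distrib scale_right_distrib)
qed

end


text \<open>With \<open>m + 1\<close> a power of two, both sides are powers of two and the claim
  becomes \<open>2 * q * K < m\<close>. Since \<open>2 * K = q - 1\<close>, it follows from
  \<open>(q + 1)^2 \<le> m + 1\<close>.\<close>

lemma poly_less_exp: "\<exists>m::nat. (m + 1) ^ K < 2 ^ m"
proof -
  define q where "q = 2 * K + 1"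
  define m where "m = 2 ^ (2 * q) - (1::nat)"
  have m: "m + 1 = 2 ^ (2 * q)" by (simp add: m_def)
  have "q + 1 \<le> 2 ^ q" using less_exp[of q] by linarith
  then have "(q + 1) ^ 2 \<le> (2 ^ q) ^ 2" by (rule power_mono) simp
  also have "\<dots> = m + 1" unfolding m by (simp add: power_mult mult.commute)
  finally have "2 * q * K < m"
    by (cases K) (simp_all add: q_def power2_eq_square algebra_simps m_def)
  then have "(m + 1) ^ K < 2 ^ m"
    unfolding m by (simp add: power_mult[symmetric])
  then show ?thesis by blast
qed


section \<open>Twisted group algebras of ordered groups\<close>

text \<open>A bimultiplicative \<open>c\<close> is a 2-cocycle, which makes the twisted product of
  basis elements associative. The order on exponents provides leading terms; the ring class allows
  multiples to be written as \<open>of_nat k * x\<close>.\<close>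

locale twisted_group_algebra =
  fixes c :: "'e::linordered_idom \<Rightarrow> 'e \<Rightarrow> 'k::field"
  assumes c_add_left: "c (x + y) z = c x z * c y z"
    and c_add_right: "c x (y + z) = c x y * c x z"
    and c_nonzero: "c x y \<noteq> 0"
begin

lemma c_zero [simp]: "c 0 y = 1" "c x 0 = 1"
  using c_add_left[of 0 0 y] c_add_right[of x 0 0] c_nonzero[of 0 y] c_nonzero[of x 0] by simp_all

definition tmul :: "('e \<Rightarrow>\<^sub>0 'k) \<Rightarrow> ('e \<Rightarrow>\<^sub>0 'k) \<Rightarrow> ('e \<Rightarrow>\<^sub>0 'k)" (infixl \<open>\<star>\<close> 70) where
  "f \<star> g = pm.linear_ext (\<lambda>x. pm.linear_ext (\<lambda>y. Poly_Mapping.single (x + y) (c x y)) g) f"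

lemma tmul_single [simp]:
  "Poly_Mapping.single x a \<star> Poly_Mapping.single y b = Poly_Mapping.single (x + y) (a * b * c x y)"
  by (simp add: tmul_def mult.assoc)

lemma tmul_add_left: "(f + g) \<star> h = f \<star> h + g \<star> h"
  by (simp add: tmul_def pm.linear_ext_add)

lemma tmul_add_right: "f \<star> (g + h) = f \<star> g + f \<star> h"
  by (simp add: tmul_def pm.linear_ext_add pm.linear_ext_fun_add)

lemma tmul_zero: "0 \<star> f = 0" "f \<star> 0 = 0"
  by (simp_all add: tmul_def pm.linear_ext_def)

lemma tmul_scale_left: "pm_scale a f \<star> h = pm_scale a (f \<star> h)"
  by (simp add: tmul_def pm.linear_ext_scale)

lemma tmul_scale_right: "f \<star> pm_scale a h = pm_scale a (f \<star> h)"
  by (simp add: tmul_def pm.linear_ext_scale pm.linear_ext_fun_scale)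

lemma tmul_assoc: "(f \<star> g) \<star> h = f \<star> (g \<star> h)"
proof (induction f rule: pm_induct)
  case (single x a)
  show ?case
  proof (induction g rule: pm_induct)
    case (single y b)
    show ?case
      by (induction h rule: pm_induct)
        (simp_all add: tmul_zero tmul_add_right add.assoc c_add_left c_add_right mult_ac)
  qed (simp_all add: tmul_zero tmul_add_left tmul_add_right)
qed (simp_all add: tmul_zero tmul_add_left)

abbreviation tone :: "'e \<Rightarrow>\<^sub>0 'k" where "tone \<equiv> 1"

lemma tone_mul: "tone \<star> f = f" "f \<star> tone = f"
  by (induction f rule: pm_induct)
    (simp_all add: tmul_zero tmul_add_left tmul_add_right flip: single_one)

sublocale unital_algebra pm_scale tmul tone
  by unfold_locales
    (auto simp: tmul_assoc tmul_add_left tmul_add_right tmul_scale_left tmul_scale_right tone_mul)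

lemma keys_tmul: "keys (f \<star> g) \<subseteq> {x + y |x y. x \<in> keys f \<and> y \<in> keys g}"
proof
  fix z assume "z \<in> keys (f \<star> g)"
  then have "(\<Sum>x\<in>keys f. lookup f x * (\<Sum>y\<in>keys g. lookup g y * (if x + y = z then c x y else 0))) \<noteq> 0"
    by (simp add: in_keys_iff tmul_def lookup_linear_ext lookup_single when_def)
  then obtain x where x: "x \<in> keys f" "(\<Sum>y\<in>keys g. lookup g y * (if x + y = z then c x y else 0)) \<noteq> 0"
    by (metis (no_types, lifting) mult_zero_right sum.neutral)
  then obtain y where "y \<in> keys g" "lookup g y * (if x + y = z then c x y else 0) \<noteq> 0"
    by (metis (no_types, lifting) sum.neutral)
  then have "y \<in> keys g" "x + y = z" by (auto split: if_splits)
  with x(1) show "z \<in> {x + y |x y. x \<in> keys f \<and> y \<in> keys g}" by blast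
qed

text \<open>A relation instead of a function: zero has no leading exponent, so each instance also
  certifies nonvanishing.\<close>

definition leading :: "('e \<Rightarrow>\<^sub>0 'k) \<Rightarrow> 'e \<Rightarrow> bool" where
  "leading f x \<longleftrightarrow> x \<in> keys f \<and> (\<forall>y\<in>keys f. y \<le> x)"

lemma leading_exists:
  assumes "f \<noteq> 0"
  obtains x where "leading f x"
proof -
  have "keys f \<noteq> {}" using assms pm_expand[of f] by auto
  then have "leading f (Max (keys f))" by (simp add: leading_def)
  then show ?thesis by (rule that)
qed

lemma leading_nonzero: "leading f x \<Longrightarrow> f \<noteq> 0"
  by (auto simp: leading_def)

lemma leading_single: "a \<noteq> 0 \<Longrightarrow> leading (Poly_Mapping.single x a) x"
  by (simp add: leading_def)

text \<open>In an ordered group, \<open>x + y\<close> is a sum of exponents of \<open>f\<close> and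
  \<open>g\<close> only as the sum of the two maxima. Its coefficient is thus a single product,
  nonzero because \<open>c\<close> does not vanish.\<close>

lemma leading_mul:
  assumes f: "leading f x" and g: "leading g y"
  shows "leading (f \<star> g) (x + y)"
proof -
  have *: "x' = x \<and> y' = y" if "x' \<in> keys f" "y' \<in> keys g" "x' + y' = x + y" for x' y'
  proof -
    have "x' \<le> x" "y' \<le> y" using f g that by (auto simp: leading_def)
    then show ?thesis using that(3) by (metis add_le_cancel_left add_le_imp_le_right order_antisym add_left_cancel add_mono order_refl)
  qed
  have "lookup (f \<star> g) (x + y) =
    (\<Sum>x'\<in>keys f. lookup f x' * (\<Sum>y'\<in>keys g. lookup g y' * (if x' + y' = x + y then c x' y' else 0)))"
    by (simp add: tmul_def lookup_linear_ext lookup_single when_def)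
  also have "\<dots> = (\<Sum>x'\<in>keys f. if x' = x then lookup f x * (\<Sum>y'\<in>keys g. if y' = y then lookup g y * c x y else 0) else 0)"
  proof (rule sum.cong[OF refl])
    fix x' assume x': "x' \<in> keys f"
    have "(\<Sum>y'\<in>keys g. lookup g y' * (if x' + y' = x + y then c x' y' else 0)) =
      (\<Sum>y'\<in>keys g. if x' = x \<and> y' = y then lookup g y * c x y else 0)"
      by (rule sum.cong) (use *[OF x'] in auto)
    then show "lookup f x' * (\<Sum>y'\<in>keys g. lookup g y' * (if x' + y' = x + y then c x' y' else 0)) =
      (if x' = x then lookup f x * (\<Sum>y'\<in>keys g. if y' = y then lookup g y * c x y else 0) else 0)"
      by simp
  qed
  also have "\<dots> = lookup f x * lookup g y * c x y"
    using f g by (simp add: leading_def)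
  finally have "lookup (f \<star> g) (x + y) \<noteq> 0"
    using f g c_nonzero[of x y] by (simp add: leading_def in_keys_iff)
  moreover have "z \<le> x + y" if "z \<in> keys (f \<star> g)" for z
    using subsetD[OF keys_tmul that] f g by (auto simp: leading_def intro!: add_mono)
  ultimately show ?thesis by (simp add: leading_def in_keys_iff)
qed

lemma leading_add_less:
  assumes "leading f x" "\<And>y. y \<in> keys g \<Longrightarrow> y < x"
  shows "leading (f + g) x"
proof -
  have "x \<notin> keys g" using assms(2) by blast
  then have "x \<in> keys (f + g)" using assms(1) by (simp add: leading_def in_keys_iff lookup_add)
  moreover have "y \<le> x" if "y \<in> keys (f + g)" for y
    using subsetD[OF keys_add that] assms by (auto simp: leading_def intro: less_imp_le)
  ultimately show ?thesis by (simp add: leading_def)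
qed

lemma tmul_eq_zero: "f \<star> g = 0 \<longleftrightarrow> f = 0 \<or> g = 0"
proof
  assume fg: "f \<star> g = 0"
  show "f = 0 \<or> g = 0"
  proof (rule ccontr)
    assume "\<not> ?thesis"
    then obtain x y where "leading f x" "leading g y" using leading_exists by metis
    then show False using leading_mul leading_nonzero fg by blast
  qed
qed auto

lemma tmul_cancel_left: "z \<noteq> 0 \<Longrightarrow> z \<star> x = z \<star> y \<Longrightarrow> x = y"
  using tmul_eq_zero[of z "x - y"] by (simp add: mul_diff)

section \<open>Growth and the Ore condition\<close>

definition sumset :: "'e set \<Rightarrow> nat \<Rightarrow> 'e set" where
  "sumset S m = (\<lambda>h. \<Sum>x\<in>S. of_nat (h x) * x) ` (S \<rightarrow>\<^sub>E {..m})"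

text \<open>Elements are indexed by multiplicities in \<open>{..m}\<close>, one for each exponent in
  \<open>S\<close>. This allows more than \<open>m\<close> summands in total but keeps the bound
  polynomial in \<open>m\<close>, which is all that the growth argument asks for.\<close>

lemma card_sumset: "finite S \<Longrightarrow> finite (sumset S m) \<and> card (sumset S m) \<le> (m + 1) ^ card S"
  unfolding sumset_def
  using card_image_le[of "S \<rightarrow>\<^sub>E {..m}" "\<lambda>h. \<Sum>x\<in>S. of_nat (h x) * x"]
  by (simp add: finite_PiE card_PiE)

lemma zero_in_sumset: "0 \<in> sumset S m"
  unfolding sumset_def
  by (rule image_eqI[of _ _ "\<lambda>x\<in>S. 0"]) (auto cong: sum.cong)

lemma sumset_add:
  assumes "finite S" "x \<in> S" "y \<in> sumset S m"
  shows "x + y \<in> sumset S (Suc m)"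
proof -
  obtain h where h: "h \<in> S \<rightarrow>\<^sub>E {..m}" "y = (\<Sum>x\<in>S. of_nat (h x) * x)"
    using assms(3) by (auto simp: sumset_def)
  have "(\<Sum>z\<in>S. of_nat ((h(x := Suc (h x))) z) * z) = (\<Sum>z\<in>S. of_nat (h z) * z + (if z = x then x else 0))"
    by (rule sum.cong) (auto simp: algebra_simps)
  also have "\<dots> = x + y" using assms h by (simp add: sum.distrib add.commute)
  finally have "x + y = (\<Sum>z\<in>S. of_nat ((h(x := Suc (h x))) z) * z)" ..
  moreover have "h(x := Suc (h x)) \<in> S \<rightarrow>\<^sub>E {..Suc m}"
    using h(1) assms(2) by (auto simp: PiE_iff extensional_def le_Suc_eq)
  ultimately show ?thesis unfolding sumset_def by blast
qed

text \<open>Jategaonkar's argument: if \<open>a W\<close> and \<open>s W\<close> meet only in zero then the \<open>2\<^sup>m\<close> words of length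
  \<open>m\<close> in \<open>a\<close> and \<open>s\<close> are linearly independent, but their supports lie in a set whose
  cardinality is polynomial in \<open>m\<close>.\<close>

lemma independent_words:
  assumes W: "is_subalgebra W" and as: "a \<in> W" "s \<in> W" "a \<noteq> 0" "s \<noteq> 0"
    and no_common: "\<And>u v. u \<in> W \<Longrightarrow> v \<in> W \<Longrightarrow> a \<star> u = s \<star> v \<Longrightarrow> u = 0"
  shows "\<exists>B. finite B \<and> card B = 2 ^ m \<and> \<not> pm.dependent B \<and> B \<subseteq> W \<and>
    (\<forall>f\<in>B. keys f \<subseteq> sumset (keys a \<union> keys s) m)"
proof (induction m)
  case 0
  have "\<not> pm.dependent {tone}"
    using leading_nonzero[OF leading_single[of 1 0]] by (simp add: pm.independent_insert)
  then show ?case using is_subalgebraD(1)[OF W] zero_in_sumset[of _ 0] by (intro exI[of _ "{tone}"]) auto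
next
  case (Suc m)
  then obtain B where B: "finite B" "card B = 2 ^ m" "\<not> pm.dependent B" "B \<subseteq> W"
    "\<And>f. f \<in> B \<Longrightarrow> keys f \<subseteq> sumset (keys a \<union> keys s) m" by blast
  have nc: "u = 0 \<and> v = 0" if "u \<in> W" "v \<in> W" "a \<star> u = s \<star> v" for u v
  proof -
    have "u = 0" by (rule no_common[OF that])
    then show ?thesis using that(3) tmul_eq_zero[of s v] as(4) by simp
  qed
  have "0 \<notin> B" using B(3) pm.dependent_zero by blast
  have disj: "(\<star>) a ` B \<inter> (\<star>) s ` B = {}"
  proof (rule equals0I, elim IntE imageE)
    fix z u v assume "z = a \<star> u" "u \<in> B" "z = s \<star> v" "v \<in> B"
    then show False using nc[of u v] B(4) \<open>0 \<notin> B\<close> by auto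
  qed
  have inj: "inj_on ((\<star>) a) B" "inj_on ((\<star>) s) B"
    using tmul_cancel_left[OF as(3)] tmul_cancel_left[OF as(4)] by (blast intro: inj_onI)+
  have indep: "r b = 0" if "(\<Sum>b\<in>B. pm_scale (r b) b) = 0" "b \<in> B" for r b
    using B(3) that unfolding pm.dependent_finite[OF B(1)] by metis
  let ?B = "(\<star>) a ` B \<union> (\<star>) s ` B"
  have "\<not> pm.dependent ?B"
  proof (rule pm.independent_if_scalars_zero)
    fix r x assume r: "(\<Sum>x\<in>?B. pm_scale (r x) x) = 0" and x: "x \<in> ?B"
    \<comment> \<open>Sorted by first letters, a linear relation reads \<open>a u + s v = 0\<close>.
      So \<open>u\<close> and \<open>v\<close> vanish, and the independence of the shorter words
      kills all coefficients.\<close>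
    define u where "u = (\<Sum>b\<in>B. pm_scale (r (a \<star> b)) b)"
    define v where "v = (\<Sum>b\<in>B. pm_scale (r (s \<star> b)) b)"
    have "(\<Sum>x\<in>?B. pm_scale (r x) x) = a \<star> u + s \<star> v"
      using disj inj B(1)
      by (simp add: sum.union_disjoint sum.reindex u_def v_def mul_sum_right mul_scale_right)
    then have "a \<star> u = s \<star> (- v)" using r by (simp add: mul_minus eq_neg_iff_add_eq_0)
    moreover have "u \<in> W" "- v \<in> W"
      unfolding u_def v_def using B(4) by (auto intro!: is_subalgebraD[OF W])
    ultimately have "u = 0" "v = 0" using nc[of u "- v"] by auto
    then have "r (a \<star> b) = 0" "r (s \<star> b) = 0" if "b \<in> B" for b
      using indep[of "\<lambda>b. r (a \<star> b)" b] indep[of "\<lambda>b. r (s \<star> b)" b] that unfolding u_def v_def by simp_all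
    then show "r x = 0" using x by blast
  qed (use B(1) in simp)
  moreover have "card ?B = 2 ^ Suc m"
    using disj inj B by (simp add: card_Un_disjoint card_image)
  moreover have "?B \<subseteq> W" using B(4) as is_subalgebraD(4)[OF W] by blast
  moreover have "keys f \<subseteq> sumset (keys a \<union> keys s) (Suc m)" if f: "f \<in> ?B" for f
  proof -
    obtain t b where "b \<in> B" "t \<in> {a, s}" "f = t \<star> b" using f by blast
    then show ?thesis
      using keys_tmul[of t b] B(5)[of b] sumset_add[of "keys a \<union> keys s" _ _ m] by fastforce
  qed
  ultimately show ?case using B(1) by (intro exI[of _ ?B]) auto
qed

lemma right_ore_subalgebra:
  assumes W: "is_subalgebra W" and as: "a \<in> W" "s \<in> W" "s \<noteq> 0"
  shows "\<exists>u\<in>W. \<exists>v\<in>W - {0}. s \<star> u = a \<star> v"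
proof (cases "a = 0")
  case True
  have "tone \<noteq> (0 :: 'e \<Rightarrow>\<^sub>0 'k)" using leading_nonzero[OF leading_single[of 1 0]] by simp
  then show ?thesis using True is_subalgebraD(1,2)[OF W] by (intro bexI[of _ 0] bexI[of _ tone]) auto
next
  case False
  show ?thesis
  proof (rule ccontr)
    assume contr: "\<not> ?thesis"
    let ?S = "keys a \<union> keys s"
    obtain m where m: "(m + 1) ^ card ?S < (2::nat) ^ m" using poly_less_exp by blast
    have "u = 0" if "u \<in> W" "v \<in> W" "a \<star> u = s \<star> v" for u v
    proof (rule ccontr)
      assume "u \<noteq> 0"
      then show False using contr that by (metis DiffI singletonD)
    qed
    then obtain B where B: "finite B" "card B = 2 ^ m" "\<not> pm.dependent B" "B \<subseteq> W"
        "\<And>f. f \<in> B \<Longrightarrow> keys f \<subseteq> sumset ?S m"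
      using independent_words[OF W as(1,2) False as(3), of m] by metis
    let ?T = "(\<lambda>x. Poly_Mapping.single x (1::'k)) ` sumset ?S m"
    \<comment> \<open>The \<open>2^m\<close> independent words lie in the span of the monomials with
      exponents in the sumset, whose dimension is too small for this \<open>m\<close>.\<close>
    have "B \<subseteq> pm.span ?T"
    proof
      fix f assume f: "f \<in> B"
      have "(\<Sum>x\<in>keys f. pm_scale (lookup f x) (Poly_Mapping.single x 1)) \<in> pm.span ?T"
        using B(5)[OF f] by (intro pm.span_sum pm.span_scale pm.span_base) blast
      then show "f \<in> pm.span ?T" using pm_expand[of f] by simp
    qed
    then have "card B \<le> card ?T"
      using pm.independent_span_bound[of ?T B] B(3) card_sumset[of ?S m] by simp
    also have "\<dots> \<le> card (sumset ?S m)" using card_sumset[of ?S m] by (intro card_image_le) simp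
    also have "\<dots> \<le> (m + 1) ^ card ?S" using card_sumset[of ?S m] by simp
    finally show False using m B(2) by simp
  qed
qed

text \<open>The opposite algebra is the twisted group algebra of the transposed bicharacter, and
  reversing factors exchanges the two Ore conditions.\<close>

lemma left_ore_subalgebra:
  assumes W: "is_subalgebra W" and as: "a \<in> W" "s \<in> W" "s \<noteq> 0"
  shows "\<exists>u\<in>W. \<exists>v\<in>W - {0}. u \<star> s = v \<star> a"
proof -
  interpret op: twisted_group_algebra "\<lambda>x y. c y x"
    by unfold_locales (simp_all add: c_add_left c_add_right c_nonzero)
  have op: "op.tmul f g = g \<star> f" for f g
  proof (induction f rule: pm_induct)
    case (single x a)
    show ?case
      by (induction g rule: pm_induct)
        (simp_all add: tmul_zero op.tmul_zero tmul_add_left op.tmul_add_right add.commute mult_ac)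
  qed (simp_all add: tmul_zero op.tmul_zero tmul_add_right op.tmul_add_left)
  have "op.is_subalgebra W" using W by (simp add: op.is_subalgebra_def is_subalgebra_def op)
  from op.right_ore_subalgebra[OF this as] show ?thesis by (simp add: op)
qed

lemma tone_nonzero: "tone \<noteq> (0 :: 'e \<Rightarrow>\<^sub>0 'k)"
  using leading_nonzero[OF leading_single[of 1 0]] by simp

lemma ore_domain_subalgebra:
  assumes "is_subalgebra W"
  shows "ore_domain (subalgebra_record W)"
proof -
  have "ring (subalgebra_record W)" using k_algebra_subalgebra[OF assms] by (simp add: k_algebra_iff)
  then show ?thesis
    unfolding ore_domain_def ore_domain_axioms_def
    using k_algebra_subalgebra[OF assms] right_ore_subalgebra[OF assms] left_ore_subalgebra[OF assms]
      tone_nonzero tmul_eq_zero by auto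
qed

section \<open>Fractions inside the ambient algebra\<close>

lemma common_multiple_subalgebra:
  assumes "is_subalgebra W" "s \<in> W" "t \<in> W" "s \<noteq> 0" "t \<noteq> 0"
  obtains u v where "u \<in> W" "v \<in> W" "u \<noteq> 0" "v \<noteq> 0" "s \<star> u = t \<star> v"
proof -
  obtain u v where uv: "u \<in> W" "v \<in> W" "v \<noteq> 0" "s \<star> u = t \<star> v"
    using right_ore_subalgebra[of W t s] assms by blast
  then have "u \<noteq> 0" using tmul_eq_zero[of t v] assms(5) by auto
  then show ?thesis using that uv by blast
qed

lemma subset_fraction_closure: "is_subalgebra W \<Longrightarrow> W \<subseteq> fraction_closure W"
  using is_subalgebraD(1) tone_nonzero by (auto simp: fraction_closure_def intro!: bexI[of _ tone])

text \<open>Sums need a common right multiple of the denominators. For a product \<open>x y\<close>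
  the numerator of \<open>y\<close> has to be matched with the denominator of \<open>x\<close>,
  which the Ore condition does.\<close>

lemma subalgebra_fraction_closure:
  assumes W: "is_subalgebra W"
  shows "is_subalgebra (fraction_closure W)"
proof -
  have add: "x + y \<in> fraction_closure W" and mul: "x \<star> y \<in> fraction_closure W"
    if xy: "x \<in> fraction_closure W" "y \<in> fraction_closure W" for x y
  proof -
    obtain s t where st: "s \<in> W" "s \<noteq> 0" "x \<star> s \<in> W" "t \<in> W" "t \<noteq> 0" "y \<star> t \<in> W"
      using xy by (auto simp: fraction_closure_def)
    obtain u v where uv: "u \<in> W" "v \<in> W" "u \<noteq> 0" "v \<noteq> 0" "s \<star> u = t \<star> v"
      using common_multiple_subalgebra[OF W st(1,4,2,5)] by blast
    have "(x + y) \<star> (s \<star> u) = (x \<star> s) \<star> u + (y \<star> t) \<star> v"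
      by (simp only: mul_add_left mul_assoc) (simp only: uv(5))
    moreover have "(x \<star> s) \<star> u + (y \<star> t) \<star> v \<in> W" "s \<star> u \<in> W"
      using st uv by (auto intro!: is_subalgebraD(3,4)[OF W])
    moreover have "s \<star> u \<noteq> 0" using st uv tmul_eq_zero by blast
    ultimately show "x + y \<in> fraction_closure W"
      unfolding fraction_closure_def mem_Collect_eq by (intro bexI[of _ "s \<star> u"]) simp_all
    \<comment> \<open>\<open>(x y) (t q) = x (y t) q = x s p\<close>, so \<open>t q\<close> is a
      denominator of \<open>x y\<close>.\<close>
    obtain p q where pq: "p \<in> W" "q \<in> W" "q \<noteq> 0" "s \<star> p = (y \<star> t) \<star> q"
      using right_ore_subalgebra[OF W st(6,1,2)] by blast
    have "(x \<star> y) \<star> (t \<star> q) = x \<star> ((y \<star> t) \<star> q)" by (simp only: mul_assoc)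
    also have "\<dots> = (x \<star> s) \<star> p" by (metis pq(4) mul_assoc)
    finally have "(x \<star> y) \<star> (t \<star> q) \<in> W" using st pq is_subalgebraD(4)[OF W] by metis
    moreover have "t \<star> q \<in> W - {0}" using st pq tmul_eq_zero is_subalgebraD(4)[OF W] by blast
    ultimately show "x \<star> y \<in> fraction_closure W" unfolding fraction_closure_def by blast
  qed
  have scale: "pm_scale a x \<in> fraction_closure W" if "x \<in> fraction_closure W" for a x
    using that is_subalgebraD(5)[OF W] by (auto simp: fraction_closure_def mul_scale_left)
  show ?thesis
    unfolding is_subalgebra_def pm.subspace_def
    using add mul scale subset_fraction_closure[OF W] is_subalgebraD(1,2)[OF W] by blast
qed

text \<open>If \<open>x s\<close> lies in \<open>W\<close>, it is a denominator of \<open>y\<close>,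
  because \<open>y (x s) = s\<close>. In this way the inverses of torus generators enter the
  closure.\<close>

lemma fraction_closure_inverse:
  assumes W: "x \<in> fraction_closure W" and "y \<star> x = tone"
  shows "y \<in> fraction_closure W"
proof -
  obtain s where s: "s \<in> W" "s \<noteq> 0" "x \<star> s \<in> W" using W by (auto simp: fraction_closure_def)
  have "y \<star> (x \<star> s) = s" using assms(2) by (simp flip: mul_assoc)
  moreover from this have "x \<star> s \<noteq> 0" using s(2) by auto
  ultimately show ?thesis
    using s unfolding fraction_closure_def mem_Collect_eq by (intro bexI[of _ "x \<star> s"]) simp_all
qed

text \<open>Monotonicity and idempotence in one: two subalgebras contained in each other's closure
  have equal closures.\<close>

lemma fraction_closure_idem:
  assumes W: "is_subalgebra W" and Y: "Y \<subseteq> fraction_closure W"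
  shows "fraction_closure Y \<subseteq> fraction_closure W"
proof
  fix x assume "x \<in> fraction_closure Y"
  then obtain s where s: "s \<in> Y" "s \<noteq> 0" "x \<star> s \<in> Y" by (auto simp: fraction_closure_def)
  note F = is_subalgebraD[OF subalgebra_fraction_closure[OF W]]
  have s': "s \<in> fraction_closure W" "x \<star> s \<in> fraction_closure W" using s Y by auto
  \<comment> \<open>Denominators are cleared twice: \<open>u\<close> brings \<open>s\<close> into
    \<open>W\<close>, and \<open>w\<close> brings \<open>x s u\<close> into
    \<open>W\<close>.\<close>
  then obtain u where u: "u \<in> W" "u \<noteq> 0" "s \<star> u \<in> W" by (auto simp: fraction_closure_def)
  have "x \<star> (s \<star> u) \<in> fraction_closure W"
    using F(4)[OF s'(2)] u(1) subset_fraction_closure[OF W] by (simp flip: mul_assoc) blast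
  then obtain w where w: "w \<in> W" "w \<noteq> 0" "x \<star> (s \<star> u) \<star> w \<in> W"
    by (auto simp: fraction_closure_def)
  have "(s \<star> u) \<star> w \<in> W - {0}"
    using u w s tmul_eq_zero is_subalgebraD(4)[OF W] by blast
  then show "x \<in> fraction_closure W"
    using w(3) unfolding fraction_closure_def mem_Collect_eq mul_assoc by (rule bexI[rotated])
qed

end


section \<open>Bringing in a row\<close>

lemma mult_antisymmetricD:
  assumes "mult_antisymmetric n q" "i \<in> {1..n}" "j \<in> {1..n}"
  shows "q i j \<noteq> 0" "q i i = 1" "q j i = inverse (q i j)"
  using assms unfolding mult_antisymmetric_def by blast+

context unital_algebra
begin

text \<open>Only the rows are truncated at \<open>l\<close>; all columns are present from the start,
  since the construction adds whole rows.\<close>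

definition quantum_rows ::
    "nat \<Rightarrow> 'k \<Rightarrow> (nat \<Rightarrow> nat \<Rightarrow> 'k) \<Rightarrow> nat \<Rightarrow> (nat \<Rightarrow> nat \<Rightarrow> 'a) \<Rightarrow> bool" where
  "quantum_rows n lam p l x \<longleftrightarrow>
    (\<forall>a\<in>{1..l}. \<forall>i\<in>{1..l}. \<forall>m\<in>{1..n}. \<forall>j\<in>{1..n}.
      (a > i \<and> m > j \<longrightarrow> x a m \<star> x i j =
        (p a i * p j m) *s (x i j \<star> x a m) + ((lam - 1) * p a i) *s (x i m \<star> x a j)) \<and>
      (a > i \<and> m \<le> j \<longrightarrow> x a m \<star> x i j = (lam * p a i * p j m) *s (x i j \<star> x a m)) \<and>
      (a = i \<and> m > j \<longrightarrow> x a m \<star> x i j = p j m *s (x i j \<star> x a m)))"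

lemma mul_inverse_commute:
  assumes "y \<star> y' = unit" "y' \<star> y = unit" "x \<star> y = c *s (y \<star> x)" "c \<noteq> 0"
  shows "x \<star> y' = inverse c *s (y' \<star> x)"
proof -
  have "y' \<star> x = y' \<star> (x \<star> y) \<star> y'" using assms(1) by (simp add: mul_assoc)
  also have "\<dots> = c *s (y' \<star> y \<star> (x \<star> y'))" by (simp add: assms(3) mul_scale_left mul_scale_right mul_assoc)
  also have "\<dots> = c *s (x \<star> y')" by (simp add: assms(2))
  finally show ?thesis using assms(4) by simp
qed

lemma commute_sums:
  assumes "\<And>a b. a \<in> I \<Longrightarrow> b \<in> J \<Longrightarrow> f a \<star> g b = c *s (g b \<star> f a)"
  shows "sum f I \<star> sum g J = c *s (sum g J \<star> sum f I)"
proof -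
  have "sum f I \<star> sum g J = (\<Sum>a\<in>I. \<Sum>b\<in>J. f a \<star> g b)"
    by (simp only: mul_sum_left, simp only: mul_sum_right)
  also have "\<dots> = (\<Sum>a\<in>I. \<Sum>b\<in>J. c *s (g b \<star> f a))"
    by (intro sum.cong refl assms)
  also have "\<dots> = c *s (sum g J \<star> sum f I)"
    by (subst sum.swap) (simp only: mul_sum_left scale_sum_right, simp only: mul_sum_right scale_sum_right)
  finally show ?thesis .
qed

end

text \<open>Passing from \<open>x\<close> and \<open>t\<close> to \<open>z\<close> reverses a whole row of deleting-derivations steps. The
  elements \<open>v i m = x i m t\<^sub>m\<^sup>-\<^sup>1\<close> have trivial column weight, so the only parameters in their
  commutation rules are \<open>lam\<close> and a constant \<open>\<kappa>\<close> per pair of rows.\<close>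

locale row_step = unital_algebra scale mul unit
  for scale :: "'k::field \<Rightarrow> 'a::ab_group_add \<Rightarrow> 'a" (infixr \<open>*s\<close> 75)
    and mul (infixl \<open>\<star>\<close> 70) and unit +
  fixes n L :: nat and lam :: 'k and p :: "nat \<Rightarrow> nat \<Rightarrow> 'k"
    and x :: "nat \<Rightarrow> nat \<Rightarrow> 'a" and t t' :: "nat \<Rightarrow> 'a"
  assumes lam: "lam \<noteq> 0" and anti: "mult_antisymmetric n p" and L: "L \<in> {1..n}"
    and t_inverse: "m \<in> {1..n} \<Longrightarrow> t m \<star> t' m = unit" "m \<in> {1..n} \<Longrightarrow> t' m \<star> t m = unit"
    and tt: "m \<in> {1..n} \<Longrightarrow> j \<in> {1..n} \<Longrightarrow> t m \<star> t j = p j m *s (t j \<star> t m)"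
    and tx: "i \<in> {1..<L} \<Longrightarrow> m \<in> {1..n} \<Longrightarrow> j \<in> {1..n} \<Longrightarrow>
      t m \<star> x i j = ((if m \<le> j then lam else 1) * p L i * p j m) *s (x i j \<star> t m)"
    and rows: "quantum_rows n lam p (L - 1) x"
begin

abbreviation "e m j \<equiv> (if m \<le> j then lam else 1)"

definition v where "v i m = x i m \<star> t' m"
text \<open>The relations among the old rows are verified for these tail sums, after the factors
  \<open>t\<close> have been collected at the right end.\<close>

definition S where "S i j = (\<Sum>m\<in>{j..n}. v i m)"
definition z where "z i j = (if i = L then t j else S i j \<star> t j)"

lemma in_range: "i \<in> {1..<L} \<Longrightarrow> i \<in> {1..n}"
  using L by auto

lemma p_facts:
  assumes "i \<in> {1..n}" "j \<in> {1..n}"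
  shows "p i j \<noteq> 0" "p i i = 1" "p i j * p j i = 1"
  using mult_antisymmetricD[OF anti assms] by auto

lemma p_cancel: "i \<in> {1..n} \<Longrightarrow> j \<in> {1..n} \<Longrightarrow> p i j * (p j i * c) = c"
  using p_facts(3)[of i j] by (metis mult.assoc mult_1)

lemma x_eq: "m \<in> {1..n} \<Longrightarrow> x i m = v i m \<star> t m"
  by (simp add: v_def mul_assoc t_inverse)

text \<open>The column parameter \<open>p j m\<close> picked up from \<open>x i j\<close> cancels
  against the one from \<open>t' j\<close>; only the row parameter and the jump \<open>e m j\<close>
  survive.\<close>

lemma tv:
  assumes "i \<in> {1..<L}" "m \<in> {1..n}" "j \<in> {1..n}"
  shows "t m \<star> v i j = (e m j * p L i) *s (v i j \<star> t m)"
proof -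
  have "t m \<star> t' j = inverse (p j m) *s (t' j \<star> t m)"
    by (rule mul_inverse_commute[OF t_inverse[OF assms(3)] tt[OF assms(2,3)] p_facts(1)[OF assms(3,2)]])
  moreover have "t m \<star> v i j = (e m j * p L i * p j m) *s (x i j \<star> (t m \<star> t' j))"
    by (simp only: v_def tx[OF assms] mul_scale_left flip: mul_assoc)
  ultimately show ?thesis
    using p_facts(1)[OF assms(3,2)] by (simp add: v_def mul_scale_right mul_assoc)
qed

text \<open>Collecting both torus factors at the right end translates a relation between entries
  \<open>x\<close> into one between the \<open>v\<close>, since \<open>t m \<star> t j\<close> can
  be cancelled.\<close>

lemma xx:
  assumes "a \<in> {1..<L}" "i \<in> {1..<L}" "m \<in> {1..n}" "j \<in> {1..n}"
  shows "x a m \<star> x i j = (e m j * p L i) *s ((v a m \<star> v i j) \<star> (t m \<star> t j))"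
proof -
  have "x a m \<star> x i j = v a m \<star> (t m \<star> v i j) \<star> t j"
    by (simp add: x_eq[OF assms(3)] x_eq[OF assms(4)] mul_assoc)
  then show ?thesis by (simp add: tv[OF assms(2-4)] mul_scale_left mul_scale_right mul_assoc)
qed

lemma cancel_tt:
  assumes "m \<in> {1..n}" "j \<in> {1..n}" "A \<noteq> 0"
    "A *s (y \<star> (t m \<star> t j)) = A *s (w \<star> (t m \<star> t j))"
  shows "y = w"
proof -
  have "y \<star> (t m \<star> t j) \<star> (t' j \<star> t' m) = w \<star> (t m \<star> t j) \<star> (t' j \<star> t' m)"
    using assms(3,4) by simp
  moreover have "u \<star> (t m \<star> t j) \<star> (t' j \<star> t' m) = u" for u
  proof -
    have "u \<star> (t m \<star> t j) \<star> (t' j \<star> t' m) = u \<star> (t m \<star> ((t j \<star> t' j) \<star> t' m))"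
      by (simp only: mul_assoc)
    then show ?thesis using assms(1,2) by (simp add: t_inverse)
  qed
  ultimately show ?thesis by simp
qed

text \<open>The \<open>lam\<close> comes from the asymmetry of \<open>e\<close>: for
  \<open>m > j\<close>, moving \<open>t m\<close> past \<open>v i j\<close> costs no
  \<open>lam\<close>, while moving \<open>t j\<close> past \<open>v i m\<close> does.\<close>

lemma v_same_row:
  assumes i: "i \<in> {1..<L}" and mj: "m \<in> {1..n}" "j \<in> {1..n}" "m > j"
  shows "v i m \<star> v i j = lam *s (v i j \<star> v i m)"
proof (rule cancel_tt[OF mj(1,2)])
  show "p L i \<noteq> 0" using p_facts(1) L in_range i by blast
  have "p L i *s ((v i m \<star> v i j) \<star> (t m \<star> t j)) = x i m \<star> x i j"
    using xx[OF i i mj(1,2)] mj by simp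
  also have "\<dots> = p j m *s (x i j \<star> x i m)"
    using rows i mj unfolding quantum_rows_def by fastforce
  also have "\<dots> = (p j m * lam * p L i) *s ((v i j \<star> v i m) \<star> (t j \<star> t m))"
    using xx[OF i i mj(2,1)] mj by (simp add: mult_ac)
  also have "\<dots> = p L i *s ((lam *s (v i j \<star> v i m)) \<star> (t m \<star> t j))"
    using p_cancel[OF mj(2,1)]
    by (simp add: tt[OF mj(2,1)] mul_scale_left mul_scale_right mult_ac)
  finally show "p L i *s ((v i m \<star> v i j) \<star> (t m \<star> t j)) = p L i *s ((lam *s (v i j \<star> v i m)) \<star> (t m \<star> t j))" .
qed

text \<open>Net row parameter: \<open>p a i\<close> from the relation between the two rows,
  \<open>p L a\<close> and \<open>p L i\<close> from moving factors \<open>t\<close> of row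
  \<open>L\<close> across rows \<open>a\<close> and \<open>i\<close>.\<close>

definition \<kappa> where "\<kappa> a i = p a i * p L a / p L i"

text \<open>For \<open>m < j\<close> the \<open>lam\<close> of the matrix relation is absorbed by
  \<open>e m j\<close>; for \<open>m = j\<close> another one comes back from \<open>e j m\<close>;
  for \<open>m > j\<close> the first term of the relation has none and \<open>e j m\<close> supplies
  it.\<close>

lemma v_rows:
  assumes a: "a \<in> {1..<L}" and i: "i \<in> {1..<L}" and ai: "a > i" and mj: "m \<in> {1..n}" "j \<in> {1..n}"
  shows "m < j \<Longrightarrow> v a m \<star> v i j = \<kappa> a i *s (v i j \<star> v a m)"
    and "m = j \<Longrightarrow> v a m \<star> v i j = (\<kappa> a i * lam) *s (v i j \<star> v a m)"
    and "m > j \<Longrightarrow> v a m \<star> v i j =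
      \<kappa> a i *s (lam *s (v i j \<star> v a m) + (lam - 1) *s (v i m \<star> v a j))"
proof -
  have pL: "p L i \<noteq> 0" using p_facts(1) L in_range i by blast
  have lhs: "(e m j * p L i) *s ((v a m \<star> v i j) \<star> (t m \<star> t j)) = x a m \<star> x i j"
    using xx[OF a i mj] by simp
  have rhs: "x i j \<star> x a m = (e j m * p L a * p m j) *s ((v i j \<star> v a m) \<star> (t m \<star> t j))"
    using xx[OF i a mj(2,1)] by (simp add: tt[OF mj(2,1)] mul_scale_left mul_scale_right mult_ac)
  have "x a m \<star> x i j = (lam * p a i * p j m) *s (x i j \<star> x a m)" if "m \<le> j"
    using rows a i ai mj that unfolding quantum_rows_def by fastforce
  then have 1: "x a m \<star> x i j = (lam * p a i * e j m * p L a) *s ((v i j \<star> v a m) \<star> (t m \<star> t j))"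
    if "m \<le> j"
    using that p_cancel[OF mj(2,1)] by (simp add: rhs mult_ac)
  show "v a m \<star> v i j = \<kappa> a i *s (v i j \<star> v a m)" if "m < j"
    by (rule cancel_tt[OF mj, of "lam * p L i"])
      (use lhs 1 that pL lam in \<open>simp_all add: \<kappa>_def mul_scale_left mult_ac\<close>)
  show "v a m \<star> v i j = (\<kappa> a i * lam) *s (v i j \<star> v a m)" if "m = j"
    by (rule cancel_tt[OF mj, of "lam * p L i"])
      (use lhs 1 that pL lam in \<open>simp_all add: \<kappa>_def mul_scale_left mult_ac\<close>)
  assume m: "m > j"
  have "x a m \<star> x i j = (p a i * p j m) *s (x i j \<star> x a m) + ((lam - 1) * p a i) *s (x i m \<star> x a j)"
    using rows a i ai mj m unfolding quantum_rows_def by fastforce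
  also have "x i m \<star> x a j = p L a *s ((v i m \<star> v a j) \<star> (t m \<star> t j))"
    using xx[OF i a mj] m by simp
  finally have 2: "x a m \<star> x i j = (p a i * lam * p L a) *s ((v i j \<star> v a m) \<star> (t m \<star> t j)) +
      ((lam - 1) * p a i * p L a) *s ((v i m \<star> v a j) \<star> (t m \<star> t j))"
    using m p_cancel[OF mj(2,1)] by (simp add: rhs mult_ac)
  show "v a m \<star> v i j = \<kappa> a i *s (lam *s (v i j \<star> v a m) + (lam - 1) *s (v i m \<star> v a j))"
    by (rule cancel_tt[OF mj, of "p L i"])
      (use lhs 2 m pL in \<open>simp_all add: \<kappa>_def mul_scale_left mul_add_left scale_right_distrib mult_ac\<close>)
qed

lemma sums_rows_less:
  assumes "a \<in> {1..<L}" "i \<in> {1..<L}" "a > i" "M \<subseteq> {1..n}" "J \<subseteq> {1..n}"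
    "\<And>m j. m \<in> M \<Longrightarrow> j \<in> J \<Longrightarrow> m < j"
  shows "sum (v a) M \<star> sum (v i) J = \<kappa> a i *s (sum (v i) J \<star> sum (v a) M)"
  by (rule commute_sums) (use assms in \<open>auto intro!: v_rows(1)\<close>)

text \<open>By bilinearity; the correction term exchanges the column blocks \<open>M\<close> and
  \<open>J\<close> between the two rows.\<close>

lemma sums_rows_greater:
  assumes "a \<in> {1..<L}" "i \<in> {1..<L}" "a > i" "M \<subseteq> {1..n}" "J \<subseteq> {1..n}"
    "\<And>m j. m \<in> M \<Longrightarrow> j \<in> J \<Longrightarrow> m > j"
  shows "sum (v a) M \<star> sum (v i) J =
    \<kappa> a i *s (lam *s (sum (v i) J \<star> sum (v a) M) + (lam - 1) *s (sum (v i) M \<star> sum (v a) J))"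
proof -
  have "sum (v a) M \<star> sum (v i) J = (\<Sum>m\<in>M. \<Sum>j\<in>J. v a m \<star> v i j)"
    by (simp only: mul_sum_left, simp only: mul_sum_right)
  also have "\<dots> = (\<Sum>m\<in>M. \<Sum>j\<in>J. \<kappa> a i *s (lam *s (v i j \<star> v a m) + (lam - 1) *s (v i m \<star> v a j)))"
    by (intro sum.cong refl v_rows(3)) (use assms in auto)
  also have "\<dots> = \<kappa> a i *s (lam *s (\<Sum>m\<in>M. \<Sum>j\<in>J. v i j \<star> v a m) + (lam - 1) *s (\<Sum>m\<in>M. \<Sum>j\<in>J. v i m \<star> v a j))"
    by (simp add: scale_sum_right scale_right_distrib sum.distrib)
  also have "(\<Sum>m\<in>M. \<Sum>j\<in>J. v i j \<star> v a m) = sum (v i) J \<star> sum (v a) M"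
    by (subst sum.swap) (simp only: mul_sum_left, simp only: mul_sum_right)
  also have "(\<Sum>m\<in>M. \<Sum>j\<in>J. v i m \<star> v a j) = sum (v i) M \<star> sum (v a) J"
    by (simp only: mul_sum_left, simp only: mul_sum_right)
  finally show ?thesis .
qed

lemma S_split: "j \<le> m \<Longrightarrow> m \<le> n \<Longrightarrow> S i j = sum (v i) {j..<m} + S i m"
  unfolding S_def by (subst sum.union_disjoint[symmetric]) (auto intro!: sum.cong)

text \<open>Split \<open>S i j\<close> at column \<open>m\<close>: the part left of \<open>m\<close>
  commutes with \<open>S i m\<close> up to \<open>lam\<close>, and the added
  \<open>(lam - 1) *s S i m\<close> gives the square of \<open>S i m\<close> the same
  coefficient.\<close>

lemma S_same_row:
  assumes i: "i \<in> {1..<L}" and mj: "m \<in> {1..n}" "j \<in> {1..n}" "m > j"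
  shows "S i m \<star> (S i j + (lam - 1) *s S i m) = lam *s (S i j \<star> S i m)"
proof -
  have "S i m \<star> sum (v i) {j..<m} = lam *s (sum (v i) {j..<m} \<star> S i m)"
    unfolding S_def by (rule commute_sums) (use i mj in \<open>auto intro!: v_same_row\<close>)
  then show ?thesis
    using S_split[of j m i] mj
    by (simp add: mul_add_left mul_add_right mul_scale_right scale_right_distrib scale_left_diff_distrib scale_right_diff_distrib)
qed

text \<open>Adding one column creates four products. The term
  \<open>S i (Suc j) \<star> v a j\<close> arises with \<open>\<kappa> a i\<close> from one of them
  and with \<open>\<kappa> a i * (lam - 1)\<close> from another, together
  \<open>\<kappa> a i * lam\<close>, the factor of all the rest. This is what makes plain tail sums
  the right choice.\<close>

lemma S_diagonal:
  assumes a: "a \<in> {1..<L}" and i: "i \<in> {1..<L}" and ai: "a > i" and j: "j \<in> {1..Suc n}"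
  shows "S a j \<star> S i j = (\<kappa> a i * lam) *s (S i j \<star> S a j)"
  using j
proof (induction "Suc n - j" arbitrary: j)
  \<comment> \<open>Here \<open>j = Suc n\<close> and both sums are empty.\<close>
  case 0
  then show ?case by (simp add: S_def)
next
  case (Suc d)
  then have j: "j \<in> {1..n}" by auto
  have IH: "S a (Suc j) \<star> S i (Suc j) = (\<kappa> a i * lam) *s (S i (Suc j) \<star> S a (Suc j))"
    using Suc by (intro Suc.hyps(1)) auto
  have S: "S b j = v b j + S b (Suc j)" for b
    using j by (simp add: S_def sum.atLeast_Suc_atMost)
  have d: "v a j \<star> v i j = (\<kappa> a i * lam) *s (v i j \<star> v a j)"
    by (rule v_rows(2)[OF a i ai j j refl])
  have l: "v a j \<star> S i (Suc j) = \<kappa> a i *s (S i (Suc j) \<star> v a j)"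
    using sums_rows_less[OF a i ai, of "{j}" "{Suc j..n}"] j by (auto simp: S_def)
  have g: "S a (Suc j) \<star> v i j =
      \<kappa> a i *s (lam *s (v i j \<star> S a (Suc j)) + (lam - 1) *s (S i (Suc j) \<star> v a j))"
    using sums_rows_greater[OF a i ai, of "{Suc j..n}" "{j}"] j by (auto simp: S_def)
  show ?case
    unfolding S by (simp add: mul_add_left mul_add_right IH d l g scale_right_distrib
        scale_left_diff_distrib right_diff_distrib scale_right_diff_distrib)
qed

text \<open>The columns \<open>m..<j\<close> of row \<open>a\<close> pass \<open>S i j\<close>
  without \<open>lam\<close>, those from \<open>j\<close> on pass with it; the excess is
  \<open>(lam - 1) *s S a j\<close>.\<close>

lemma S_rows_le:
  assumes a: "a \<in> {1..<L}" and i: "i \<in> {1..<L}" and ai: "a > i"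
    and mj: "m \<in> {1..n}" "j \<in> {1..n}" "m < j"
  shows "S a m \<star> S i j = \<kappa> a i *s (S i j \<star> (S a m + (lam - 1) *s S a j))"
proof -
  have "sum (v a) {m..<j} \<star> S i j = \<kappa> a i *s (S i j \<star> sum (v a) {m..<j})"
    unfolding S_def by (rule sums_rows_less[OF a i ai]) (use mj in auto)
  then show ?thesis
    using S_split[of m j a] S_diagonal[OF a i ai, of j] mj
    by (simp add: mul_add_left mul_add_right mul_scale_right scale_right_distrib
        scale_left_diff_distrib right_diff_distrib scale_right_diff_distrib)
qed

text \<open>Split both tail sums at \<open>m\<close>. The block terms agree by
  \<open>sums_rows_greater\<close>, and \<open>S i m \<star> S a m\<close> ends up with the
  coefficient \<open>\<kappa> a i * lam^2\<close> on both sides.\<close>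

lemma S_rows_greater:
  assumes a: "a \<in> {1..<L}" and i: "i \<in> {1..<L}" and ai: "a > i"
    and mj: "m \<in> {1..n}" "j \<in> {1..n}" "m > j"
  shows "S a m \<star> (S i j + (lam - 1) *s S i m) =
    \<kappa> a i *s (lam *s (S i j \<star> S a m) + (lam - 1) *s (S i m \<star> (S a j + (lam - 1) *s S a m)))"
proof -
  have g: "S a m \<star> sum (v i) {j..<m} =
    \<kappa> a i *s (lam *s (sum (v i) {j..<m} \<star> S a m) + (lam - 1) *s (S i m \<star> sum (v a) {j..<m}))"
    unfolding S_def by (rule sums_rows_greater[OF a i ai]) (use mj in auto)
  have d: "S a m \<star> S i m = (\<kappa> a i * lam) *s (S i m \<star> S a m)"
    using S_diagonal[OF a i ai, of m] mj by simp
  show ?thesis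
    using S_split[of j m i] S_split[of j m a] mj g d
    by (simp add: mul_add_left mul_add_right mul_scale_right scale_right_distrib
        scale_left_diff_distrib right_diff_distrib left_diff_distrib scale_right_diff_distrib mult_ac)
qed

text \<open>What \<open>S i j\<close> becomes, up to \<open>p L i\<close>, when \<open>t m\<close>
  moves across it: every column \<open>k \<ge> m\<close> gains a factor \<open>lam\<close>. For
  \<open>m > j\<close> this concerns just the tail from \<open>m\<close>.\<close>

definition D where "D m i j = (if m \<le> j then lam *s S i j else S i j + (lam - 1) *s S i m)"

lemma tS:
  assumes i: "i \<in> {1..<L}" and mj: "m \<in> {1..n}" "j \<in> {1..n}"
  shows "t m \<star> S i j = p L i *s (D m i j \<star> t m)"
proof -
  have "t m \<star> S i j = (\<Sum>k\<in>{j..n}. (e m k * p L i) *s (v i k \<star> t m))"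
    unfolding S_def mul_sum_right using tv[OF i mj(1)] mj by (intro sum.cong) auto
  also have "\<dots> = p L i *s ((\<Sum>k\<in>{j..n}. e m k *s v i k) \<star> t m)"
    by (simp add: mul_sum_left scale_sum_right mul_scale_left mult.commute)
  also have "(\<Sum>k\<in>{j..n}. e m k *s v i k) = D m i j"
  proof (cases "m \<le> j")
    case True
    then show ?thesis unfolding D_def S_def scale_sum_right if_P[OF True] by (intro sum.cong) auto
  next
    case False
    have "(\<Sum>k\<in>{j..n}. e m k *s v i k) = (\<Sum>k\<in>{j..n}. v i k + (if m \<le> k then (lam - 1) *s v i k else 0))"
      by (rule sum.cong) (auto simp: scale_left_diff_distrib)
    also have "\<dots> = S i j + (\<Sum>k\<in>{k\<in>{j..n}. m \<le> k}. (lam - 1) *s v i k)"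
      by (simp only: sum.distrib S_def sum.inter_filter finite_atLeastAtMost)
    also have "{k\<in>{j..n}. m \<le> k} = {m..n}" using False by auto
    finally show ?thesis using False by (simp add: D_def S_def scale_sum_right)
  qed
  finally show ?thesis .
qed

lemma zz:
  assumes "a \<in> {1..<L}" "i \<in> {1..<L}" "m \<in> {1..n}" "j \<in> {1..n}"
  shows "z a m \<star> z i j = p L i *s ((S a m \<star> D m i j) \<star> (t m \<star> t j))"
proof -
  have "z a m \<star> z i j = S a m \<star> (t m \<star> S i j) \<star> t j"
    using assms by (simp add: z_def mul_assoc)
  then show ?thesis by (simp add: tS[OF assms(2-4)] mul_scale_left mul_scale_right mul_assoc)
qed

text \<open>The column parameter \<open>p j m\<close> of the matrix relations is used up in
  reordering \<open>t j \<star> t m\<close>, so that both products end in the same torus factor as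
  in \<open>zz\<close>.\<close>

lemma zz':
  assumes "a \<in> {1..<L}" "i \<in> {1..<L}" "m \<in> {1..n}" "j \<in> {1..n}"
  shows "p j m *s (z i j \<star> z a m) = p L a *s ((S i j \<star> D j a m) \<star> (t m \<star> t j))"
  using zz[OF assms(2,1,4,3)] p_cancel[OF assms(4,3)]
  by (simp add: tt[OF assms(4,3)] mul_scale_left mul_scale_right mult_ac)

lemma quantum_rows_step: "quantum_rows n lam p L z"
proof -
  have pL: "p L i \<noteq> 0" if "i \<in> {1..<L}" for i using p_facts(1) L in_range that by blast
  have pk: "p a i * p L a = p L i * \<kappa> a i" if "i \<in> {1..<L}" for a i
    using pL[OF that] by (simp add: \<kappa>_def)
  have same: "z i m \<star> z i j = p j m *s (z i j \<star> z i m)"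
    if "i \<in> {1..L}" "m \<in> {1..n}" "j \<in> {1..n}" "m > j" for i m j
  proof (cases "i = L")
    case True
    then show ?thesis using tt[OF that(2,3)] by (simp add: z_def)
  next
    case False
    then have i: "i \<in> {1..<L}" using that by auto
    show ?thesis
      using S_same_row[OF i that(2-4)] that(4)
      by (simp add: zz[OF i i that(2,3)] zz'[OF i i that(2,3)] D_def mul_scale_right)
  qed
  have le: "z a m \<star> z i j = (lam * p a i * p j m) *s (z i j \<star> z a m)"
    if "a \<in> {1..L}" "i \<in> {1..L}" "a > i" "m \<in> {1..n}" "j \<in> {1..n}" "m \<le> j" for a i m j
  proof (cases "a = L")
    case True
    then have i: "i \<in> {1..<L}" using that by auto
    have "z a m \<star> z i j = (lam * p L i) *s (S i j \<star> (t m \<star> t j))"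
      using True i tS[OF i that(4,5)] that(6)
      by (simp add: z_def D_def mul_scale_left mult.commute flip: mul_assoc)
    then show ?thesis
      using True i tt[OF that(4,5)] by (simp add: z_def mul_scale_right mul_assoc)
  next
    case False
    then have i: "i \<in> {1..<L}" and a: "a \<in> {1..<L}" using that by auto
    have "(lam * p a i * p j m) *s (z i j \<star> z a m) = (lam * p a i) *s (p j m *s (z i j \<star> z a m))"
      by simp
    also have "\<dots> = (lam * (p a i * p L a)) *s ((S i j \<star> D j a m) \<star> (t m \<star> t j))"
      unfolding zz'[OF a i that(4,5)] by (simp add: mult_ac)
    also have "\<dots> = (lam * p L i) *s ((\<kappa> a i *s (S i j \<star> D j a m)) \<star> (t m \<star> t j))"
      unfolding pk[OF i] by (simp add: mul_scale_left mult_ac)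
    also have "\<kappa> a i *s (S i j \<star> D j a m) = S a m \<star> S i j"
    proof (cases "m = j")
      case True
      then show ?thesis using S_diagonal[OF a i that(3), of j] that(5) by (simp add: D_def mul_scale_right)
    next
      case False
      then show ?thesis using S_rows_le[OF a i that(3-5)] that(6) by (simp add: D_def)
    qed
    finally show ?thesis
      using that(6) by (simp add: zz[OF a i that(4,5)] D_def mul_scale_left mul_scale_right mult_ac)
  qed
  have gr: "z a m \<star> z i j = (p a i * p j m) *s (z i j \<star> z a m) + ((lam - 1) * p a i) *s (z i m \<star> z a j)"
    if "a \<in> {1..L}" "i \<in> {1..L}" "a > i" "m \<in> {1..n}" "j \<in> {1..n}" "m > j" for a i m j
  proof (cases "a = L")
    case True
    then have i: "i \<in> {1..<L}" using that by auto
    \<comment> \<open>In the new row the left factor is \<open>t m\<close> alone, and the two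
      summands of \<open>D m i j\<close> become the two terms of the relation.\<close>
    have "z a m \<star> z i j = p L i *s (S i j \<star> (t m \<star> t j)) + ((lam - 1) * p L i) *s (S i m \<star> (t m \<star> t j))"
      using True i tS[OF i that(4,5)] that(6)
      by (simp add: z_def D_def mul_scale_left mul_add_left scale_right_distrib mult.commute flip: mul_assoc)
    moreover have "S i j \<star> (t m \<star> t j) = p j m *s (S i j \<star> (t j \<star> t m))"
      using tt[OF that(4,5)] by (simp add: mul_scale_right)
    ultimately show ?thesis
      using True i by (simp add: z_def mul_assoc)
  next
    case False
    then have i: "i \<in> {1..<L}" and a: "a \<in> {1..<L}" using that by auto
    have "(p a i * p j m) *s (z i j \<star> z a m) + ((lam - 1) * p a i) *s (z i m \<star> z a j) =
      p a i *s (p j m *s (z i j \<star> z a m)) + ((lam - 1) * p a i) *s (z i m \<star> z a j)"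
      by simp
    also have "\<dots> = (p a i * p L a) *s ((S i j \<star> D j a m) \<star> (t m \<star> t j)) +
      ((lam - 1) * (p a i * p L a)) *s ((S i m \<star> D m a j) \<star> (t m \<star> t j))"
      unfolding zz'[OF a i that(4,5)] zz[OF i a that(4,5)] by (simp add: mult_ac)
    also have "\<dots> = p L i *s ((\<kappa> a i *s (S i j \<star> D j a m + (lam - 1) *s (S i m \<star> D m a j))) \<star> (t m \<star> t j))"
      unfolding pk[OF i] by (simp add: mul_scale_left mul_add_left scale_right_distrib mult_ac)
    also have "\<kappa> a i *s (S i j \<star> D j a m + (lam - 1) *s (S i m \<star> D m a j)) = S a m \<star> D m i j"
      using S_rows_greater[OF a i that(3-6)] that(6) by (simp add: D_def mul_scale_right)
    finally show ?thesis by (simp add: zz[OF a i that(4,5)])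
  qed
  show ?thesis
    unfolding quantum_rows_def using same le gr by blast
qed

text \<open>Here \<open>s\<close> stands for a torus generator of column \<open>m\<close> in a row
  \<open>r\<close> still to come. It passes every \<open>v i k\<close> with the same scalar
  \<open>p r i / p r L\<close>, hence also \<open>S i j\<close>; the dependence on columns is
  carried by the last factor \<open>t j\<close>. Thus \<open>z\<close> satisfies for later rows what
  was required of \<open>x\<close>.\<close>

lemma row_step_below:
  assumes i: "i \<in> {1..<L}" and r: "r \<in> {1..n}" and mj: "m \<in> {1..n}" "j \<in> {1..n}"
    and sx: "\<And>j. j \<in> {1..n} \<Longrightarrow> s \<star> x i j = (e m j * p r i * p j m) *s (x i j \<star> s)"
    and st: "\<And>j. j \<in> {1..n} \<Longrightarrow> s \<star> t j = (e m j * p r L * p j m) *s (t j \<star> s)"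
  shows "s \<star> z i j = (e m j * p r i * p j m) *s (z i j \<star> s)"
proof -
  have prL: "p r L \<noteq> 0" using p_facts(1)[OF r L] .
  have sv: "s \<star> v i k = (p r i / p r L) *s (v i k \<star> s)" if k: "k \<in> {1..n}" for k
  proof -
    have nz: "p k m \<noteq> 0" using p_facts(1)[OF k mj(1)] .
    have "s \<star> t' k = inverse (e m k * p r L * p k m) *s (t' k \<star> s)"
      by (rule mul_inverse_commute[OF t_inverse[OF k] st[OF k]]) (use prL nz lam in simp)
    moreover have "s \<star> v i k = (e m k * p r i * p k m) *s (x i k \<star> (s \<star> t' k))"
      by (simp only: v_def sx[OF k] mul_scale_left flip: mul_assoc)
    moreover have "(e m k * p r i * p k m) * inverse (e m k * p r L * p k m) = p r i / p r L"
      using prL nz lam by (cases "m \<le> k") (simp_all add: divide_simps)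
    ultimately show ?thesis
      by (simp only: v_def mul_scale_right mul_assoc scale_scale)
  qed
  have sS: "s \<star> S i j = (p r i / p r L) *s (S i j \<star> s)"
    unfolding S_def mul_sum_left mul_sum_right scale_sum_right
    by (rule sum.cong[OF refl]) (use sv mj in auto)
  have "s \<star> z i j = (s \<star> S i j) \<star> t j" using i by (simp add: z_def mul_assoc)
  also have "\<dots> = (p r i / p r L) *s (S i j \<star> (s \<star> t j))" by (simp add: sS mul_scale_left mul_assoc)
  also have "\<dots> = (e m j * p r i * p j m) *s (z i j \<star> s)"
    using prL i by (simp add: st[OF mj(2)] z_def mul_scale_right mul_assoc)
  finally show ?thesis .
qed

end


section \<open>Presented algebras\<close>

lemma ring_cong:
  assumes "ring R" "carrier S = carrier R" "monoid.mult S = monoid.mult R" "one S = one R"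
    "ring.zero S = ring.zero R" "add S = add R"
  shows "ring S"
proof -
  interpret ring R by (rule assms(1))
  have "abelian_group S"
  proof (rule abelian_groupI)
    fix x assume "x \<in> carrier S"
    then have "\<ominus>\<^bsub>R\<^esub> x \<in> carrier S" "\<ominus>\<^bsub>R\<^esub> x \<oplus>\<^bsub>S\<^esub> x = \<zero>\<^bsub>S\<^esub>" using assms(2-6) by (simp_all add: l_neg)
    then show "\<exists>y\<in>carrier S. y \<oplus>\<^bsub>S\<^esub> x = \<zero>\<^bsub>S\<^esub>" by blast
  qed (simp_all add: assms(2-6) a_ac)
  moreover have "Group.monoid S"
    by (rule monoidI) (simp_all add: assms(2-6) m_assoc)
  ultimately show ?thesis
    by (rule ringI) (simp_all add: assms(2-6) l_distr r_distr)
qed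

lemma quotient_algebra_simps [simp]:
  "carrier (quotient_algebra A I) = carrier (A Quot I)"
  "monoid.mult (quotient_algebra A I) = monoid.mult (A Quot I)"
  "one (quotient_algebra A I) = one (A Quot I)"
  "ring.zero (quotient_algebra A I) = ring.zero (A Quot I)"
  "add (quotient_algebra A I) = add (A Quot I)"
  by (simp_all add: quotient_algebra_def)

locale algebra_ideal = ideal I A for I and A :: "('k::field, 'a) module" (structure) +
  assumes k_alg: "k_algebra A"
begin

lemma smult_closed [simp]: "x \<in> carrier A \<Longrightarrow> c \<odot> x \<in> carrier A"
  using k_alg by (simp add: k_algebra_iff)

text \<open>Ring ideals suffice: \<open>c \<odot> x\<close> is the product of
  \<open>c \<odot> \<one>\<close> with \<open>x\<close>.\<close>

lemma smult_ideal:
  assumes "x \<in> I"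
  shows "c \<odot> x \<in> I"
proof -
  have x: "x \<in> carrier A" using assms by (rule a_Hcarr)
  have "(c \<odot> \<one>) \<otimes> x = c \<odot> (\<one> \<otimes> x)" using k_alg x by (simp add: k_algebra_iff)
  then show ?thesis using I_l_closed[OF assms, of "c \<odot> \<one>"] x by simp
qed

lemma carrier_quotient: "carrier (A Quot I) = {I +> x | x. x \<in> carrier A}"
  by (auto simp: FactRing_def A_RCOSETS_def RCOSETS_def a_r_coset_def)

lemma coset_eq_iff:
  assumes "x \<in> carrier A" "y \<in> carrier A"
  shows "I +> x = I +> y \<longleftrightarrow> x \<ominus> y \<in> I"
  using quotient_eq_iff_same_a_r_cos[OF is_ideal assms] by blast

lemma quotient_mult: "x \<in> carrier A \<Longrightarrow> y \<in> carrier A \<Longrightarrow> (I +> x) \<otimes>\<^bsub>A Quot I\<^esub> (I +> y) = I +> (x \<otimes> y)"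
  by (simp add: FactRing_def rcoset_mult_add)

lemma quotient_add: "x \<in> carrier A \<Longrightarrow> y \<in> carrier A \<Longrightarrow> (I +> x) \<oplus>\<^bsub>A Quot I\<^esub> (I +> y) = I +> (x \<oplus> y)"
  by (simp add: FactRing_def a_rcos_sum)

text \<open>The union in the definition collapses, since the multiples by \<open>c\<close> of all
  elements of a coset lie in one and the same coset.\<close>

lemma quotient_smult:
  assumes x: "x \<in> carrier A"
  shows "c \<odot>\<^bsub>quotient_algebra A I\<^esub> (I +> x) = I +> (c \<odot> x)"
proof -
  have "I +> (c \<odot> y) = I +> (c \<odot> x)" if y: "y \<in> I +> x" for y
  proof -
    have yc: "y \<in> carrier A" using y x a_r_coset_subset_G[of I x] a_subset by blast
    have "I +> y = I +> x" using a_repr_independence[OF y x a_subgroup] by simp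
    then have "y \<ominus> x \<in> I" using coset_eq_iff yc x by simp
    then have "c \<odot> (y \<ominus> x) \<in> I" by (rule smult_ideal)
    moreover have "c \<odot> (y \<ominus> x) \<oplus> c \<odot> x = c \<odot> y"
    proof -
      have "c \<odot> (y \<ominus> x) \<oplus> c \<odot> x = c \<odot> (y \<ominus> x \<oplus> x)"
        using k_alg yc x by (simp add: k_algebra_iff)
      then show ?thesis using yc x by (simp add: minus_eq a_assoc l_neg)
    qed
    ultimately have "c \<odot> y \<ominus> c \<odot> x \<in> I"
      using yc x a_Hcarr[OF \<open>c \<odot> (y \<ominus> x) \<in> I\<close>]
      by (metis add.inv_solve_right' minus_eq smult_closed)
    then show ?thesis using coset_eq_iff yc x by simp
  qed
  then have "(\<Union>y\<in>I +> x. I +> (c \<odot> y)) = (\<Union>y\<in>I +> x. I +> (c \<odot> x))"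
    by (intro SUP_cong refl)
  moreover have "I +> x \<noteq> {}" using a_rcos_self[OF x] by blast
  ultimately show ?thesis unfolding quotient_algebra_def module.simps by (simp only: UN_constant if_False)
qed

lemma k_algebra_quotient: "k_algebra (quotient_algebra A I)"
  unfolding k_algebra_iff
proof (intro conjI allI ballI)
  show "ring (quotient_algebra A I)"
    by (rule ring_cong[OF quotient_is_ring]) simp_all
  note K = k_alg[unfolded k_algebra_iff]
  fix c d
  fix u assume "u \<in> carrier (quotient_algebra A I)"
  then obtain x where x: "x \<in> carrier A" and u: "u = I +> x" by (auto simp: carrier_quotient)
  show "c \<odot>\<^bsub>quotient_algebra A I\<^esub> u \<in> carrier (quotient_algebra A I)"
    using x by (auto simp: u quotient_smult carrier_quotient)
  show "(c + d) \<odot>\<^bsub>quotient_algebra A I\<^esub> u =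
      c \<odot>\<^bsub>quotient_algebra A I\<^esub> u \<oplus>\<^bsub>quotient_algebra A I\<^esub> d \<odot>\<^bsub>quotient_algebra A I\<^esub> u"
    using x K by (simp add: u quotient_smult quotient_add)
  show "(c * d) \<odot>\<^bsub>quotient_algebra A I\<^esub> u = c \<odot>\<^bsub>quotient_algebra A I\<^esub> (d \<odot>\<^bsub>quotient_algebra A I\<^esub> u)"
    using x K by (simp add: u quotient_smult)
  show "1 \<odot>\<^bsub>quotient_algebra A I\<^esub> u = u"
    using x K by (simp add: u quotient_smult)
  fix v assume "v \<in> carrier (quotient_algebra A I)"
  then obtain y where y: "y \<in> carrier A" and v: "v = I +> y" by (auto simp: carrier_quotient)
  show "c \<odot>\<^bsub>quotient_algebra A I\<^esub> (u \<oplus>\<^bsub>quotient_algebra A I\<^esub> v) =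
      c \<odot>\<^bsub>quotient_algebra A I\<^esub> u \<oplus>\<^bsub>quotient_algebra A I\<^esub> c \<odot>\<^bsub>quotient_algebra A I\<^esub> v"
    using x y K by (simp add: u v quotient_smult quotient_add)
  show "c \<odot>\<^bsub>quotient_algebra A I\<^esub> u \<otimes>\<^bsub>quotient_algebra A I\<^esub> v =
      c \<odot>\<^bsub>quotient_algebra A I\<^esub> (u \<otimes>\<^bsub>quotient_algebra A I\<^esub> v)"
    using x y K by (simp add: u v quotient_smult quotient_mult)
  show "u \<otimes>\<^bsub>quotient_algebra A I\<^esub> (c \<odot>\<^bsub>quotient_algebra A I\<^esub> v) =
      c \<odot>\<^bsub>quotient_algebra A I\<^esub> (u \<otimes>\<^bsub>quotient_algebra A I\<^esub> v)"
    using x y K by (simp add: u v quotient_smult quotient_mult)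
qed

end

section \<open>Free algebras\<close>

lemma scal_mult: "scal a * f = pm_scale a f"
  by (simp add: scal_def pm_scale_def mult_map_scale_conv_mult)

lemma free_algebra_carrier:
  "f \<in> carrier (free_algebra G) \<longleftrightarrow> (\<forall>w\<in>keys f. set (letters w) \<subseteq> G)"
  by (simp add: free_algebra_def)

lemma free_algebra_simps [simp]:
  "monoid.mult (free_algebra G) = (*)" "one (free_algebra G) = 1"
  "ring.zero (free_algebra G) = 0" "add (free_algebra G) = (+)"
  "c \<odot>\<^bsub>free_algebra G\<^esub> f = scal c * f"
  by (simp_all add: free_algebra_def)

lemma letters_word [simp]: "letters (u + v) = letters u @ letters v" "letters 0 = []"
  by (simp_all add: plus_word_def zero_word_def)

lemma k_algebra_free: "k_algebra (free_algebra G :: ('k::field, 'g word \<Rightarrow>\<^sub>0 'k) module)"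
proof -
  let ?F = "free_algebra G :: ('k::field, 'g word \<Rightarrow>\<^sub>0 'k) module"
  have add: "f + g \<in> carrier ?F" if "f \<in> carrier ?F" "g \<in> carrier ?F" for f g
    using that keys_add[of f g] by (auto simp: free_algebra_carrier)
  have mult: "f * g \<in> carrier ?F" if "f \<in> carrier ?F" "g \<in> carrier ?F" for f g
    using that keys_mult[of f g] by (fastforce simp: free_algebra_carrier)
  have scale: "scal c * f \<in> carrier ?F" if "f \<in> carrier ?F" for c f
    using that by (auto simp: free_algebra_carrier scal_mult in_keys_iff)
  have "abelian_group ?F"
  proof (rule abelian_groupI)
    fix f assume "f \<in> carrier ?F"
    then have "- f \<in> carrier ?F" "- f \<oplus>\<^bsub>?F\<^esub> f = \<zero>\<^bsub>?F\<^esub>"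
      by (auto simp: free_algebra_carrier in_keys_iff)
    then show "\<exists>g\<in>carrier ?F. g \<oplus>\<^bsub>?F\<^esub> f = \<zero>\<^bsub>?F\<^esub>" by blast
  qed (simp_all add: add add_ac free_algebra_carrier[of 0])
  moreover have "Group.monoid ?F"
    by (rule monoidI) (simp_all add: mult mult.assoc free_algebra_carrier[of 1])
  ultimately have "ring ?F"
    by (rule ringI) (simp_all add: distrib_left distrib_right)
  moreover have "f * pm_scale c g = pm_scale c (f * g)" for c and f g :: "'g word \<Rightarrow>\<^sub>0 'k"
  proof -
    have "f * (scal c) = scal c * f"
      by (induction f rule: pm_induct) (simp_all add: scal_def mult_single algebra_simps)
    then show ?thesis unfolding scal_mult[symmetric] by (metis mult.assoc)
  qed
  moreover have "pm_scale c f * g = pm_scale c (f * g)" for c and f g :: "'g word \<Rightarrow>\<^sub>0 'k"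
    unfolding scal_mult[symmetric] by (simp add: mult.assoc)
  ultimately show ?thesis
    unfolding k_algebra_iff using scale
    by (simp add: scal_mult pm.scale_left_distrib pm.scale_right_distrib)
qed

lemma ore_domain_cong:
  assumes A: "k_algebra A" and B: "ore_domain B"
    and h: "h \<in> algebra_hom A B" "bij_betw h (carrier A) (carrier B)"
  shows "ore_domain A"
proof -
  interpret A: ring A using A by (simp add: k_algebra_iff)
  interpret B: ore_domain B by (rule B)
  have h_closed [simp]: "h x \<in> carrier B" if "x \<in> carrier A" for x
    using h(1) that by (auto simp: algebra_hom_def ring_hom_def)
  have h_mult: "h (x \<otimes>\<^bsub>A\<^esub> y) = h x \<otimes>\<^bsub>B\<^esub> h y" if "x \<in> carrier A" "y \<in> carrier A" for x y
    using h(1) that by (auto simp: algebra_hom_def ring_hom_def)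
  have h_add: "h (x \<oplus>\<^bsub>A\<^esub> y) = h x \<oplus>\<^bsub>B\<^esub> h y" if "x \<in> carrier A" "y \<in> carrier A" for x y
    using h(1) that by (auto simp: algebra_hom_def ring_hom_def)
  have h_one: "h \<one>\<^bsub>A\<^esub> = \<one>\<^bsub>B\<^esub>"
    using h(1) by (auto simp: algebra_hom_def ring_hom_def)
  have h_zero: "h \<zero>\<^bsub>A\<^esub> = \<zero>\<^bsub>B\<^esub>"
    using h_add[of "\<zero>\<^bsub>A\<^esub>" "\<zero>\<^bsub>A\<^esub>"] B.add.l_cancel_one[of "h \<zero>\<^bsub>A\<^esub>" "h \<zero>\<^bsub>A\<^esub>"] by simp
  have inj: "x = y" if "h x = h y" "x \<in> carrier A" "y \<in> carrier A" for x y
    using h(2) that by (auto simp: bij_betw_def dest: inj_onD)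
  have zero_iff: "h x = \<zero>\<^bsub>B\<^esub> \<longleftrightarrow> x = \<zero>\<^bsub>A\<^esub>" if "x \<in> carrier A" for x
    using inj[of x "\<zero>\<^bsub>A\<^esub>"] that h_zero by auto
  have surj: "\<exists>x\<in>carrier A. y = h x" if "y \<in> carrier B" for y
    using h(2) that unfolding bij_betw_def by blast
  show ?thesis
  proof
    show "k_algebra A" by (rule A)
    show "\<one>\<^bsub>A\<^esub> \<noteq> \<zero>\<^bsub>A\<^esub>" using B.one_not_zero h_one h_zero by metis
  next
    fix x y assume xy: "x \<in> carrier A" "y \<in> carrier A" "x \<otimes>\<^bsub>A\<^esub> y = \<zero>\<^bsub>A\<^esub>"
    then have "h x \<otimes>\<^bsub>B\<^esub> h y = \<zero>\<^bsub>B\<^esub>" using h_mult h_zero by metis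
    then show "x = \<zero>\<^bsub>A\<^esub> \<or> y = \<zero>\<^bsub>A\<^esub>" using B.integral[of "h x" "h y"] xy zero_iff by simp
  next
    fix a s assume as: "a \<in> carrier A" "s \<in> carrier A" "s \<noteq> \<zero>\<^bsub>A\<^esub>"
    obtain c v where cv: "c \<in> carrier B" "v \<in> carrier B" "v \<noteq> \<zero>\<^bsub>B\<^esub>" "h s \<otimes>\<^bsub>B\<^esub> c = h a \<otimes>\<^bsub>B\<^esub> v"
      using B.right_ore[of "h a" "h s"] as zero_iff by auto
    obtain c' v' where c': "c' \<in> carrier A" "v' \<in> carrier A" "c = h c'" "v = h v'"
      using surj[OF cv(1)] surj[OF cv(2)] by auto
    have "s \<otimes>\<^bsub>A\<^esub> c' = a \<otimes>\<^bsub>A\<^esub> v'"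
      using cv(4) as c' by (intro inj) (simp_all add: h_mult)
    moreover have "v' \<in> carrier A - {\<zero>\<^bsub>A\<^esub>}" using c' cv(3) zero_iff by auto
    ultimately show "\<exists>c\<in>carrier A. \<exists>v\<in>carrier A - {\<zero>\<^bsub>A\<^esub>}. s \<otimes>\<^bsub>A\<^esub> c = a \<otimes>\<^bsub>A\<^esub> v"
      using c'(1) by blast
  next
    fix a s assume as: "a \<in> carrier A" "s \<in> carrier A" "s \<noteq> \<zero>\<^bsub>A\<^esub>"
    obtain c v where cv: "c \<in> carrier B" "v \<in> carrier B" "v \<noteq> \<zero>\<^bsub>B\<^esub>" "c \<otimes>\<^bsub>B\<^esub> h s = v \<otimes>\<^bsub>B\<^esub> h a"
      using B.left_ore[of "h a" "h s"] as zero_iff by auto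
    obtain c' v' where c': "c' \<in> carrier A" "v' \<in> carrier A" "c = h c'" "v = h v'"
      using surj[OF cv(1)] surj[OF cv(2)] by auto
    have "c' \<otimes>\<^bsub>A\<^esub> s = v' \<otimes>\<^bsub>A\<^esub> a"
      using cv(4) as c' by (intro inj) (simp_all add: h_mult)
    moreover have "v' \<in> carrier A - {\<zero>\<^bsub>A\<^esub>}" using c' cv(3) zero_iff by auto
    ultimately show "\<exists>c\<in>carrier A. \<exists>v\<in>carrier A - {\<zero>\<^bsub>A\<^esub>}. c \<otimes>\<^bsub>A\<^esub> s = v \<otimes>\<^bsub>A\<^esub> a"
      using c'(1) by blast
  qed
qed

section \<open>Evaluation of noncommutative polynomials and presented algebras\<close>

context unital_algebra
begin

definition word_value :: "('g \<Rightarrow> 'a) \<Rightarrow> 'g word \<Rightarrow> 'a" where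
  "word_value \<xi> w = foldr (\<lambda>g y. \<xi> g \<star> y) (letters w) unit"

abbreviation evaluate :: "('g \<Rightarrow> 'a) \<Rightarrow> ('g word \<Rightarrow>\<^sub>0 'k) \<Rightarrow> 'a" where
  "evaluate \<xi> \<equiv> linear_ext (word_value \<xi>)"

lemma word_value_add: "word_value \<xi> (u + v) = word_value \<xi> u \<star> word_value \<xi> v"
proof -
  have *: "foldr (\<lambda>g y. \<xi> g \<star> y) us z = foldr (\<lambda>g y. \<xi> g \<star> y) us unit \<star> z" for us z
    by (induction us) (simp_all add: mul_assoc)
  show ?thesis by (simp add: word_value_def) (rule *)
qed

lemma evaluate_mult: "evaluate \<xi> (f * g) = evaluate \<xi> f \<star> evaluate \<xi> g"
proof (induction f rule: pm_induct)
  case (single u c)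
  show ?case
    by (induction g rule: pm_induct)
      (simp_all add: linear_ext_add mul_add_right mult_single word_value_add mul_scale_left
        mul_scale_right distrib_left)
qed (simp_all add: linear_ext_add mul_add_left distrib_right)

lemma evaluate_one: "evaluate \<xi> 1 = unit"
  by (simp add: word_value_def flip: single_one)

lemma evaluate_gen: "evaluate \<xi> (gen g) = \<xi> g"
  by (simp add: gen_def word_value_def)

lemma evaluate_scal: "evaluate \<xi> (scal c) = c *s unit"
  by (simp add: scal_def word_value_def)

lemma is_subalgebra_UNIV: "is_subalgebra UNIV"
  by (simp add: is_subalgebra_def)

lemma evaluate_hom: "evaluate \<xi> \<in> algebra_hom (free_algebra G) (subalgebra_record UNIV)"
  unfolding algebra_hom_def ring_hom_def
  by (auto simp: linear_ext_add evaluate_mult evaluate_one evaluate_scal mul_scale_left)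

text \<open>The kernel of evaluation is a two-sided ideal containing the relations, and the
  generated ideal is the least such.\<close>

lemma evaluate_genideal:
  fixes \<xi> :: "'g \<Rightarrow> 'a"
  assumes R: "R \<subseteq> carrier (free_algebra G)" "\<And>r. r \<in> R \<Longrightarrow> evaluate \<xi> r = 0"
    and f: "f \<in> genideal (free_algebra G) R"
  shows "evaluate \<xi> f = 0"
proof -
  let ?F = "free_algebra G :: ('k, 'g word \<Rightarrow>\<^sub>0 'k) module"
  interpret F: ring ?F
    using k_algebra_free[of G, where 'k = 'k] unfolding k_algebra_iff by (rule conjunct1)
  interpret T: ring "subalgebra_record UNIV"
    by (rule k_algebra_subalgebra[OF is_subalgebra_UNIV, unfolded k_algebra_iff, THEN conjunct1])
  interpret ev: ring_hom_ring ?F "subalgebra_record UNIV" "evaluate \<xi>"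
    by (rule ring_hom_ringI2[OF F.ring_axioms T.ring_axioms])
      (rule evaluate_hom[of \<xi> G, unfolded algebra_hom_def, THEN CollectD, THEN conjunct1])
  have kernel: "g \<in> a_kernel ?F (subalgebra_record UNIV) (evaluate \<xi>) \<longleftrightarrow>
      g \<in> carrier ?F \<and> evaluate \<xi> g = 0" for g
    unfolding a_kernel_def' by simp
  have "R \<subseteq> a_kernel ?F (subalgebra_record UNIV) (evaluate \<xi>)"
    unfolding subset_iff kernel using subsetD[OF R(1)] R(2) by blast
  then have "genideal ?F R \<subseteq> a_kernel ?F (subalgebra_record UNIV) (evaluate \<xi>)"
    by (intro F.genideal_minimal ev.kernel_is_ideal)
  then show ?thesis using f kernel by blast
qed

text \<open>Taking the image of the free algebra builds in the surjectivity of the induced map;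
  \<open>generated_least\<close> recovers the usual minimality.\<close>

definition generated :: "('g \<Rightarrow> 'a) \<Rightarrow> 'g set \<Rightarrow> 'a set" where
  "generated \<xi> G = evaluate \<xi> ` carrier (free_algebra G)"

lemma is_subalgebra_generated:
  fixes \<xi> :: "'g \<Rightarrow> 'a"
  shows "is_subalgebra (generated \<xi> G)"
proof -
  interpret F: ring "free_algebra G :: ('k, 'g word \<Rightarrow>\<^sub>0 'k) module"
    using k_algebra_free[of G, where 'k = 'k] by (simp add: k_algebra_iff)
  let ?F = "free_algebra G :: ('k, 'g word \<Rightarrow>\<^sub>0 'k) module"
  have scale: "scal c * f \<in> carrier ?F" if "f \<in> carrier ?F" for c f
    using k_algebra_free[of G, where 'k = 'k] that unfolding k_algebra_iff by (metis free_algebra_simps(5))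
  have g: "evaluate \<xi> f \<in> generated \<xi> G" if "f \<in> carrier ?F" for f
    using that by (simp only: generated_def image_eqI)
  show ?thesis
    unfolding is_subalgebra_def subspace_def
  proof (intro conjI ballI allI)
    show "0 \<in> generated \<xi> G" using g[OF F.zero_closed] by simp
    show "unit \<in> generated \<xi> G" using g[OF F.one_closed] by (simp add: evaluate_one)
    fix y z assume "y \<in> generated \<xi> G" "z \<in> generated \<xi> G"
    then obtain f h where fh: "f \<in> carrier ?F" "h \<in> carrier ?F" "y = evaluate \<xi> f" "z = evaluate \<xi> h"
      by (auto simp only: generated_def)
    show "y + z \<in> generated \<xi> G" using g[OF F.a_closed[OF fh(1,2)]] fh(3,4) by (simp add: linear_ext_add)
    show "y \<star> z \<in> generated \<xi> G" using g[OF F.m_closed[OF fh(1,2)]] fh(3,4) by (simp add: evaluate_mult)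
  next
    fix c y assume "y \<in> generated \<xi> G"
    then obtain f where f: "f \<in> carrier ?F" "y = evaluate \<xi> f"
      by (auto simp only: generated_def)
    show "c *s y \<in> generated \<xi> G" using g[OF scale[OF f(1), of c]] f(2)
      by (simp add: evaluate_mult evaluate_scal mul_scale_left)
  qed
qed

lemma generated_least:
  assumes W: "is_subalgebra W" and \<xi>: "\<And>g. g \<in> G \<Longrightarrow> \<xi> g \<in> W"
  shows "generated \<xi> G \<subseteq> W"
proof -
  have "foldr (\<lambda>g y. \<xi> g \<star> y) us unit \<in> W" if "set us \<subseteq> G" for us
    using that by (induction us) (auto intro!: is_subalgebraD[OF W] \<xi>)
  then have "word_value \<xi> w \<in> W" if "set (letters w) \<subseteq> G" for w
    using that by (simp add: word_value_def)
  then show ?thesis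
    by (auto simp: generated_def linear_ext_def free_algebra_carrier intro!: is_subalgebraD[OF W])
qed

lemma generator_in_generated: "g \<in> G \<Longrightarrow> \<xi> g \<in> generated \<xi> G"
  unfolding generated_def
  by (rule image_eqI[of _ _ "gen g"]) (simp_all add: evaluate_gen, simp add: free_algebra_carrier gen_def)

text \<open>First isomorphism theorem: evaluating to zero is equivalent to lying in the ideal, one
  direction by \<open>evaluate_genideal\<close>, the other by the assumption
  \<open>faithful\<close>.\<close>

lemma presented_algebra_isomorphism:
  fixes \<xi> :: "'g \<Rightarrow> 'a" and R :: "('g word \<Rightarrow>\<^sub>0 'k) set"
  assumes R: "R \<subseteq> carrier (free_algebra G)" "\<And>r. r \<in> R \<Longrightarrow> evaluate \<xi> r = 0"
    and faithful: "\<And>f. f \<in> carrier (free_algebra G) \<Longrightarrow> evaluate \<xi> f = 0 \<Longrightarrow>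
      f \<in> genideal (free_algebra G) R"
  shows "k_algebra (presented_algebra G R)"
    and "\<exists>h \<in> algebra_hom (presented_algebra G R) (subalgebra_record (generated \<xi> G)).
      bij_betw h (carrier (presented_algebra G R)) (generated \<xi> G)"
proof -
  let ?F = "free_algebra G :: ('k, 'g word \<Rightarrow>\<^sub>0 'k) module"
  define I where "I = genideal ?F R"
  interpret F: ring ?F using k_algebra_free[of G, where 'k = 'k] by (simp add: k_algebra_iff)
  have "ideal I ?F" unfolding I_def by (rule F.genideal_ideal[OF R(1)])
  then interpret I: algebra_ideal I ?F
    using k_algebra_free[of G, where 'k = 'k] by (simp add: algebra_ideal_def algebra_ideal_axioms_def)
  have A: "presented_algebra G R = quotient_algebra ?F I"
    by (simp add: presented_algebra_def I_def)
  show "k_algebra (presented_algebra G R)" unfolding A by (rule I.k_algebra_quotient)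
  have ker: "evaluate \<xi> f = 0 \<longleftrightarrow> f \<in> I" if "f \<in> carrier ?F" for f
    using faithful[OF that] evaluate_genideal[OF R] unfolding I_def by blast
  have minus: "f \<ominus>\<^bsub>?F\<^esub> g = f - g" if "f \<in> carrier ?F" "g \<in> carrier ?F" for f g
  proof -
    have "f \<ominus>\<^bsub>?F\<^esub> g \<oplus>\<^bsub>?F\<^esub> g = f" using that by (simp only: F.minus_eq F.a_assoc F.a_inv_closed F.l_neg F.r_zero)
    then show ?thesis by (simp add: eq_diff_eq)
  qed
  have coset: "I +>\<^bsub>?F\<^esub> f = I +>\<^bsub>?F\<^esub> g \<longleftrightarrow> evaluate \<xi> f = evaluate \<xi> g"
    if "f \<in> carrier ?F" "g \<in> carrier ?F" for f g
    using I.coset_eq_iff[OF that] ker[OF F.minus_closed[OF that]] minus[OF that]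
    by (simp add: linear_ext_diff)
  define h where "h C = evaluate \<xi> (SOME f. f \<in> carrier ?F \<and> C = I +>\<^bsub>?F\<^esub> f)" for C
  have h: "h (I +>\<^bsub>?F\<^esub> f) = evaluate \<xi> f" if "f \<in> carrier ?F" for f
  proof -
    have "\<exists>g. g \<in> carrier ?F \<and> I +>\<^bsub>?F\<^esub> f = I +>\<^bsub>?F\<^esub> g" using that by blast
    note g = someI_ex[OF this]
    show ?thesis
      unfolding h_def by (rule coset[OF that g[THEN conjunct1], THEN iffD1, symmetric]) (rule g[THEN conjunct2])
  qed
  have carr: "\<exists>f\<in>carrier ?F. C = I +>\<^bsub>?F\<^esub> f" if "C \<in> carrier (presented_algebra G R)" for C
    using that unfolding A quotient_algebra_simps I.carrier_quotient by blast
  have carr': "I +>\<^bsub>?F\<^esub> f \<in> carrier (presented_algebra G R)" if "f \<in> carrier ?F" for f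
    using that unfolding A quotient_algebra_simps I.carrier_quotient by blast
  have "h \<in> algebra_hom (presented_algebra G R) (subalgebra_record (generated \<xi> G))"
    unfolding algebra_hom_def mem_Collect_eq
  proof (intro conjI ring_hom_memI allI ballI)
    fix C assume "C \<in> carrier (presented_algebra G R)"
    then obtain f where f: "f \<in> carrier ?F" "C = I +>\<^bsub>?F\<^esub> f" using carr by blast
    show "h C \<in> carrier (subalgebra_record (generated \<xi> G))"
      using f(1) by (simp only: f(2) h subalgebra_record_simps generated_def image_eqI)
    show "h (c \<odot>\<^bsub>presented_algebra G R\<^esub> C) = c \<odot>\<^bsub>subalgebra_record (generated \<xi> G)\<^esub> h C" for c
      unfolding A f(2) I.quotient_smult[OF f(1)] h[OF I.smult_closed[OF f(1)]] h[OF f(1)]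
      by (simp add: evaluate_mult evaluate_scal mul_scale_left)
    fix D assume "D \<in> carrier (presented_algebra G R)"
    then obtain g where g: "g \<in> carrier ?F" "D = I +>\<^bsub>?F\<^esub> g" using carr by blast
    show "h (C \<otimes>\<^bsub>presented_algebra G R\<^esub> D) = h C \<otimes>\<^bsub>subalgebra_record (generated \<xi> G)\<^esub> h D"
      unfolding A f(2) g(2) quotient_algebra_simps I.quotient_mult[OF f(1) g(1)]
        h[OF F.m_closed[OF f(1) g(1)]] h[OF f(1)] h[OF g(1)]
      by (simp add: evaluate_mult)
    show "h (C \<oplus>\<^bsub>presented_algebra G R\<^esub> D) = h C \<oplus>\<^bsub>subalgebra_record (generated \<xi> G)\<^esub> h D"
      unfolding A f(2) g(2) quotient_algebra_simps I.quotient_add[OF f(1) g(1)]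
        h[OF F.a_closed[OF f(1) g(1)]] h[OF f(1)] h[OF g(1)]
      by (simp add: linear_ext_add)
  next
    show "h \<one>\<^bsub>presented_algebra G R\<^esub> = \<one>\<^bsub>subalgebra_record (generated \<xi> G)\<^esub>"
      unfolding A using h[OF F.one_closed] by (simp add: FactRing_def evaluate_one)
  qed
  moreover have "bij_betw h (carrier (presented_algebra G R)) (generated \<xi> G)"
    unfolding bij_betw_def
  proof
    show "inj_on h (carrier (presented_algebra G R))"
    proof (rule inj_onI)
      fix C D assume CD: "C \<in> carrier (presented_algebra G R)" "D \<in> carrier (presented_algebra G R)" "h C = h D"
      obtain f g where fg: "f \<in> carrier ?F" "C = I +>\<^bsub>?F\<^esub> f" "g \<in> carrier ?F" "D = I +>\<^bsub>?F\<^esub> g"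
        using carr CD(1,2) by blast
      then show "C = D" using CD(3) h coset by metis
    qed
    show "h ` carrier (presented_algebra G R) = generated \<xi> G"
    proof
      show "h ` carrier (presented_algebra G R) \<subseteq> generated \<xi> G"
        using calculation by (auto simp: algebra_hom_def ring_hom_def)
      show "generated \<xi> G \<subseteq> h ` carrier (presented_algebra G R)"
      proof
        fix y assume "y \<in> generated \<xi> G"
        then obtain f where "f \<in> carrier ?F" "y = evaluate \<xi> f" unfolding generated_def by blast
        then show "y \<in> h ` carrier (presented_algebra G R)" using h carr' by (metis image_eqI)
      qed
    qed
  qed
  ultimately show "\<exists>h \<in> algebra_hom (presented_algebra G R) (subalgebra_record (generated \<xi> G)).
      bij_betw h (carrier (presented_algebra G R)) (generated \<xi> G)" by blast
qed

end


section \<open>Straightening\<close>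

definition sorted_word :: "'g set \<Rightarrow> ('g \<Rightarrow> nat) \<Rightarrow> 'g word \<Rightarrow> bool" where
  "sorted_word G pos w \<longleftrightarrow> set (letters w) \<subseteq> G \<and> sorted (map pos (letters w))"

text \<open>A descent \<open>a b\<close> is rewritten into words \<open>c d\<close> with \<open>c < a\<close>. This makes words of a fixed
  length lexicographically smaller, so it terminates although the number of inversions may grow.\<close>

locale straightening =
  fixes G :: "'g set" and pos :: "'g \<Rightarrow> nat" and R :: "('g word \<Rightarrow>\<^sub>0 'k::field) set"
  assumes relations: "R \<subseteq> carrier (free_algebra G)"
    and straighten: "\<lbrakk>a \<in> G; b \<in> G; pos b < pos a\<rbrakk> \<Longrightarrow>
      \<exists>f. gen a * gen b - f \<in> genideal (free_algebra G) R \<and>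
        (\<forall>w\<in>keys f. \<exists>c\<in>G. \<exists>d\<in>G. letters w = [c, d] \<and> pos c < pos a)"
begin

abbreviation "I \<equiv> genideal (free_algebra G) R"

sublocale F: ring "free_algebra G :: ('k, 'g word \<Rightarrow>\<^sub>0 'k) module"
  using k_algebra_free[of G, where 'k = 'k] unfolding k_algebra_iff by (rule conjunct1)

sublocale I: algebra_ideal I "free_algebra G"
  using k_algebra_free[of G, where 'k = 'k] F.genideal_ideal[OF relations]
  by (simp add: algebra_ideal_def algebra_ideal_axioms_def)

lemma I_add: "f \<in> I \<Longrightarrow> g \<in> I \<Longrightarrow> f + g \<in> I"
  using I.a_closed[of f g] by simp

lemma I_scale: "f \<in> I \<Longrightarrow> pm_scale c f \<in> I"
  using I.smult_ideal[of f c] by (simp add: scal_mult)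

lemma I_zero: "0 \<in> I"
  using I.zero_closed by simp

lemma I_mult: "f \<in> I \<Longrightarrow> h \<in> carrier (free_algebra G) \<Longrightarrow> h * f \<in> I"
  "f \<in> I \<Longrightarrow> h \<in> carrier (free_algebra G) \<Longrightarrow> f * h \<in> I"
  using I.I_l_closed[of f h] I.I_r_closed[of f h] by simp_all

definition reducible :: "('g word \<Rightarrow>\<^sub>0 'k) \<Rightarrow> bool" where
  "reducible f \<longleftrightarrow> (\<exists>g. f - g \<in> I \<and> (\<forall>w\<in>keys g. sorted_word G pos w))"

lemma reducible_add:
  assumes "reducible f" "reducible g"
  shows "reducible (f + g)"
proof -
  obtain f' g' where *: "f - f' \<in> I" "\<forall>w\<in>keys f'. sorted_word G pos w"
    "g - g' \<in> I" "\<forall>w\<in>keys g'. sorted_word G pos w"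
    using assms unfolding reducible_def by blast
  have "(f + g) - (f' + g') \<in> I" using I_add[OF *(1,3)] by (simp add: algebra_simps)
  moreover have "\<forall>w\<in>keys (f' + g'). sorted_word G pos w" using keys_add[of f' g'] *(2,4) by blast
  ultimately show ?thesis unfolding reducible_def by blast
qed

lemma reducible_scale:
  assumes "reducible f"
  shows "reducible (pm_scale c f)"
proof -
  obtain f' where *: "f - f' \<in> I" "\<forall>w\<in>keys f'. sorted_word G pos w"
    using assms unfolding reducible_def by blast
  have "pm_scale c f - pm_scale c f' \<in> I" using I_scale[OF *(1), of c] by (simp add: pm.scale_right_diff_distrib)
  moreover have "\<forall>w\<in>keys (pm_scale c f'). sorted_word G pos w" using *(2) by (auto simp: in_keys_iff)
  ultimately show ?thesis unfolding reducible_def by blast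
qed

lemma reducible_zero: "reducible 0"
  unfolding reducible_def using I_zero by (intro exI[of _ 0]) simp

lemma reducible_sum: "(\<And>x. x \<in> B \<Longrightarrow> reducible (f x)) \<Longrightarrow> reducible (sum f B)"
  by (induction B rule: infinite_finite_induct) (simp_all add: reducible_zero reducible_add)

lemma reducible_words:
  assumes "\<And>w. w \<in> keys f \<Longrightarrow> reducible (Poly_Mapping.single w 1)"
  shows "reducible f"
proof -
  have "reducible (\<Sum>w\<in>keys f. pm_scale (lookup f w) (Poly_Mapping.single w 1))"
    by (intro reducible_sum reducible_scale assms)
  then show ?thesis using pm_expand[of f] by simp
qed

lemma reducible_cong: "reducible g \<Longrightarrow> f - g \<in> I \<Longrightarrow> reducible f"
proof -
  assume "reducible g" and fg: "f - g \<in> I"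
  then obtain h where h: "g - h \<in> I" "\<forall>w\<in>keys h. sorted_word G pos w"
    unfolding reducible_def by blast
  have "f - h \<in> I" using I_add[OF fg h(1)] by simp
  then show ?thesis using h(2) unfolding reducible_def by blast
qed

lemma reducible_word:
  "set (letters w) \<subseteq> G \<Longrightarrow> reducible (Poly_Mapping.single w 1)"
proof (induction w rule: wf_induct_rule[OF wf_inv_image[OF wf_lenlex[OF wf_less_than]],
      where f1 = "\<lambda>w. map pos (letters w)"])
  case (1 w)
  show ?case
  proof (cases "sorted (map pos (letters w))")
    case True
    then show ?thesis unfolding reducible_def using 1(2) I_zero
      by (intro exI[of _ "Poly_Mapping.single w 1"]) (simp add: sorted_word_def)
  next
    case False
    then obtain i where i: "Suc i < length (letters w)" "pos (letters w ! Suc i) < pos (letters w ! i)"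
      by (auto simp: sorted_iff_nth_Suc not_le)
    define u v a b where "u = take i (letters w)" and "v = drop (Suc (Suc i)) (letters w)"
      and "a = letters w ! i" and "b = letters w ! Suc i"
    have w: "letters w = u @ a # b # v"
      using i(1) by (simp add: u_def v_def a_def b_def Cons_nth_drop_Suc id_take_nth_drop)
    then have G: "set u \<subseteq> G" "set v \<subseteq> G" "a \<in> G" "b \<in> G" using 1(2) by auto
    have ba: "pos b < pos a" using i(2) by (simp add: a_def b_def)
    obtain f where f: "gen a * gen b - f \<in> I"
        "\<And>x. x \<in> keys f \<Longrightarrow> \<exists>c\<in>G. \<exists>d\<in>G. letters x = [c, d] \<and> pos c < pos a"
      using straighten[OF G(3,4) ba] by blast
    let ?U = "Poly_Mapping.single (Word u) (1::'k)" and ?V = "Poly_Mapping.single (Word v) (1::'k)"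
    have "w = Word u + (Word [a] + Word [b]) + Word v"
      using w by (cases w) (simp add: plus_word_def)
    then have "Poly_Mapping.single w 1 = ?U * (gen a * gen b) * ?V"
      by (simp add: gen_def mult_single)
    moreover have "?U * (gen a * gen b) * ?V - ?U * f * ?V = ?U * (gen a * gen b - f) * ?V"
      by (simp add: left_diff_distrib right_diff_distrib)
    moreover have "?U * (gen a * gen b - f) * ?V \<in> I"
      using G(1,2) by (intro I_mult f(1)) (simp_all add: free_algebra_carrier)
    ultimately have *: "Poly_Mapping.single w 1 - ?U * f * ?V \<in> I" by simp
    have "reducible (?U * f * ?V)"
    proof (rule reducible_words)
      fix y assume y: "y \<in> keys (?U * f * ?V)"
      then obtain x where "x \<in> keys f" "y = Word u + x + Word v"
        using subsetD[OF keys_mult y] subsetD[OF keys_mult[of ?U f]] by fastforce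
      then obtain c d where cd: "c \<in> G" "d \<in> G" "pos c < pos a" "letters y = u @ [c, d] @ v"
        using f(2) by fastforce
      \<comment> \<open>Lengths agree and the prefix \<open>u\<close> is shared, so the drop from
        \<open>a\<close> to \<open>c\<close> decides the comparison, however large the position of
        \<open>d\<close> is.\<close>
      have "(map pos (letters y), map pos (letters w)) \<in> lenlex less_than"
        using cd(3,4) w by (simp add: lenlex_conv lex_append_leftI)
      moreover have "set (letters y) \<subseteq> G" using cd G by auto
      ultimately show "reducible (Poly_Mapping.single y 1)" by (intro 1(1)) (simp_all add: inv_image_def)
    qed
    then show ?thesis using * by (rule reducible_cong)
  qed
qed

lemma reducible_all: "f \<in> carrier (free_algebra G) \<Longrightarrow> reducible f"
  by (rule reducible_words) (simp add: reducible_word free_algebra_carrier)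

end

section \<open>Faithfulness by leading exponents\<close>

context twisted_group_algebra
begin

lemma leading_word_value:
  assumes "\<And>g. g \<in> G \<Longrightarrow> leading (\<xi> g) (\<epsilon> g)" "set (letters w) \<subseteq> G"
  shows "leading (word_value \<xi> w) (\<Sum>g\<leftarrow>letters w. \<epsilon> g)"
proof -
  have "leading (foldr (\<lambda>g y. \<xi> g \<star> y) us tone) (\<Sum>g\<leftarrow>us. \<epsilon> g)" if "set us \<subseteq> G" for us
    using that
  proof (induction us)
    case Nil
    show ?case using leading_single[of 1 0] by simp
  next
    case (Cons g us)
    then show ?case using leading_mul[OF assms(1)] by simp
  qed
  then show ?thesis using assms(2) by (simp add: word_value_def)
qed

text \<open>Among the words in the support, the one with the largest exponent sum is unique by
  \<open>inj\<close>. No other word contributes to that exponent, so nothing can cancel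
  there.\<close>

lemma evaluate_sorted_nonzero:
  assumes lead: "\<And>g. g \<in> G \<Longrightarrow> leading (\<xi> g) (\<epsilon> g)"
    and inj: "\<And>u w. sorted_word G pos u \<Longrightarrow> sorted_word G pos w \<Longrightarrow>
      (\<Sum>g\<leftarrow>letters u. \<epsilon> g) = (\<Sum>g\<leftarrow>letters w. \<epsilon> g) \<Longrightarrow> u = w"
    and f: "\<And>w. w \<in> keys f \<Longrightarrow> sorted_word G pos w" "f \<noteq> 0"
  shows "evaluate \<xi> f \<noteq> 0"
proof -
  define \<sigma> where "\<sigma> w = (\<Sum>g\<leftarrow>letters w. \<epsilon> g)" for w :: "'a word"
  have "keys f \<noteq> {}" using f(2) pm_expand[of f] by auto
  then obtain w where w: "w \<in> keys f" "\<And>u. u \<in> keys f \<Longrightarrow> \<sigma> u \<le> \<sigma> w"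
    using Max_in[of "\<sigma> ` keys f"] Max_ge[of "\<sigma> ` keys f"] by fastforce
  have l: "leading (word_value \<xi> u) (\<sigma> u)" if "u \<in> keys f" for u
    unfolding \<sigma>_def using f(1)[OF that] by (intro leading_word_value[of G] lead) (auto simp: sorted_word_def)
  have "lookup (word_value \<xi> u) (\<sigma> w) = 0" if u: "u \<in> keys f" "u \<noteq> w" for u
  proof (rule ccontr)
    assume "lookup (word_value \<xi> u) (\<sigma> w) \<noteq> 0"
    then have "\<sigma> w \<le> \<sigma> u" using l[OF u(1)] by (simp add: leading_def in_keys_iff)
    then have "\<sigma> u = \<sigma> w" using w(2)[OF u(1)] by simp
    then show False using inj f(1) u w(1) unfolding \<sigma>_def by blast
  qed
  then have "lookup (evaluate \<xi> f) (\<sigma> w) = (\<Sum>u\<in>keys f. if u = w then lookup f w * lookup (word_value \<xi> w) (\<sigma> w) else 0)"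
    unfolding lookup_linear_ext by (intro sum.cong) auto
  also have "\<dots> = lookup f w * lookup (word_value \<xi> w) (\<sigma> w)" using w(1) by simp
  also have "\<dots> \<noteq> 0" using w(1) l[OF w(1)] by (simp add: leading_def in_keys_iff)
  finally show ?thesis by auto
qed

text \<open>Modulo the ideal, \<open>f\<close> equals a combination \<open>g\<close> of sorted
  words; \<open>g\<close> evaluates to zero and is therefore zero itself. No basis theorem for the
  presented algebra is presupposed.\<close>

lemma presented_algebra_faithful:
  fixes \<xi> :: "'g \<Rightarrow> 'e \<Rightarrow>\<^sub>0 'k"
  assumes "straightening G pos R" and R: "\<And>r. r \<in> R \<Longrightarrow> evaluate \<xi> r = 0"
    and lead: "\<And>g. g \<in> G \<Longrightarrow> leading (\<xi> g) (\<epsilon> g)"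
    and inj: "\<And>u w. sorted_word G pos u \<Longrightarrow> sorted_word G pos w \<Longrightarrow>
      (\<Sum>g\<leftarrow>letters u. \<epsilon> g) = (\<Sum>g\<leftarrow>letters w. \<epsilon> g) \<Longrightarrow> u = w"
    and f: "f \<in> carrier (free_algebra G)" "evaluate \<xi> f = 0"
  shows "f \<in> genideal (free_algebra G) R"
proof -
  interpret straightening G pos R by (rule assms(1))
  obtain g where g: "f - g \<in> I" "\<forall>w\<in>keys g. sorted_word G pos w"
    using reducible_all[OF f(1)] unfolding reducible_def by blast
  have "evaluate \<xi> (f - g) = 0" by (rule evaluate_genideal[OF relations R g(1)])
  then have "evaluate \<xi> g = 0" using f(2) by (simp add: linear_ext_diff)
  then have "g = 0"
    using evaluate_sorted_nonzero[of G \<xi> \<epsilon> pos g, OF lead inj] g(2) by blast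
  then show ?thesis using g(1) by simp
qed

end

text \<open>The coefficient of the exponent sum at \<open>r\<close> counts the letters at position
  \<open>r\<close>. So the sum determines the multiset of positions, which determines the sorted
  list.\<close>

lemma sorted_word_exponent_inj:
  fixes G :: "'g set" and pos :: "'g \<Rightarrow> nat"
  assumes pos: "inj_on pos G" and uw: "sorted_word G pos u" "sorted_word G pos w"
    and eq: "(\<Sum>g\<leftarrow>letters u. monom (1::int) (pos g)) = (\<Sum>g\<leftarrow>letters w. monom 1 (pos g))"
  shows "u = w"
proof -
  have c: "coeff (\<Sum>g\<leftarrow>us. monom (1::int) (pos g)) r = int (count (mset (map pos us)) r)" for us r
    by (induction us) auto
  have "count (mset (map pos (letters u))) r = count (mset (map pos (letters w))) r" for r
    using c[of "letters u" r] c[of "letters w" r] eq by simp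
  then have "mset (map pos (letters u)) = mset (map pos (letters w))" by (rule multiset_eqI)
  then have "map pos (letters u) = map pos (letters w)"
    using uw unfolding sorted_word_def by (metis properties_for_sort sorted_sort_id)
  moreover have "inj_on pos (set (letters u) \<union> set (letters w))"
    using uw by (intro inj_on_subset[OF pos]) (auto simp: sorted_word_def)
  ultimately have "letters u = letters w" by (rule map_inj_on)
  then show ?thesis by (cases u, cases w) simp
qed


section \<open>Quantum tori\<close>

text \<open>For \<open>s < r\<close> the product \<open>\<tau> s \<star> \<tau> r\<close> is a plain
  basis element and \<open>\<tau> r \<star> \<tau> s\<close> is \<open>q r s\<close> times it.
  Monomials whose degree lies outside \<open>{1..N}\<close> are central.\<close>

definition torus_cocycle :: "nat \<Rightarrow> (nat \<Rightarrow> nat \<Rightarrow> 'k::field) \<Rightarrow> int poly \<Rightarrow> int poly \<Rightarrow> 'k" where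
  "torus_cocycle N q P Q = (\<Prod>r\<in>{1..N}. \<Prod>s\<in>{1..<r}. q r s powi (coeff P r * coeff Q s))"

text \<open>The exponent lattice is realised inside \<open>int poly\<close> because that type already carries a
  group order, namely the one determined by the sign of the leading coefficient.\<close>

locale quantum_torus =
  fixes N :: nat and q :: "nat \<Rightarrow> nat \<Rightarrow> 'k::field"
  assumes antisym: "mult_antisymmetric N q"
begin

lemma q_nonzero: "r \<in> {1..N} \<Longrightarrow> s \<in> {1..N} \<Longrightarrow> q r s \<noteq> 0"
  using mult_antisymmetricD[OF antisym] by blast

sublocale twisted_group_algebra "torus_cocycle N q"
proof
  fix x y z :: "int poly"
  show "torus_cocycle N q (x + y) z = torus_cocycle N q x z * torus_cocycle N q y z"
    unfolding torus_cocycle_def prod.distrib[symmetric]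
    by (intro prod.cong refl) (simp add: distrib_right power_int_add q_nonzero)
  show "torus_cocycle N q x (y + z) = torus_cocycle N q x y * torus_cocycle N q x z"
    unfolding torus_cocycle_def prod.distrib[symmetric]
    by (intro prod.cong refl) (simp add: distrib_left power_int_add q_nonzero)
  show "torus_cocycle N q x y \<noteq> 0"
    unfolding torus_cocycle_def by (simp add: q_nonzero)
qed

notation tmul (infixl \<open>\<star>\<close> 70)

definition \<tau> :: "nat \<Rightarrow> int poly \<Rightarrow>\<^sub>0 'k" where
  "\<tau> r = Poly_Mapping.single (monom 1 r) 1"

definition \<tau>' :: "nat \<Rightarrow> int poly \<Rightarrow>\<^sub>0 'k" where
  "\<tau>' r = Poly_Mapping.single (- monom 1 r) 1"

lemma torus_cocycle_monom:
  assumes "r \<in> {1..N}" "s \<in> {1..N}"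
  shows "torus_cocycle N q (monom a r) (monom b s) = (if s < r then q r s powi (a * b) else 1)"
proof -
  have "torus_cocycle N q (monom a r) (monom b s) =
    (\<Prod>r'\<in>{1..N}. if r' = r then (if s < r then q r s powi (a * b) else 1) else 1)"
    unfolding torus_cocycle_def
  proof (rule prod.cong[OF refl])
    fix r' assume "r' \<in> {1..N}"
    have "(\<Prod>s'\<in>{1..<r'}. q r' s' powi (coeff (monom a r) r' * coeff (monom b s) s')) =
      (\<Prod>s'\<in>{1..<r'}. if s' = s then (if r' = r then q r s powi (a * b) else 1) else 1)"
      by (rule prod.cong) auto
    also have "\<dots> = (if r' = r then (if s < r then q r s powi (a * b) else 1) else 1)"
      using assms by (simp add: prod.delta)
    finally show "(\<Prod>s'\<in>{1..<r'}. q r' s' powi (coeff (monom a r) r' * coeff (monom b s) s')) =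
      (if r' = r then (if s < r then q r s powi (a * b) else 1) else 1)" .
  qed
  then show ?thesis using assms by (simp add: prod.delta)
qed

lemma \<tau>_commute:
  assumes "r \<in> {1..N}" "s \<in> {1..N}"
  shows "\<tau> r \<star> \<tau> s = pm_scale (q r s) (\<tau> s \<star> \<tau> r)"
proof -
  have "q r r = 1" "q r s * q s r = 1"
    using mult_antisymmetricD[OF antisym assms] q_nonzero[OF assms] by simp_all
  moreover have "r < s \<or> r = s \<or> s < r" by auto
  ultimately show ?thesis
    using assms by (auto simp: \<tau>_def torus_cocycle_monom add.commute)
qed

lemma \<tau>_inverse:
  assumes "r \<in> {1..N}"
  shows "\<tau> r \<star> \<tau>' r = tone" "\<tau>' r \<star> \<tau> r = tone"
  using assms torus_cocycle_monom[of r r 1 "-1"] torus_cocycle_monom[of r r "-1" 1]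
  by (simp_all add: \<tau>_def \<tau>'_def minus_monom add_monom)

lemma leading_\<tau>: "leading (\<tau> r) (monom 1 r)" "leading (\<tau>' r) (- monom 1 r)"
  by (simp_all add: \<tau>_def \<tau>'_def leading_single)

abbreviation affine_relations :: "(nat word \<Rightarrow>\<^sub>0 'k) set" where
  "affine_relations \<equiv> {gen i * gen j - scal (q i j) * gen j * gen i | i j. i \<in> {1..N} \<and> j \<in> {1..N}}"

lemma straightening_affine: "straightening {1..N} id affine_relations"
proof
  let ?F = "free_algebra {1..N} :: ('k, nat word \<Rightarrow>\<^sub>0 'k) module"
  interpret F: ring ?F
    using k_algebra_free[of "{1..N}", where 'k = 'k] unfolding k_algebra_iff by (rule conjunct1)
  have g: "scal c * gen j * gen i = Poly_Mapping.single (Word [j, i]) c" for c :: 'k and i j :: nat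
    by (simp add: scal_def gen_def mult_single plus_word_def zero_word_def)
  show rel: "affine_relations \<subseteq> carrier ?F"
  proof clarify
    fix i j assume ij: "i \<in> {1..N}" "j \<in> {1..N}"
    have "gen i * gen j - scal (q i j) * gen j * gen i =
        Poly_Mapping.single (Word [i, j]) 1 - Poly_Mapping.single (Word [j, i]) (q i j)"
      unfolding g by (simp add: gen_def mult_single plus_word_def)
    then show "gen i * gen j - scal (q i j) * gen j * gen i \<in> carrier ?F"
      using ij keys_diff[of "Poly_Mapping.single (Word [i, j]) (1::'k)" "Poly_Mapping.single (Word [j, i]) (q i j)"]
      by (fastforce simp: free_algebra_carrier split: if_splits)
  qed
  fix a b assume ab: "a \<in> {1..N}" "b \<in> {1..N}" "id b < id a"
  have "gen a * gen b - Poly_Mapping.single (Word [b, a]) (q a b) \<in> genideal ?F affine_relations"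
    using ab F.genideal_self[OF rel] unfolding g[symmetric] by blast
  then show "\<exists>f. gen a * gen b - f \<in> genideal ?F affine_relations \<and>
      (\<forall>w\<in>keys f. \<exists>c\<in>{1..N}. \<exists>d\<in>{1..N}. letters w = [c, d] \<and> id c < id a)"
    using ab by (intro exI[of _ "Poly_Mapping.single (Word [b, a]) (q a b)"]) auto
qed

lemma affine_isomorphism:
  "k_algebra (quantum_affine_space N q)"
  "\<exists>h \<in> algebra_hom (quantum_affine_space N q) (subalgebra_record (generated \<tau> {1..N})).
    bij_betw h (carrier (quantum_affine_space N q)) (generated \<tau> {1..N})"
proof -
  have ev: "evaluate \<tau> r = 0" if r: "r \<in> affine_relations" for r
  proof -
    obtain i j where "i \<in> {1..N}" "j \<in> {1..N}" "r = gen i * gen j - scal (q i j) * gen j * gen i"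
      using r by blast
    then show ?thesis
      using \<tau>_commute[of i j]
      by (simp add: pm.linear_ext_diff evaluate_mult evaluate_gen evaluate_scal mul_scale_left)
  qed
  have inj: "inj_on id {1..N}" by simp
  have faithful: "f \<in> genideal (free_algebra {1..N}) affine_relations"
    if "f \<in> carrier (free_algebra {1..N})" "evaluate \<tau> f = 0" for f
    by (rule presented_algebra_faithful[where \<epsilon> = "\<lambda>r. monom 1 (id r)" and pos = id,
          OF straightening_affine ev _ sorted_word_exponent_inj[OF inj]])
      (use that leading_\<tau> in simp_all)
  note P = presented_algebra_isomorphism[OF straightening.relations[OF straightening_affine] ev faithful]
  show "k_algebra (quantum_affine_space N q)"
    unfolding quantum_affine_space_def by (rule P(1))
  show "\<exists>h \<in> algebra_hom (quantum_affine_space N q) (subalgebra_record (generated \<tau> {1..N})).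
    bij_betw h (carrier (quantum_affine_space N q)) (generated \<tau> {1..N})"
    unfolding quantum_affine_space_def by (rule P(2))
qed

end


section \<open>Quantum matrices inside the quantum torus\<close>

definition lex_index :: "nat \<Rightarrow> nat \<times> nat \<Rightarrow> nat" where
  "lex_index n x = (fst x - 1) * n + snd x"

lemma lex_index:
  assumes "i \<in> {1..n}" "a \<in> {1..n}"
  shows "lex_index n (i, a) \<in> {1..n^2}" "lex_pair n (lex_index n (i, a)) = (i, a)"
proof -
  have "(i - 1) * n + a \<le> (i - 1) * n + n" using assms by simp
  also have "\<dots> = i * n" using assms by (cases i) simp_all
  also have "\<dots> \<le> n * n" using assms by simp
  finally show "lex_index n (i, a) \<in> {1..n^2}"
    using assms by (simp add: lex_index_def power2_eq_square)
  obtain i' a' where "i = Suc i'" "a = Suc a'" "a' < n" using assms by (cases i; cases a) auto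
  then show "lex_pair n (lex_index n (i, a)) = (i, a)"
    by (simp add: lex_index_def lex_pair_def)
qed

lemma lex_index_less:
  assumes "i < k" "i \<ge> 1" "a \<le> n" "b \<ge> 1"
  shows "lex_index n (i, a) < lex_index n (k, b)"
proof -
  have "(i - 1) * n + a \<le> i * n" using assms by (cases i) simp_all
  also have "\<dots> \<le> (k - 1) * n" using assms by (intro mult_right_mono) auto
  finally show ?thesis using assms by (simp add: lex_index_def)
qed

lemma inj_on_lex_index: "inj_on (lex_index n) ({1..n} \<times> {1..n})"
  by (rule inj_on_inverseI[of _ "lex_pair n"]) (auto simp: lex_index(2))

lemma lex_index_surj:
  assumes "r \<in> {1..n^2}"
  obtains i a where "i \<in> {1..n}" "a \<in> {1..n}" "r = lex_index n (i, a)"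
proof -
  obtain i a where ia: "lex_pair n r = (i, a)" by (metis surj_pair)
  then have 1: "i \<in> {1..n}" "a \<in> {1..n}" using lex_pair_in[OF assms] by auto
  have "r = lex_index n (i, a)"
    using inj_onD[OF bij_betw_imp_inj_on[OF lex_pair_bij], of n r "lex_index n (i, a)"]
      assms lex_index[OF 1] ia by simp
  then show ?thesis using that 1 by blast
qed

text \<open>The sign of a polynomial is that of its leading coefficient, so the largest index
  present decides every comparison.\<close>

lemma exponent_less:
  fixes P :: "int poly"
  assumes "degree P < r"
  shows "0 < monom 1 r + P"
proof -
  have "lead_coeff (monom 1 r + P) > 0"
    using assms lead_coeff_add_le[of P "monom 1 r"] by (simp add: degree_monom_eq add.commute)
  then show ?thesis
    unfolding less_poly_def by (simp add: pos_poly_def last_coeffs_eq_coeff_degree)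
qed

locale quantum_matrix_torus =
  fixes n :: nat and lam :: "'k::field" and p :: "nat \<Rightarrow> nat \<Rightarrow> 'k"
  assumes lam: "lam \<noteq> 0" and p_antisym: "mult_antisymmetric n p"
begin

sublocale quantum_torus "n^2" "Lambda_matrix n lam p"
  by unfold_locales (rule Lambda_matrix_antisymmetric[OF lam p_antisym])

notation tmul (infixl \<open>\<star>\<close> 70)

definition t where "t i a = \<tau> (lex_index n (i, a))"
definition t' where "t' i a = \<tau>' (lex_index n (i, a))"

lemma t_inverse:
  assumes "i \<in> {1..n}" "a \<in> {1..n}"
  shows "t i a \<star> t' i a = tone" "t' i a \<star> t i a = tone"
  unfolding t_def t'_def using \<tau>_inverse lex_index(1)[OF assms] by blast+

lemma t_commute:
  assumes "i \<in> {1..n}" "a \<in> {1..n}" "j \<in> {1..n}" "b \<in> {1..n}"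
  shows "t i a \<star> t j b = pm_scale (Lambda_entry lam p (i, a) (j, b)) (t j b \<star> t i a)"
  unfolding t_def using \<tau>_commute[OF lex_index(1)[OF assms(1,2)] lex_index(1)[OF assms(3,4)]]
  unfolding Lambda_matrix_def lex_index(2)[OF assms(1,2)] lex_index(2)[OF assms(3,4)] .

lemma t_commute_rows:
  assumes "i \<in> {1..n}" "a \<in> {1..n}" "j \<in> {1..n}" "b \<in> {1..n}" "i > j"
  shows "t i a \<star> t j b = pm_scale ((if a \<le> b then lam else 1) * p i j * p b a) (t j b \<star> t i a)"
  using t_commute[OF assms(1-4)] assms(5) by (simp add: Lambda_entry_def)

lemma t_commute_row:
  assumes "i \<in> {1..n}" "a \<in> {1..n}" "b \<in> {1..n}"
  shows "t i a \<star> t i b = pm_scale (p b a) (t i b \<star> t i a)"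
  using t_commute[OF assms(1,2,1,3)] by (simp add: Lambda_entry_def)

text \<open>Stage \<open>l\<close> has rows \<open>1\<close> to \<open>l\<close> in place, starting
  from the empty matrix. All other rows are zero by default, which keeps the recursion free of range
  conditions.\<close>

fun matrix_entry :: "nat \<Rightarrow> nat \<Rightarrow> nat \<Rightarrow> int poly \<Rightarrow>\<^sub>0 'k" where
  "matrix_entry 0 i j = 0"
| "matrix_entry (Suc l) i j =
    (if i = Suc l then t (Suc l) j
     else (\<Sum>m\<in>{j..n}. matrix_entry l i m \<star> t' (Suc l) m) \<star> t (Suc l) j)"

text \<open>The second conjunct, commutation with the torus generators of all later rows, is carried
  along because each row step assumes it for its new row.\<close>

lemma matrix_entry_relations:
  "l \<le> n \<Longrightarrow> quantum_rows n lam p l (matrix_entry l) \<and>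
    (\<forall>i\<in>{1..l}. \<forall>r\<in>{l+1..n}. \<forall>m\<in>{1..n}. \<forall>j\<in>{1..n}.
      t r m \<star> matrix_entry l i j =
        pm_scale ((if m \<le> j then lam else 1) * p r i * p j m) (matrix_entry l i j \<star> t r m))"
proof (induction l)
  case 0
  show ?case by (simp add: quantum_rows_def)
next
  case (Suc l)
  then have IH: "quantum_rows n lam p l (matrix_entry l)"
    "\<And>i r m j. \<lbrakk>i \<in> {1..l}; r \<in> {l+1..n}; m \<in> {1..n}; j \<in> {1..n}\<rbrakk> \<Longrightarrow>
      t r m \<star> matrix_entry l i j =
        pm_scale ((if m \<le> j then lam else 1) * p r i * p j m) (matrix_entry l i j \<star> t r m)"
    by auto
  interpret row_step pm_scale tmul tone n "Suc l" lam p "matrix_entry l" "t (Suc l)" "t' (Suc l)"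
  proof
    show "Suc l \<in> {1..n}" using Suc.prems by simp
    then show "t (Suc l) m \<star> t' (Suc l) m = tone" "t' (Suc l) m \<star> t (Suc l) m = tone"
      if "m \<in> {1..n}" for m
      using t_inverse that by blast+
    show "t (Suc l) m \<star> t (Suc l) j = pm_scale (p j m) (t (Suc l) j \<star> t (Suc l) m)"
      if "m \<in> {1..n}" "j \<in> {1..n}" for m j
      using t_commute_row \<open>Suc l \<in> {1..n}\<close> that by blast
    show "t (Suc l) m \<star> matrix_entry l i j =
      pm_scale ((if m \<le> j then lam else 1) * p (Suc l) i * p j m) (matrix_entry l i j \<star> t (Suc l) m)"
      if "i \<in> {1..<Suc l}" "m \<in> {1..n}" "j \<in> {1..n}" for i m j
      using that \<open>Suc l \<in> {1..n}\<close> by (intro IH(2)) auto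
    show "quantum_rows n lam p (Suc l - 1) (matrix_entry l)" using IH(1) by simp
  qed (rule lam p_antisym)+
  have z: "z = matrix_entry (Suc l)"
    by (intro ext) (simp add: z_def S_def v_def)
  have "t r m \<star> matrix_entry (Suc l) i j =
      pm_scale ((if m \<le> j then lam else 1) * p r i * p j m) (matrix_entry (Suc l) i j \<star> t r m)"
    if "i \<in> {1..Suc l}" "r \<in> {Suc l+1..n}" "m \<in> {1..n}" "j \<in> {1..n}" for i r m j
  proof (cases "i = Suc l")
    case True
    then show ?thesis using t_commute_rows[of r m "Suc l" j] that by simp
  next
    case False
    then have i: "i \<in> {1..<Suc l}" and r: "r \<in> {1..n}" using that by auto
    show ?thesis unfolding z[symmetric]
    proof (rule row_step_below[OF i r that(3,4)])
      fix j assume j: "j \<in> {1..n}"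
      show "t r m \<star> matrix_entry l i j =
          pm_scale ((if m \<le> j then lam else 1) * p r i * p j m) (matrix_entry l i j \<star> t r m)"
        using that i j by (intro IH(2)) auto
      show "t r m \<star> t (Suc l) j =
          pm_scale ((if m \<le> j then lam else 1) * p r (Suc l) * p j m) (t (Suc l) j \<star> t r m)"
        using that j by (intro t_commute_rows) auto
    qed
  qed
  then show ?case using quantum_rows_step unfolding z by blast
qed

text \<open>In the summand \<open>m = j\<close> the two torus factors cancel and the old entry
  remains. For \<open>m > j\<close> the exponent contains a negative monomial at the index of
  \<open>(Suc l, m)\<close>, which exceeds all other indices involved, so the summand lies
  below.\<close>

lemma leading_matrix_entry:
  "\<lbrakk>l \<le> n; i \<in> {1..l}; j \<in> {1..n}\<rbrakk> \<Longrightarrow> leading (matrix_entry l i j) (monom 1 (lex_index n (i, j)))"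
proof (induction l arbitrary: i j)
  case 0
  then show ?case by simp
next
  case (Suc l)
  let ?e = "\<lambda>i j. monom (1::int) (lex_index n (i, j))"
  show ?case
  proof (cases "i = Suc l")
    case True
    then show ?thesis by (simp add: t_def leading_\<tau>)
  next
    case False
    then have i: "i \<in> {1..l}" "l \<le> n" "Suc l \<in> {1..n}" using Suc.prems by auto
    have lead: "leading (matrix_entry l i m \<star> t' (Suc l) m \<star> t (Suc l) j)
        (?e i m + - ?e (Suc l) m + ?e (Suc l) j)" if "m \<in> {1..n}" for m
      unfolding t_def t'_def by (intro leading_mul leading_\<tau> Suc.IH i that)
    have eq: "matrix_entry (Suc l) i j = matrix_entry l i j \<star> t' (Suc l) j \<star> t (Suc l) j +
        (\<Sum>m\<in>{Suc j..n}. matrix_entry l i m \<star> t' (Suc l) m \<star> t (Suc l) j)"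
      using False Suc.prems(3) by (simp add: sum.atLeast_Suc_atMost mul_add_left mul_sum_left)
    have "leading (matrix_entry l i j \<star> t' (Suc l) j \<star> t (Suc l) j) (?e i j)"
      using lead[OF Suc.prems(3)] by simp
    moreover have "y < ?e i j"
      if y: "y \<in> keys (\<Sum>m\<in>{Suc j..n}. matrix_entry l i m \<star> t' (Suc l) m \<star> t (Suc l) j)" for y
    proof -
      obtain m where m: "m \<in> {Suc j..n}" "y \<in> keys (matrix_entry l i m \<star> t' (Suc l) m \<star> t (Suc l) j)"
        using subsetD[OF keys_sum y] by blast
      then have m': "m \<in> {1..n}" by auto
      have "y \<le> ?e i m + - ?e (Suc l) m + ?e (Suc l) j"
        using lead[OF m'] m(2) by (simp add: leading_def)
      also have "\<dots> < ?e i j"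
      proof -
        have "lex_index n (i, m) < lex_index n (Suc l, m)" "lex_index n (i, j) < lex_index n (Suc l, m)"
          "lex_index n (Suc l, j) < lex_index n (Suc l, m)"
          using i m m' Suc.prems(3) lex_index_less[of i "Suc l" m n m] lex_index_less[of i "Suc l" j n m]
          by (simp_all add: lex_index_def)
        then have "degree (?e i j - ?e i m - ?e (Suc l) j) < lex_index n (Suc l, m)"
          by (intro degree_diff_less) (simp_all add: degree_monom_eq)
        from exponent_less[OF this]
        have "0 < ?e (Suc l) m + (?e i j - ?e i m - ?e (Suc l) j)" .
        also have "\<dots> = ?e i j - (?e i m + - ?e (Suc l) m + ?e (Suc l) j)" by simp
        finally show ?thesis by (simp only: diff_gt_0_iff_gt)
      qed
      finally show ?thesis .
    qed
    ultimately show ?thesis unfolding eq by (rule leading_add_less)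
  qed
qed

abbreviation "pairs \<equiv> {1..n} \<times> {1..n}"

definition \<xi> :: "nat \<times> nat \<Rightarrow> int poly \<Rightarrow>\<^sub>0 'k" where
  "\<xi> = (\<lambda>(i, j). matrix_entry n i j)"

text \<open>In every relation the words on the right-hand side start with a letter before
  \<open>(l, m)\<close>. The extra word \<open>x_im x_lj\<close> qualifies as well, since it starts
  in row \<open>i < l\<close>.\<close>

lemma straightening_matrices:
  "straightening pairs (lex_index n) (quantum_matrix_relations n lam p)"
proof
  let ?F = "free_algebra pairs :: ('k, (nat \<times> nat) word \<Rightarrow>\<^sub>0 'k) module"
  let ?R = "quantum_matrix_relations n lam p"
  interpret F: ring ?F
    using k_algebra_free[of pairs, where 'k = 'k] unfolding k_algebra_iff by (rule conjunct1)
  have g: "scal c * gen u * gen w = Poly_Mapping.single (Word [u, w]) c" for c :: 'k and u w :: "nat \<times> nat"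
    by (simp add: scal_def gen_def mult_single plus_word_def zero_word_def)
  have g': "gen u * gen w = Poly_Mapping.single (Word [u, w]) (1::'k)" for u w :: "nat \<times> nat"
    by (simp add: gen_def mult_single plus_word_def)
  have carrier: "Poly_Mapping.single (Word [u, w]) c \<in> carrier ?F" if "u \<in> pairs" "w \<in> pairs" for u w c
    using that by (auto simp: free_algebra_carrier)
  have add: "f + h \<in> carrier ?F" if "f \<in> carrier ?F" "h \<in> carrier ?F" for f h
    using F.a_closed[OF that] by simp
  have diff: "f - h \<in> carrier ?F" if "f \<in> carrier ?F" "h \<in> carrier ?F" for f h
    using that keys_diff[of f h] unfolding free_algebra_carrier by blast
  show rel: "?R \<subseteq> carrier ?F"
    unfolding quantum_matrix_relations_def Let_def g g'
    by (safe; intro diff add carrier; simp)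
  fix u w assume uw: "u \<in> pairs" "w \<in> pairs" "lex_index n w < lex_index n u"
  obtain l m i j where lm: "u = (l, m)" "w = (i, j)" by (metis surj_pair)
  have range: "l \<in> {1..n}" "m \<in> {1..n}" "i \<in> {1..n}" "j \<in> {1..n}" using uw lm by auto
  \<comment> \<open>A smaller position means an earlier row, or the same row and an earlier column;
    the cases match the three families of relations.\<close>
  have "i \<le> l" using lex_index_less[of l i m n j] uw(3) range lm by fastforce
  then consider "i < l" "j < m" | "i < l" "m \<le> j" | "i = l" "j < m"
    using uw(3) lm by (fastforce simp: lex_index_def)
  then show "\<exists>f. gen u * gen w - f \<in> genideal ?F ?R \<and>
      (\<forall>x\<in>keys f. \<exists>c\<in>pairs. \<exists>d\<in>pairs. letters x = [c, d] \<and> lex_index n c < lex_index n u)"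
  proof cases
    case 1
    let ?f = "Poly_Mapping.single (Word [(i, j), (l, m)]) (p l i * p j m) +
      Poly_Mapping.single (Word [(i, m), (l, j)]) ((lam - 1) * p l i)"
    have "gen u * gen w - ?f \<in> ?R"
      unfolding quantum_matrix_relations_def Let_def g lm using range 1 by blast
    moreover have "lex_index n (i, m) < lex_index n (l, m)" "lex_index n (i, j) < lex_index n (l, m)"
      using 1 range by (auto intro!: lex_index_less)
    ultimately show ?thesis
      using F.genideal_self[OF rel] range lm subsetD[OF keys_add]
      by (intro exI[of _ ?f]) (fastforce split: if_splits)
  next
    case 2
    let ?f = "Poly_Mapping.single (Word [(i, j), (l, m)]) (lam * p l i * p j m)"
    have "gen u * gen w - ?f \<in> ?R"
      unfolding quantum_matrix_relations_def Let_def g lm using range 2 by blast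
    then show ?thesis
      using F.genideal_self[OF rel] range lm uw
      by (intro exI[of _ ?f]) (fastforce split: if_splits)
  next
    case 3
    let ?f = "Poly_Mapping.single (Word [(i, j), (l, m)]) (p j m)"
    have "gen u * gen w - ?f \<in> ?R"
      unfolding quantum_matrix_relations_def Let_def g lm using range 3 by blast
    then show ?thesis
      using F.genideal_self[OF rel] range lm uw
      by (intro exI[of _ ?f]) (fastforce split: if_splits)
  qed
qed

lemma matrices_isomorphism:
  "k_algebra (quantum_matrices n lam p)"
  "\<exists>h \<in> algebra_hom (quantum_matrices n lam p) (subalgebra_record (generated \<xi> pairs)).
    bij_betw h (carrier (quantum_matrices n lam p)) (generated \<xi> pairs)"
proof -
  have rows: "(m > j \<and> a > i \<longrightarrow> \<xi> (a, m) \<star> \<xi> (i, j) =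
        pm_scale (p a i * p j m) (\<xi> (i, j) \<star> \<xi> (a, m)) + pm_scale ((lam - 1) * p a i) (\<xi> (i, m) \<star> \<xi> (a, j))) \<and>
      (m \<le> j \<and> a > i \<longrightarrow> \<xi> (a, m) \<star> \<xi> (i, j) = pm_scale (lam * p a i * p j m) (\<xi> (i, j) \<star> \<xi> (a, m))) \<and>
      (m > j \<and> a = i \<longrightarrow> \<xi> (a, m) \<star> \<xi> (i, j) = pm_scale (p j m) (\<xi> (i, j) \<star> \<xi> (a, m)))"
    if "a \<in> {1..n}" "i \<in> {1..n}" "m \<in> {1..n}" "j \<in> {1..n}" for a i m j
    using matrix_entry_relations[of n, THEN conjunct1] that unfolding quantum_rows_def \<xi>_def prod.case by blast
  note ev_simps = pm.linear_ext_diff pm.linear_ext_add evaluate_mult evaluate_gen evaluate_scal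
    mul_scale_left unit_mul
  have ev: "evaluate \<xi> r = 0" if r: "r \<in> quantum_matrix_relations n lam p" for r
    using r unfolding quantum_matrix_relations_def Let_def
  proof (elim UnE CollectE exE conjE, goal_cases)
    case (1 l m i j)
    then show ?case using rows[of l i m j] by (simp only: ev_simps) simp
  next
    case (2 l m i j)
    then show ?case using rows[of l i m j] by (simp only: ev_simps) simp
  next
    case (3 l m i j)
    then show ?case using rows[of l i m j] by (simp only: ev_simps) simp
  qed
  have lead: "leading (\<xi> g) (monom 1 (lex_index n g))" if "g \<in> pairs" for g
    using that by (auto simp: \<xi>_def intro!: leading_matrix_entry)
  have faithful: "f \<in> genideal (free_algebra pairs) (quantum_matrix_relations n lam p)"
    if "f \<in> carrier (free_algebra pairs)" "evaluate \<xi> f = 0" for f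
    by (rule presented_algebra_faithful[where \<epsilon> = "\<lambda>g. monom 1 (lex_index n g)",
          OF straightening_matrices ev lead sorted_word_exponent_inj[OF inj_on_lex_index] that])
  note P = presented_algebra_isomorphism[OF straightening.relations[OF straightening_matrices] ev faithful]
  show "k_algebra (quantum_matrices n lam p)"
    unfolding quantum_matrices_def by (rule P(1))
  show "\<exists>h \<in> algebra_hom (quantum_matrices n lam p) (subalgebra_record (generated \<xi> pairs)).
    bij_betw h (carrier (quantum_matrices n lam p)) (generated \<xi> pairs)"
    unfolding quantum_matrices_def by (rule P(2))
qed

section \<open>Comparison of the two subalgebras of the torus\<close>

lemma matrix_entries_in_fraction_closure:
  "generated \<xi> pairs \<subseteq> fraction_closure (generated \<tau> {1..n^2})"
proof -
  let ?W = "fraction_closure (generated \<tau> {1..n^2})"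
  have W: "is_subalgebra ?W" by (intro subalgebra_fraction_closure is_subalgebra_generated)
  have t: "t i a \<in> ?W" if "i \<in> {1..n}" "a \<in> {1..n}" for i a
    unfolding t_def by (rule subsetD[OF subset_fraction_closure[OF is_subalgebra_generated]
          generator_in_generated[OF lex_index(1)[OF that]]])
  have t': "t' i a \<in> ?W" if "i \<in> {1..n}" "a \<in> {1..n}" for i a
    by (rule fraction_closure_inverse[OF t[OF that] t_inverse(2)[OF that]])
  \<comment> \<open>All \<open>i\<close> are treated at once: entries in rows outside
    \<open>{1..l}\<close> are zero.\<close>
  have "matrix_entry l i j \<in> ?W" if "l \<le> n" "j \<in> {1..n}" for l i j
    using that
  proof (induction l arbitrary: i j)
    case 0
    show ?case using is_subalgebraD(2)[OF W] by simp
  next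
    case (Suc l)
    then have l: "Suc l \<in> {1..n}" by simp
    have "matrix_entry l i m \<star> t' (Suc l) m \<in> ?W" if "m \<in> {j..n}" for m
      using that Suc by (intro is_subalgebraD(4)[OF W] t' l) auto
    then have "(\<Sum>m\<in>{j..n}. matrix_entry l i m \<star> t' (Suc l) m) \<star> t (Suc l) j \<in> ?W"
      by (intro is_subalgebraD(4)[OF W is_subalgebraD(8)[OF W] t[OF l Suc.prems(2)]])
    then show ?case using t[OF l Suc.prems(2)] by simp
  qed
  then show ?thesis by (intro generated_least W) (auto simp: \<xi>_def)
qed

text \<open>The row steps are undone from the last one backwards: row \<open>Suc l\<close> of stage
  \<open>Suc l\<close> consists of torus generators, multiplying the other entries by their inverses
  gives the tail sums, and differences of consecutive tail sums return stage
  \<open>l\<close>.\<close>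

lemma torus_generators_in_fraction_closure:
  "generated \<tau> {1..n^2} \<subseteq> fraction_closure (generated \<xi> pairs)"
proof -
  let ?W = "fraction_closure (generated \<xi> pairs)"
  have W: "is_subalgebra ?W" by (intro subalgebra_fraction_closure is_subalgebra_generated)
  have entries: "\<forall>i\<in>{1..l}. \<forall>j\<in>{1..n}. matrix_entry l i j \<in> ?W" if "l \<le> n" for l
    using that
  proof (induction l rule: inc_induct)
    case base
    have "matrix_entry n i j \<in> ?W" if "i \<in> {1..n}" "j \<in> {1..n}" for i j
      using subsetD[OF subset_fraction_closure[OF is_subalgebra_generated]
          generator_in_generated[of "(i, j)" pairs \<xi>]] that by (simp add: \<xi>_def)
    then show ?case by blast
  next
    case (step l)
    then have l: "Suc l \<in> {1..n}" by simp
    have t: "t (Suc l) j \<in> ?W" if "j \<in> {1..n}" for j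
      using step(3) that by force
    have t': "t' (Suc l) j \<in> ?W" if "j \<in> {1..n}" for j
      by (rule fraction_closure_inverse[OF t[OF that] t_inverse(2)[OF l that]])
    show ?case
    proof (intro ballI)
      fix i j assume i: "i \<in> {1..l}" and j: "j \<in> {1..n}"
      define S where "S k = (\<Sum>m\<in>{k..n}. matrix_entry l i m \<star> t' (Suc l) m)" for k
      \<comment> \<open>Stated for all \<open>k \<ge> 1\<close> because the difference at
        \<open>j = n\<close> involves the empty sum \<open>S (Suc n)\<close>.\<close>
      have S: "S k \<in> ?W" if "k \<ge> 1" for k
      proof (cases "k \<le> n")
        case True
        then have k: "k \<in> {1..n}" using that by simp
        have "matrix_entry (Suc l) i k \<star> t' (Suc l) k = S k \<star> (t (Suc l) k \<star> t' (Suc l) k)"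
          using i by (simp add: S_def mul_assoc)
        then have "matrix_entry (Suc l) i k \<star> t' (Suc l) k = S k" using t_inverse(1)[OF l k] by simp
        moreover have "i \<in> {1..Suc l}" using i by simp
        then have "matrix_entry (Suc l) i k \<in> ?W" using step(3) k by blast
        then have "matrix_entry (Suc l) i k \<star> t' (Suc l) k \<in> ?W" by (rule is_subalgebraD(4)[OF W _ t'[OF k]])
        ultimately show ?thesis by simp
      next
        case False
        then show ?thesis using is_subalgebraD(2)[OF W] by (simp add: S_def)
      qed
      have "(S j - S (Suc j)) \<star> t (Suc l) j = matrix_entry l i j \<star> (t' (Suc l) j \<star> t (Suc l) j)"
        using j by (simp add: S_def sum.atLeast_Suc_atMost mul_assoc)
      also have "\<dots> = matrix_entry l i j" using t_inverse(2)[OF l j] by simp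
      finally show "matrix_entry l i j \<in> ?W"
        using j by (metis S t is_subalgebraD(4,7)[OF W] atLeastAtMost_iff le_SucI)
    qed
  qed
  have "\<tau> r \<in> ?W" if r: "r \<in> {1..n^2}" for r
  proof -
    obtain i a where ia: "i \<in> {1..n}" "a \<in> {1..n}" "r = lex_index n (i, a)"
      using r by (rule lex_index_surj)
    \<comment> \<open>The generators \<open>t i a\<close> form the last row of stage
      \<open>i\<close>.\<close>
    have "matrix_entry i i a \<in> ?W" using entries[of i] ia by auto
    moreover have "matrix_entry i i a = \<tau> r" using ia by (cases i) (auto simp: t_def)
    ultimately show ?thesis by simp
  qed
  then show ?thesis by (intro generated_least W)
qed

end

section \<open>Passage to division rings of fractions\<close>

context twisted_group_algebra
begin

text \<open>Each \<open>c\<close> in the closure satisfies \<open>c s \<in> W\<close> for some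
  nonzero \<open>s\<close> in \<open>W\<close>, so enlarging \<open>W\<close> to its closure adds no
  new fractions; the isomorphism with \<open>W\<close> is used as an embedding of \<open>A\<close>
  into the closure.\<close>

lemma Fract_isomorphic_fraction_closure:
  assumes W: "is_subalgebra W" and A: "k_algebra A"
    and ex: "\<exists>h \<in> algebra_hom A (subalgebra_record W). bij_betw h (carrier A) W"
  shows "ore_domain A"
    and "Fract_algebra A \<cong>\<^sub>k Fract_algebra (subalgebra_record (fraction_closure W))"
proof -
  obtain h where h: "h \<in> algebra_hom A (subalgebra_record W)" "bij_betw h (carrier A) W"
    using ex by blast
  show ore: "ore_domain A"
    by (rule ore_domain_cong[OF A ore_domain_subalgebra[OF W] h(1)]) (simp add: h(2))
  have h_closed: "h x \<in> W" if "x \<in> carrier A" for x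
    using h(2) that by (auto simp: bij_betw_def)
  have hom: "h (x \<otimes>\<^bsub>A\<^esub> y) = h x \<star> h y" "h (x \<oplus>\<^bsub>A\<^esub> y) = h x + h y"
    if "x \<in> carrier A" "y \<in> carrier A" for x y
    using h(1) that by (simp_all add: algebra_hom_def ring_hom_def)
  have hom': "h \<one>\<^bsub>A\<^esub> = tone" "x \<in> carrier A \<Longrightarrow> h (c \<odot>\<^bsub>A\<^esub> x) = pm_scale c (h x)" for c x
    using h(1) by (simp_all add: algebra_hom_def ring_hom_def)
  have h': "h \<in> algebra_hom A (subalgebra_record (fraction_closure W))"
    unfolding algebra_hom_def mem_Collect_eq using subsetD[OF subset_fraction_closure[OF W] h_closed]
    by (intro conjI ring_hom_memI allI ballI) (simp_all add: hom hom')
  interpret A: ore_domain A by (rule ore)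
  have zero: "h \<zero>\<^bsub>A\<^esub> = 0"
    using hom(2)[OF A.zero_closed A.zero_closed]
    by (simp only: A.r_zero A.zero_closed add_cancel_right_right)
  show "Fract_algebra A \<cong>\<^sub>k Fract_algebra (subalgebra_record (fraction_closure W))"
  proof (rule Fract_algebra_isomorphic[OF ore ore_domain_subalgebra[OF subalgebra_fraction_closure[OF W]] h'])
    show "inj_on h (carrier A)" using h(2) by (simp add: bij_betw_def)
    fix c assume "c \<in> carrier (subalgebra_record (fraction_closure W))"
    then obtain s where s: "s \<in> W" "s \<noteq> 0" "c \<star> s \<in> W" by (auto simp: fraction_closure_def)
    have img: "h ` carrier A = W" using h(2) by (simp add: bij_betw_def)
    obtain s' a where "s' \<in> carrier A" "s = h s'" "a \<in> carrier A" "c \<star> s = h a"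
      using s(1,3) unfolding img[symmetric] by blast
    moreover from this have "s' \<noteq> \<zero>\<^bsub>A\<^esub>" using s(2) zero by auto
    ultimately show "\<exists>a\<in>carrier A. \<exists>s\<in>carrier A - {\<zero>\<^bsub>A\<^esub>}.
        c \<otimes>\<^bsub>subalgebra_record (fraction_closure W)\<^esub> h s = h a" by auto
  qed
qed

end

theorem mainTheorem9:
  fixes n :: nat and lam :: "'k::field" and p :: "nat \<Rightarrow> nat \<Rightarrow> 'k"
  assumes "n \<ge> 1" and "lam \<noteq> 0" and "mult_antisymmetric n p"
  defines "A \<equiv> quantum_matrices n lam p"
  defines "B \<equiv> quantum_affine_space (n^2) (Lambda_matrix n lam p)"
  shows "division_ring_of_fractions A (Fract_algebra A) (to_Fract_algebra A) \<and>
         division_ring_of_fractions B (Fract_algebra B) (to_Fract_algebra B) \<and>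
         Fract_algebra A \<cong>\<^sub>k Fract_algebra B"
proof -
  interpret quantum_matrix_torus n lam p by unfold_locales (fact assms)+
  let ?U = "generated \<xi> pairs" and ?V = "generated \<tau> {1..n^2}"
  note U = Fract_isomorphic_fraction_closure[OF is_subalgebra_generated matrices_isomorphism, folded A_def]
  note V = Fract_isomorphic_fraction_closure[OF is_subalgebra_generated affine_isomorphism, folded B_def]
  \<comment> \<open>Each subalgebra lies in the closure of the other, so the common closure links
    the two algebras of fractions.\<close>
  have "fraction_closure ?U = fraction_closure ?V"
    using fraction_closure_idem[OF is_subalgebra_generated matrix_entries_in_fraction_closure]
      fraction_closure_idem[OF is_subalgebra_generated torus_generators_in_fraction_closure] by blast
  then have "Fract_algebra A \<cong>\<^sub>k Fract_algebra (subalgebra_record (fraction_closure ?V))"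
    using U(2) by simp
  moreover have "Fract_algebra (subalgebra_record (fraction_closure ?V)) \<cong>\<^sub>k Fract_algebra B"
    using V(2) ore_domain.k_algebra_Q[OF V(1)] by (rule algebra_isomorphic_sym)
  ultimately have "Fract_algebra A \<cong>\<^sub>k Fract_algebra B" by (rule algebra_isomorphic_trans)
  then show ?thesis
    using ore_domain.division_ring_of_fractions_Fract[OF U(1)]
      ore_domain.division_ring_of_fractions_Fract[OF V(1)] by blast
qed

end
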